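(* Let $0<\alpha_0\le\alpha<2$, $c_l,c_K>0$, and assume that $k$ satisfies condition (E$_\ge$) with constant $c_l$ and condition (U2) with constant $c_K$. For any $q>1$ there exists a constant $C$, depending only on $d,q,c_l,c_K$ and $\alpha_0$, such that for every $x_0\in\mathbb{R}^d$, $r>0$ and every $u\in H(\mathbb{R}^d;k)$ satisfying $\mathcal{E}(u,\varphi)\le0$ for every nonnegative $\varphi\in H_{B_r(x_0)}(\mathbb{R}^d;k)$, $$\operatorname*{ess\,sup}_{B_{r/2}(x_0)}u\le C\left(\fint_{B_r(x_0)}u_+^q(x)\,dx\right)^{1/q}+r^\alpha\int_{\mathbb{R}^d\setminus B_{r/2}(x_0)}\frac{u_+(y)}{|y-x_0|^{d+\alpha}}\,dy.$$
   Context: Throughout, $d\ge 3$ and $k:(\mathbb{R}^d\times\mathbb{R}^d)\setminus\{x=y\}\to[0,\infty)$ is a measurable function with $k(x,y)=k(y,x)$ and $\sup_{x\in\mathbb{R}^d}\int_{\mathbb{R}^d}(1\wedge|y-x|^2)k(x,y)\,dy<\infty$. For an open set $U\subset\mathbb{R}^d$ and measurable $u,v$, $\mathcal{E}_U(u,v)=\int_U\int_U(u(y)-u(x))(v(y)-v(x))k(x,y)\,dy\,dx$ (when finite), and $\mathcal{E}=\mathcal{E}_{\mathbb{R}^d}$. For $0<\alpha<2$ let $k^{(\alpha)}(x,y)=\frac{2^\alpha\Gamma((d+\alpha)/2)}{\pi^{d/2}|\Gamma(-\alpha/2)|}|y-x|^{-d-\alpha}$ and let $\mathcal{E}^\alpha_U$,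 $\mathcal{E}^\alpha$ denote the same forms with $k$ replaced by $k^{(\alpha)}$. $H(\mathbb{R}^d;k)=\{u\in L^2(\mathbb{R}^d):\mathcal{E}(u,u)<\infty\}$ and, for open $\Omega$, $H_\Omega(\mathbb{R}^d;k)=\{u\in H(\mathbb{R}^d;k): u=0\text{ a.e. on }\mathbb{R}^d\setminus\Omega\}$. $u_+=\max\{u,0\}$. Condition (E$_\ge$) with constant $c_l>0$: for every ball $B=B_r(x_0)\subset\mathbb{R}^d$ and every $u\in L^2(B)$, $\mathcal{E}_B(u,u)\ge c_l\,\mathcal{E}^\alpha_B(u,u)$. Condition (U2) with constant $c_K>0$: $k(x,y)\le c_K(2-\alpha)|y-x|^{-d-\alpha}$ for a.e. $x,y\in\mathbb{R}^d$. *)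

theory Defs
  imports "HOL-Analysis.Analysis" "HOL-Probability.Essential_Supremum"
begin

text \<open>Jump kernels are functions k :: 'a => 'a => real on a Euclidean space 'a
  (dimension d = DIM('a)); values on the diagonal are irrelevant.\<close>

definition kernel_ok :: "('a::euclidean_space \<Rightarrow> 'a \<Rightarrow> real) \<Rightarrow> bool" where
  "kernel_ok k \<longleftrightarrow>
     (\<lambda>p. k (fst p) (snd p)) \<in> borel_measurable (lborel \<Otimes>\<^sub>M lborel) \<and>
     (\<forall>x y. x \<noteq> y \<longrightarrow> k x y \<ge> 0) \<and>
     (\<forall>x y. x \<noteq> y \<longrightarrow> k x y = k y x) \<and>
     (SUP x. \<integral>\<^sup>+ y. ennreal (min 1 ((norm (y - x))\<^sup>2) * k x y) \<partial>lborel) < \<infinity>"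

definition frac_kernel :: "real \<Rightarrow> 'a::euclidean_space \<Rightarrow> 'a \<Rightarrow> real" where
  "frac_kernel \<alpha> x y =
     (2 powr \<alpha> * Gamma ((real DIM('a) + \<alpha>) / 2)
       / (pi powr (real DIM('a) / 2) * \<bar>Gamma (- \<alpha> / 2)\<bar>))
     * norm (y - x) powr (- real DIM('a) - \<alpha>)"

definition energy :: "('a::euclidean_space \<Rightarrow> 'a \<Rightarrow> real) \<Rightarrow> 'a set \<Rightarrow> ('a \<Rightarrow> real) \<Rightarrow> ennreal" where
  "energy k U u =
     (\<integral>\<^sup>+ p. indicator (U \<times> U) p *
         ennreal ((u (snd p) - u (fst p))\<^sup>2 * k (fst p) (snd p)) \<partial>(lebesgue \<Otimes>\<^sub>M lebesgue))"

text \<open>Bilinear form E_U(u,v) (meaningful when the integrand is integrable,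
  e.g. for u, v in H(R^d;k)).\<close>
definition Eform :: "('a::euclidean_space \<Rightarrow> 'a \<Rightarrow> real) \<Rightarrow> 'a set \<Rightarrow> ('a \<Rightarrow> real) \<Rightarrow> ('a \<Rightarrow> real) \<Rightarrow> real" where
  "Eform k U u v =
     (\<integral> p. indicator (U \<times> U) p *
         ((u (snd p) - u (fst p)) * (v (snd p) - v (fst p)) * k (fst p) (snd p))
       \<partial>(lebesgue \<Otimes>\<^sub>M lebesgue))"

definition Hspace :: "('a::euclidean_space \<Rightarrow> 'a \<Rightarrow> real) \<Rightarrow> ('a \<Rightarrow> real) set" where
  "Hspace k = {u. u \<in> borel_measurable lebesgue \<and> integrable lebesgue (\<lambda>x. (u x)\<^sup>2)
                  \<and> energy k UNIV u < \<infinity>}"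

definition Hspace0 :: "('a::euclidean_space \<Rightarrow> 'a \<Rightarrow> real) \<Rightarrow> 'a set \<Rightarrow> ('a \<Rightarrow> real) set" where
  "Hspace0 k \<Omega> = {u. u \<in> Hspace k \<and> (AE x in lebesgue. x \<notin> \<Omega> \<longrightarrow> u x = 0)}"

definition cond_E_ge :: "('a::euclidean_space \<Rightarrow> 'a \<Rightarrow> real) \<Rightarrow> real \<Rightarrow> real \<Rightarrow> bool" where
  "cond_E_ge k \<alpha> cl \<longleftrightarrow>
     (\<forall>x0 r u. r > 0 \<longrightarrow> u \<in> borel_measurable lebesgue \<longrightarrow>
        set_integrable lebesgue (ball x0 r) (\<lambda>x. (u x)\<^sup>2) \<longrightarrow>
        energy k (ball x0 r) u \<ge> ennreal cl * energy (frac_kernel \<alpha>) (ball x0 r) u)"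

definition cond_U2 :: "('a::euclidean_space \<Rightarrow> 'a \<Rightarrow> real) \<Rightarrow> real \<Rightarrow> real \<Rightarrow> bool" where
  "cond_U2 k \<alpha> cK \<longleftrightarrow>
     (AE p in lborel \<Otimes>\<^sub>M lborel.
        k (fst p) (snd p) \<le> cK * (2 - \<alpha>) * norm (snd p - fst p) powr (- real DIM('a) - \<alpha>))"

end

theory Submission
  imports Defs
begin

text \<open>
  De Giorgi iteration with constants uniform as \<open>\<alpha> \<rightarrow> 2\<close>. Instead of a Sobolev inequality, a Faber--Krahn
  inequality suffices: if \<open>v\<close> vanishes off a set of measure \<open>m\<close>, then
  \<open>\<integral> v\<^sup>2 \<le> C m\<^bsup>\<alpha>/d\<^esup> \<E>\<^sup>\<alpha>(v,v)\<close>. With \<open>D(h) = \<integral> (v(x+h) - v(x))\<^sup>2 dx\<close> one has \<open>D(2h) \<le> 4 D(h)\<close>, so the part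
  of the energy coming from \<open>|h| < R\<close> is at least \<open>1/(4(2-\<alpha>))\<close> times that of the shell \<open>R \<le> |h| < 2R\<close>;
  this compensates the factor \<open>2-\<alpha>\<close> hidden in the normalising constant. On a shell of volume
  comparable to \<open>m\<close>, most of the points \<open>x+h\<close> lie off the support of \<open>v\<close>.

  Testing the subsolution property with \<open>\<eta>\<^sup>2(u-l)\<^sub>+\<close> gives a Caccioppoli inequality whose right-hand side is
  split at the scale of the cutoff; the far part produces the tail, which is absorbed by requiring the
  final level \<open>L\<close> to be at least half of the tail. This proves the bound by the \<open>L\<^sup>2\<close> norm on all pairs of concentric balls.
  For \<open>q < 2\<close> one interpolates \<open>\<integral> u\<^sub>+\<^sup>2 \<le> (sup u)\<^bsup>2-q\<^esup> \<integral> u\<^sub>+\<^sup>q\<close> and absorbs the supremum along increasing radii.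
\<close>

section \<open>Lebesgue and Borel product measures\<close>

text \<open>The bound in (U2) carries a factor \<open>2 - \<alpha>\<close> too, and near the
  diagonal it must be kept: there it cancels the \<open>1 / (2 - \<alpha>)\<close> that comes from
  integrating \<open>norm h powr (2 - d - \<alpha>)\<close> over a small ball. The gain exponent
  \<alpha>/d of the iteration varies with \<alpha> as well, but only its lower bound \<alpha>0/d
  enters the constants, because the normalised iterates stay below one.

  The tail has coefficient exactly one in the final estimate. This is why the level is only required
  to exceed half of it: the other half pays for the tail that is carried along while the supremum is
  absorbed.

  The forms are integrals over a product of completed measures, whereas Fubini, translations and
  dilations are applied over \<open>lborel\<close>. The analytic estimates therefore concern Borel
  functions, and u is exchanged for a Borel representative in the final proof. The right-hand side
  there is a real number and \<open>enn2real\<close> sends infinity to 0, hence the finiteness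
  hypotheses on the two integrals; if one of them is infinite, the estimate is trivial in the
  extended sense.\<close>

lemma measurable_ident_lebesgue:
  "(\<lambda>x. x) \<in> lebesgue \<rightarrow>\<^sub>M (lborel :: 'a::euclidean_space measure)"
  by (auto intro!: measurable_completion)

lemma measurable_ident_pair_lebesgue:
  "(\<lambda>p. p) \<in> (lebesgue \<Otimes>\<^sub>M lebesgue) \<rightarrow>\<^sub>M
     ((lborel :: 'a::euclidean_space measure) \<Otimes>\<^sub>M (lborel :: 'b::euclidean_space measure))"
proof -
  have "(\<lambda>p. (fst p, snd p)) \<in> (lebesgue \<Otimes>\<^sub>M lebesgue) \<rightarrow>\<^sub>M
     ((lborel :: 'a measure) \<Otimes>\<^sub>M (lborel :: 'b measure))"
    by (intro measurable_Pair measurable_compose[OF measurable_fst measurable_ident_lebesgue]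
        measurable_compose[OF measurable_snd measurable_ident_lebesgue])
  then show ?thesis by simp
qed

lemma distr_lebesgue_lborel:
  "distr lebesgue lborel (\<lambda>x. x) = (lborel :: 'a::euclidean_space measure)"
proof (rule measure_eqI)
  fix A :: "'a set" assume "A \<in> sets (distr lebesgue lborel (\<lambda>x. x))"
  then show "emeasure (distr lebesgue lborel (\<lambda>x. x)) A = emeasure lborel A"
    by (subst emeasure_distr) (auto simp: measurable_completion)
qed simp

text \<open>Completion does not change the measure of Borel sets, so the identity pushes each
  completed factor forward to \<open>lborel\<close>; pushforward then commutes with the product by
  sigma-finiteness. This transfers integrals of Borel integrands and almost-everywhere statements
  between the two products.\<close>

lemma distr_pair_lebesgue_lborel:
  "distr (lebesgue \<Otimes>\<^sub>M lebesgue) (lborel \<Otimes>\<^sub>M lborel) (\<lambda>p. p)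
     = (lborel :: 'a::euclidean_space measure) \<Otimes>\<^sub>M (lborel :: 'b::euclidean_space measure)"
proof -
  have i: "(\<lambda>(x, y). (x, y)) = (\<lambda>p :: 'a \<times> 'b. p)" by auto
  show ?thesis
    using pair_measure_distr[OF measurable_ident_lebesgue[where 'a='a] measurable_ident_lebesgue[where 'a='b]]
    unfolding distr_lebesgue_lborel i by (simp add: sigma_finite_lborel)
qed

lemma nn_integral_pair_lebesgue:
  fixes f :: "'a::euclidean_space \<times> 'b::euclidean_space \<Rightarrow> ennreal"
  assumes "f \<in> borel_measurable (lborel \<Otimes>\<^sub>M lborel)"
  shows "integral\<^sup>N (lebesgue \<Otimes>\<^sub>M lebesgue) f = integral\<^sup>N (lborel \<Otimes>\<^sub>M lborel) f"
  using nn_integral_distr[OF measurable_ident_pair_lebesgue, of f] assms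
  unfolding distr_pair_lebesgue_lborel by simp

lemma AE_pair_lebesgue:
  fixes P :: "'a::euclidean_space \<times> 'b::euclidean_space \<Rightarrow> bool"
  assumes "AE p in lborel \<Otimes>\<^sub>M lborel. P p"
  shows "AE p in lebesgue \<Otimes>\<^sub>M lebesgue. P p"
  using AE_distrD[OF measurable_ident_pair_lebesgue, of P] assms
  unfolding distr_pair_lebesgue_lborel by simp

lemma integral_pair_lebesgue:
  fixes f :: "'a::euclidean_space \<times> 'b::euclidean_space \<Rightarrow> real"
  assumes "f \<in> borel_measurable (lborel \<Otimes>\<^sub>M lborel)"
  shows "integral\<^sup>L (lebesgue \<Otimes>\<^sub>M lebesgue) f = integral\<^sup>L (lborel \<Otimes>\<^sub>M lborel) f"
  using integral_distr[OF measurable_ident_pair_lebesgue, of f] assms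
  unfolding distr_pair_lebesgue_lborel by simp

section \<open>Translation, scaling and null sets for \<open>lborel\<close>\<close>

lemma ball_measurable_borel [measurable]:
  "ball (x :: 'a::metric_space) r \<in> sets borel"
  by simp

lemma nn_integral_lborel_translate:
  fixes f :: "'a::euclidean_space \<Rightarrow> ennreal"
  assumes "f \<in> borel_measurable borel"
  shows "(\<integral>\<^sup>+ x. f (c + x) \<partial>lborel) = integral\<^sup>N lborel f"
  using nn_integral_distr[of "(+) c" lborel borel f] assms by (simp add: lborel_distr_plus)

lemma nn_integral_lborel_scale:
  fixes f :: "'a::euclidean_space \<Rightarrow> ennreal"
  assumes [measurable]: "f \<in> borel_measurable borel" and "0 < c"
  shows "integral\<^sup>N lborel f = ennreal (c ^ DIM('a)) * (\<integral>\<^sup>+ x. f (c *\<^sub>R x) \<partial>lborel)"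
  by (subst lborel_affine[of c 0])
     (use assms in \<open>auto simp: nn_integral_density nn_integral_distr nn_integral_cmult\<close>)

lemma AE_pair_lborel_fst_snd:
  fixes P :: "'a::euclidean_space \<Rightarrow> bool"
  assumes "AE x in lborel. P x"
  shows "AE p in lborel \<Otimes>\<^sub>M (lborel :: 'a measure). P (fst p) \<and> P (snd p)"
proof -
  obtain N where N: "N \<in> null_sets lborel" "{x. \<not> P x} \<subseteq> N"
    using assms by (auto elim!: AE_E simp: null_sets_def)
  have "N \<times> UNIV \<in> null_sets (lborel \<Otimes>\<^sub>M (lborel :: 'a measure))"
    using lborel.times_in_null_sets1[OF N(1), of UNIV] by simp
  moreover have "UNIV \<times> N \<in> null_sets ((lborel :: 'a measure) \<Otimes>\<^sub>M lborel)"
    using lborel.times_in_null_sets2[of UNIV lborel N] N(1) by simp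
  ultimately have "N \<times> UNIV \<union> UNIV \<times> N \<in> null_sets (lborel \<Otimes>\<^sub>M (lborel :: 'a measure))"
    by (rule null_sets.Un)
  then show ?thesis by (rule AE_I') (use N(2) in auto)
qed

section \<open>A Faber--Krahn inequality uniform in the order\<close>

text \<open>Applying the functional equation of Gamma twice gives \<Gamma>(2 - \<alpha>/2) = (1 -
  \<alpha>/2) (\<alpha>/2) |\<Gamma>(-\<alpha>/2)|, which exhibits the zero of the constant at
  \<alpha> = 2. The remaining Gamma values have arguments in compact intervals of positive numbers,
  so extreme values bound them. The factor \<alpha>/2 is the reason for keeping \<alpha> above
  \<alpha>0.\<close>

lemma frac_const_lower:
  fixes d \<alpha>0 :: real
  assumes "0 < d" "0 < \<alpha>0"
  shows "\<exists>c>0. \<forall>\<alpha>. \<alpha>0 \<le> \<alpha> \<longrightarrow> \<alpha> < 2 \<longrightarrow>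
    c * (2 - \<alpha>) \<le> 2 powr \<alpha> * Gamma ((d + \<alpha>) / 2) / (pi powr (d / 2) * \<bar>Gamma (- \<alpha> / 2)\<bar>)"
proof -
  have cont: "continuous_on {a..b} (Gamma :: real \<Rightarrow> real)" if "0 < a" for a b
    by (rule continuous_on_Gamma) (use that in \<open>auto elim!: nonpos_Ints_cases\<close>)
  obtain z1 where z1: "z1 \<in> {d/2..d/2+1}" "\<And>y. y \<in> {d/2..d/2+1} \<Longrightarrow> Gamma z1 \<le> Gamma y"
    using continuous_attains_inf[OF _ _ cont[of "d/2" "d/2+1"]] assms by auto
  obtain z2 where z2: "z2 \<in> {1..2}" "\<And>y. y \<in> {1..2::real} \<Longrightarrow> Gamma y \<le> Gamma z2"
    using continuous_attains_sup[OF _ _ cont[of 1 2]] by auto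
  have p1: "Gamma z1 > 0" and p2: "Gamma z2 > 0"
    using z1(1) z2(1) assms by (auto intro!: Gamma_real_pos)
  \<comment> \<open>One half of \<alpha>0/4 comes from \<alpha>/2 \<ge> \<alpha>0/2, the other from
    1 - \<alpha>/2 = (2 - \<alpha>)/2.\<close>
  define c where "c = Gamma z1 * (\<alpha>0 / 4) / (pi powr (d/2) * Gamma z2)"
  have "c > 0" unfolding c_def using p1 p2 assms by simp
  moreover have "c * (2 - \<alpha>) \<le> 2 powr \<alpha> * Gamma ((d + \<alpha>) / 2) / (pi powr (d / 2) * \<bar>Gamma (- \<alpha> / 2)\<bar>)"
    if "\<alpha>0 \<le> \<alpha>" "\<alpha> < 2" for \<alpha>
  proof -
    have "- \<alpha> / 2 \<notin> \<int>\<^sub>\<le>\<^sub>0"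
    proof
      assume "- \<alpha> / 2 \<in> \<int>\<^sub>\<le>\<^sub>0"
      then obtain n where n: "- \<alpha> / 2 = real_of_int n" by (auto elim!: nonpos_Ints_cases)
      then have "-1 < n" "n < 0" using that assms by linarith+
      then show False by linarith
    qed
    from Gamma_plus1[OF this] have e1: "Gamma (1 - \<alpha>/2) = (- \<alpha> / 2) * Gamma (- \<alpha> / 2)"
      by (simp add: algebra_simps)
    have "1 - \<alpha> / 2 \<notin> \<int>\<^sub>\<le>\<^sub>0" using that assms by (auto elim!: nonpos_Ints_cases)
    from Gamma_plus1[OF this] have e2: "Gamma (2 - \<alpha>/2) = (1 - \<alpha> / 2) * Gamma (1 - \<alpha> / 2)"
      by (simp add: algebra_simps)
    have e3: "Gamma (2 - \<alpha>/2) = (1 - \<alpha>/2) * (\<alpha>/2) * \<bar>Gamma (- \<alpha> / 2)\<bar>"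
    proof -
      have g: "Gamma (2 - \<alpha>/2) > 0" using that by (intro Gamma_real_pos) auto
      then have "Gamma (2 - \<alpha>/2) = \<bar>(1 - \<alpha> / 2) * ((- \<alpha> / 2) * Gamma (- \<alpha> / 2))\<bar>"
        unfolding e2 e1 by simp
      also have "\<dots> = (1 - \<alpha>/2) * (\<alpha>/2) * \<bar>Gamma (- \<alpha> / 2)\<bar>"
        using that assms by (simp add: abs_mult)
      finally show ?thesis .
    qed
    have gpos: "\<bar>Gamma (- \<alpha> / 2)\<bar> > 0"
      using \<open>- \<alpha> / 2 \<notin> \<int>\<^sub>\<le>\<^sub>0\<close> by (simp add: Gamma_eq_zero_iff)
    have le2: "(1 - \<alpha>/2) * (\<alpha>/2) * \<bar>Gamma (- \<alpha> / 2)\<bar> \<le> Gamma z2"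
      unfolding e3[symmetric] using that assms by (intro z2(2)) auto
    have le1: "Gamma z1 \<le> Gamma ((d + \<alpha>) / 2)"
      using that assms by (intro z1(2)) (auto simp: field_simps)
    have pw: "1 \<le> 2 powr \<alpha>" using that assms by (intro ge_one_powr_ge_zero) auto
    have "c * (2 - \<alpha>) = Gamma z1 * (\<alpha>0 / 2) * (1 - \<alpha>/2) / (pi powr (d/2) * Gamma z2)"
      unfolding c_def by (simp add: field_simps)
    also have "\<dots> \<le> Gamma z1 * (\<alpha>0 / 2) * (1 - \<alpha>/2) / (pi powr (d/2) * ((1 - \<alpha>/2) * (\<alpha>/2) * \<bar>Gamma (- \<alpha> / 2)\<bar>))"
      using le2 p1 p2 assms that gpos by (intro divide_left_mono mult_left_mono mult_pos_pos) auto
    also have "\<dots> = Gamma z1 * (\<alpha>0 / \<alpha>) / (pi powr (d/2) * \<bar>Gamma (- \<alpha> / 2)\<bar>)"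
      using that assms gpos by (simp add: divide_simps)
    also have "\<dots> \<le> (2 powr \<alpha> * Gamma ((d + \<alpha>) / 2)) / (pi powr (d/2) * \<bar>Gamma (- \<alpha> / 2)\<bar>)"
    proof (rule divide_right_mono)
      have "Gamma z1 * (\<alpha>0 / \<alpha>) \<le> Gamma z1 * 1"
        using that assms p1 by (intro mult_left_mono) auto
      also have "\<dots> \<le> 1 * Gamma ((d + \<alpha>) / 2)" using le1 by simp
      also have "\<dots> \<le> 2 powr \<alpha> * Gamma ((d + \<alpha>) / 2)"
        using pw le1 p1 by (intro mult_right_mono) auto
      finally show "Gamma z1 * (\<alpha>0 / \<alpha>) \<le> 2 powr \<alpha> * Gamma ((d + \<alpha>) / 2)" .
    qed simp
    finally show ?thesis .
  qed
  ultimately show ?thesis by blast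
qed

text \<open>Used with t = 2 - \<alpha>. The first bound controls the growth of the energy between
  radii R and 2R, the second the sum of a geometric series of ratio 2^(-t); in both cases the
  dependence on t must be linear.\<close>

lemma two_powr_bounds:
  fixes t :: real
  assumes "0 \<le> t" "t \<le> 2"
  shows "2 powr t - 1 \<le> 4 * t" and "t / 8 \<le> 1 - 2 powr (- t)"
proof -
  have l: "1/2 \<le> ln (2::real)" "ln 2 \<le> (1::real)"
    using ln2_ge_two_thirds ln_2_less_1 by auto
  have a: "1 - t * ln 2 \<le> 2 powr (- t)" "1 + t * ln 2 \<le> 2 powr t"
    using exp_ge_add_one_self[of "- t * ln 2"] exp_ge_add_one_self[of "t * ln 2"]
    by (auto simp: powr_def algebra_simps)
  have b: "2 powr t \<le> 4" using powr_mono[of t 2 2] assms by simp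
  have e: "2 powr t * 2 powr (- t) = 1" by (simp add: powr_minus)
  have tl: "t * ln 2 \<le> t * 1" "t * (1/2) \<le> t * ln 2" using l assms by (intro mult_left_mono; simp)+
  have "2 powr t * (1 - 2 powr (-t)) \<le> 4 * t"
    using a b tl assms powr_mono[of "- t" 0 2] by (intro mult_mono) auto
  then show "2 powr t - 1 \<le> 4 * t" using e by (simp add: algebra_simps)
  have c: "1/4 \<le> 2 powr (-t)" using powr_mono[of "-2" "-t" 2] assms by (simp add: powr_minus)
  have "1/4 * (t/2) \<le> 2 powr (-t) * (2 powr t - 1)"
    using a c tl assms by (intro mult_mono) auto
  then show "t / 8 \<le> 1 - 2 powr (- t)" using e by (simp add: algebra_simps)
qed

text \<open>The increment over 2h is the sum of two increments over h that are translates of each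
  other, and (a + b)^2 \<le> 2 a^2 + 2 b^2.\<close>

lemma increment_square_doubling:
  fixes v :: "'a::euclidean_space \<Rightarrow> real"
  assumes [measurable]: "v \<in> borel_measurable borel"
  shows "(\<integral>\<^sup>+ x. ennreal ((v (x + 2 *\<^sub>R h) - v x)\<^sup>2) \<partial>lborel)
    \<le> 4 * (\<integral>\<^sup>+ x. ennreal ((v (x + h) - v x)\<^sup>2) \<partial>lborel)"
proof -
  let ?D = "\<integral>\<^sup>+ x. ennreal ((v (x + h) - v x)\<^sup>2) \<partial>lborel"
  have "(\<integral>\<^sup>+ x. ennreal ((v (x + 2 *\<^sub>R h) - v x)\<^sup>2) \<partial>lborel)
    \<le> (\<integral>\<^sup>+ x. 2 * ennreal ((v ((h + x) + h) - v (h + x))\<^sup>2) + 2 * ennreal ((v (x + h) - v x)\<^sup>2) \<partial>lborel)"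
  proof (rule nn_integral_mono)
    fix x
    have e: "h + x = x + h" "x + h + h = x + 2 *\<^sub>R h" by (simp_all add: scaleR_2)
    have "(v (x + 2 *\<^sub>R h) - v x)\<^sup>2 \<le> 2 * (v (x + 2 *\<^sub>R h) - v (x + h))\<^sup>2 + 2 * (v (x + h) - v x)\<^sup>2"
      using zero_le_power2[of "(v (x + 2 *\<^sub>R h) - v (x + h)) - (v (x + h) - v x)"]
      by (simp add: power2_eq_square algebra_simps)
    then have "ennreal ((v (x + 2 *\<^sub>R h) - v x)\<^sup>2)
       \<le> ennreal (2 * (v (x + 2 *\<^sub>R h) - v (x + h))\<^sup>2 + 2 * (v (x + h) - v x)\<^sup>2)"
      by (rule ennreal_leI)
    then show "ennreal ((v (x + 2 *\<^sub>R h) - v x)\<^sup>2) \<le> 2 * ennreal ((v ((h + x) + h) - v (h + x))\<^sup>2)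
      + 2 * ennreal ((v (x + h) - v x)\<^sup>2)"
      unfolding e by (simp add: ennreal_plus ennreal_mult)
  qed
  also have "\<dots> = 2 * (\<integral>\<^sup>+ x. ennreal ((v ((h + x) + h) - v (h + x))\<^sup>2) \<partial>lborel) + 2 * ?D"
    by (simp add: nn_integral_add nn_integral_cmult)
  also have "(\<integral>\<^sup>+ x. ennreal ((v ((h + x) + h) - v (h + x))\<^sup>2) \<partial>lborel) = ?D"
    by (rule nn_integral_lborel_translate[of "\<lambda>x. ennreal ((v (x + h) - v x)\<^sup>2)"]) measurable
  also have "2 * ?D + 2 * ?D = 4 * ?D"
    by (simp add: distrib_right[symmetric])
  finally show ?thesis .
qed

text \<open>Substituting 2h for h in the integral P over a ball costs 2^d from the volume,
  2^(-d-\<alpha>) from the weight and 4 from \<open>dbl\<close>, so P(2R) \<le> 2^(2-\<alpha>) P(R).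
  The shell is the difference of the two, at most (2^(2-\<alpha>) - 1) P(R), and this vanishes
  linearly as \<alpha> tends to 2.\<close>

lemma shell_integral_le:
  fixes D :: "'a::euclidean_space \<Rightarrow> ennreal"
  assumes [measurable]: "D \<in> borel_measurable borel"
    and dbl: "\<And>h. D (2 *\<^sub>R h) \<le> 4 * D h"
    and \<alpha>: "0 < \<alpha>" "\<alpha> < 2" and R: "0 < R"
  defines "p \<equiv> - real DIM('a) - \<alpha>"
  shows "(\<integral>\<^sup>+ h. indicator (ball 0 (2 * R) - ball 0 R) h * (ennreal (norm h powr p) * D h) \<partial>lborel)
    \<le> ennreal (4 * (2 - \<alpha>)) * (\<integral>\<^sup>+ h. ennreal (norm h powr p) * D h \<partial>lborel)"
proof -
  let ?g = "\<lambda>h. ennreal (norm h powr p) * D h"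
  define P where "P R = (\<integral>\<^sup>+ h. indicator (ball 0 R) h * ?g h \<partial>lborel)" for R
  let ?S = "\<integral>\<^sup>+ h. indicator (ball 0 (2 * R) - ball 0 R) h * ?g h \<partial>lborel"
  have "P (2 * R) = (\<integral>\<^sup>+ h. indicator (ball 0 R) h * ?g h + indicator (ball 0 (2 * R) - ball 0 R) h * ?g h \<partial>lborel)"
    unfolding P_def using R by (intro nn_integral_cong) (auto simp: indicator_def)
  also have "\<dots> = P R + ?S" unfolding P_def by (rule nn_integral_add) measurable
  finally have sp: "P (2 * R) = P R + ?S" .
  have "P (2 * R) = ennreal (2 ^ DIM('a)) * (\<integral>\<^sup>+ h. indicator (ball 0 (2 * R)) (2 *\<^sub>R h) * ?g (2 *\<^sub>R h) \<partial>lborel)"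
    unfolding P_def by (rule nn_integral_lborel_scale) auto
  also have "(\<integral>\<^sup>+ h. indicator (ball 0 (2 * R)) (2 *\<^sub>R h) * ?g (2 *\<^sub>R h) \<partial>lborel)
     \<le> (\<integral>\<^sup>+ h. ennreal (4 * 2 powr p) * (indicator (ball 0 R) h * ?g h) \<partial>lborel)"
  proof (rule nn_integral_mono)
    fix h :: 'a
    have "ennreal (norm (2 *\<^sub>R h) powr p) * D (2 *\<^sub>R h) \<le> ennreal (norm (2 *\<^sub>R h) powr p) * (4 * D h)"
      by (intro mult_left_mono dbl) auto
    also have "\<dots> = ennreal (4 * 2 powr p) * ?g h"
      by (simp add: powr_mult ennreal_mult mult_ac)
    finally show "indicator (ball 0 (2 * R)) (2 *\<^sub>R h) * ?g (2 *\<^sub>R h)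
       \<le> ennreal (4 * 2 powr p) * (indicator (ball 0 R) h * ?g h)"
      by (auto simp: indicator_def)
  qed
  also have "\<dots> = ennreal (4 * 2 powr p) * P R"
    unfolding P_def by (rule nn_integral_cmult) measurable
  finally have "P (2 * R) \<le> ennreal (2 ^ DIM('a)) * (ennreal (4 * 2 powr p) * P R)"
    by (simp add: mult_left_mono)
  also have "\<dots> = ennreal (2 powr (2 - \<alpha>)) * P R"
  proof -
    have "2 ^ DIM('a) * (4 * 2 powr p) = 2 powr (real DIM('a) + 2 + p)"
      by (simp add: powr_add powr_realpow)
    also have "\<dots> = 2 powr (2 - \<alpha>)" by (simp add: p_def)
    finally show ?thesis by (simp add: mult.assoc[symmetric] ennreal_mult[symmetric])
  qed
  finally have le: "P R + ?S \<le> ennreal (2 powr (2 - \<alpha>)) * P R" unfolding sp .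
  have PG: "P R \<le> (\<integral>\<^sup>+ h. ?g h \<partial>lborel)"
    unfolding P_def by (intro nn_integral_mono) (auto simp: indicator_def)
  \<comment> \<open>Cancelling P(R) requires it to be finite; otherwise the right-hand side is
    infinite, because 2 - \<alpha> > 0.\<close>
  show ?thesis
  proof (cases "P R = \<infinity>")
    case True
    with PG have "(\<integral>\<^sup>+ h. ?g h \<partial>lborel) = \<infinity>" by (simp add: top_unique)
    then show ?thesis using \<alpha> by (simp add: ennreal_mult_top)
  next
    case False
    have "1 \<le> 2 powr (2 - \<alpha>)" using \<alpha> by (intro ge_one_powr_ge_zero) auto
    then have "ennreal (2 powr (2 - \<alpha>)) = 1 + ennreal (2 powr (2 - \<alpha>) - 1)"
      by (simp add: ennreal_plus[symmetric] del: ennreal_plus flip: ennreal_1)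
    with le have "P R + ?S \<le> P R + ennreal (2 powr (2 - \<alpha>) - 1) * P R"
      by (simp add: distrib_right)
    then have "?S \<le> ennreal (2 powr (2 - \<alpha>) - 1) * P R"
      using False by (simp add: ennreal_add_left_cancel_le)
    also have "\<dots> \<le> ennreal (4 * (2 - \<alpha>)) * (\<integral>\<^sup>+ h. ?g h \<partial>lborel)"
      using two_powr_bounds(1)[of "2 - \<alpha>"] \<alpha> PG by (intro mult_mono ennreal_leI) auto
    finally show ?thesis .
  qed
qed


text \<open>With |B_R| = 2m the larger ball has measure at least 4m; removing the smaller ball (2m)
  and the translate of S (at most m) leaves at least m. Only 2^d \<ge> 2 is needed.\<close>

lemma emeasure_shell_diff_ge:
  fixes S :: "'a::euclidean_space set"
  assumes [measurable]: "S \<in> sets borel" and S: "emeasure lborel S \<le> ennreal m" and "0 \<le> m" "0 \<le> R"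
    and R: "unit_ball_vol (real DIM('a)) * R ^ DIM('a) = 2 * m"
  shows "ennreal m \<le> emeasure lborel {h \<in> ball 0 (2 * R) - ball 0 R. x + h \<notin> S}"
proof -
  let ?T = "{h \<in> ball 0 (2 * R) - ball 0 R. x + h \<notin> S}"
  let ?S = "{h. x + h \<in> S}"
  have [measurable]: "?T \<in> sets borel" "?S \<in> sets borel" by measurable
  have eS: "emeasure lborel ?S = emeasure lborel S"
  proof -
    have "emeasure lborel ?S = (\<integral>\<^sup>+ h. indicator ?S h \<partial>lborel)" by simp
    also have "\<dots> = (\<integral>\<^sup>+ h. indicator S (x + h) \<partial>lborel)"
      by (intro nn_integral_cong) (simp add: indicator_def)
    also have "\<dots> = emeasure lborel S"
      by (subst nn_integral_lborel_translate) auto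
    finally show ?thesis .
  qed
  have "2 * (2 * m) \<le> 2 ^ DIM('a) * (2 * m)"
    using assms by (intro mult_right_mono) (auto simp: self_le_power)
  then have "ennreal (2 * (2 * m)) \<le> ennreal (unit_ball_vol (real DIM('a)) * (2 * R) ^ DIM('a))"
    unfolding power_mult_distrib R[symmetric] by (intro ennreal_leI) (simp only: mult_ac)
  also have "\<dots> = emeasure lborel (ball 0 (2 * R) :: 'a set)"
    using assms by (subst emeasure_ball) auto
  also have "\<dots> \<le> emeasure lborel ((ball 0 R \<union> ?S) \<union> ?T)"
    by (intro emeasure_mono) auto
  also have "\<dots> \<le> emeasure lborel (ball 0 R \<union> ?S) + emeasure lborel ?T"
    by (intro emeasure_subadditive) auto
  also have "emeasure lborel (ball 0 R \<union> ?S) \<le> emeasure lborel (ball 0 R :: 'a set) + emeasure lborel ?S"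
    by (intro emeasure_subadditive) auto
  also have "emeasure lborel (ball 0 R :: 'a set) = ennreal (2 * m)"
    using assms by (subst emeasure_ball) auto
  also have "emeasure lborel ?S \<le> ennreal m" using S eS by simp
  finally have "ennreal (2 * (2 * m)) \<le> ennreal (2 * m) + ennreal m + emeasure lborel ?T"
    by (simp add: add_mono add_right_mono)
  also have "ennreal (2 * m) + ennreal m = ennreal (3 * m)"
    using assms by (subst ennreal_plus[symmetric]) auto
  finally have "ennreal (3 * m) + ennreal m \<le> ennreal (3 * m) + emeasure lborel ?T"
    using assms by (subst ennreal_plus[symmetric]) auto
  then show ?thesis by (simp add: ennreal_add_left_cancel_le)
qed

section \<open>The fractional energy as an integral over increments, and the Faber--Krahn
  inequality\<close>

lemma energy_UNIV_lborel:
  fixes k :: "'a::euclidean_space \<Rightarrow> 'a \<Rightarrow> real"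
  assumes [measurable]: "v \<in> borel_measurable borel" 
    and k[measurable]: "(\<lambda>p. k (fst p) (snd p)) \<in> borel_measurable (lborel \<Otimes>\<^sub>M lborel)"
  shows "energy k UNIV v = (\<integral>\<^sup>+ p. ennreal ((v (snd p) - v (fst p))\<^sup>2 * k (fst p) (snd p)) \<partial>(lborel \<Otimes>\<^sub>M lborel))"
  unfolding energy_def UNIV_Times_UNIV indicator_UNIV mult_1
  by (rule nn_integral_pair_lebesgue) measurable

lemma frac_kernel_measurable [measurable]:
  "(\<lambda>p. frac_kernel \<alpha> (fst p) (snd p :: 'a::euclidean_space)) \<in> borel_measurable (lborel \<Otimes>\<^sub>M lborel)"
  unfolding frac_kernel_def by measurable

lemma energy_frac_kernel_increments:
  fixes v :: "'a::euclidean_space \<Rightarrow> real"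
  assumes [measurable]: "v \<in> borel_measurable borel" and "0 \<le> A"
    and A: "A = 2 powr \<alpha> * Gamma ((real DIM('a) + \<alpha>) / 2)
       / (pi powr (real DIM('a) / 2) * \<bar>Gamma (- \<alpha> / 2)\<bar>)"
  shows "energy (frac_kernel \<alpha>) UNIV v = ennreal A * (\<integral>\<^sup>+ h. ennreal (norm h powr (- real DIM('a) - \<alpha>)) *
    (\<integral>\<^sup>+ x. ennreal ((v (x + h) - v x)\<^sup>2) \<partial>lborel) \<partial>lborel)"
proof -
  let ?p = "- real DIM('a) - \<alpha>"
  have "energy (frac_kernel \<alpha>) UNIV v = (\<integral>\<^sup>+ x. \<integral>\<^sup>+ y. ennreal ((v y - v x)\<^sup>2 * frac_kernel \<alpha> x y) \<partial>lborel \<partial>lborel)"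
    by (subst energy_UNIV_lborel) (auto simp: lborel.nn_integral_fst[symmetric] intro!: nn_integral_cong)
  also have "\<dots> = (\<integral>\<^sup>+ x. \<integral>\<^sup>+ h. ennreal ((v (x + h) - v x)\<^sup>2 * frac_kernel \<alpha> x (x + h)) \<partial>lborel \<partial>lborel)"
    by (intro nn_integral_cong nn_integral_lborel_translate[symmetric]) (unfold frac_kernel_def, measurable)
  also have "\<dots> = (\<integral>\<^sup>+ x. \<integral>\<^sup>+ h. ennreal A * (ennreal (norm h powr ?p) * ennreal ((v (x + h) - v x)\<^sup>2)) \<partial>lborel \<partial>lborel)"
    unfolding frac_kernel_def A[symmetric] using \<open>0 \<le> A\<close>
    by (intro nn_integral_cong) (simp add: ennreal_mult mult_ac)
  also have "\<dots> = (\<integral>\<^sup>+ h. \<integral>\<^sup>+ x. ennreal A * (ennreal (norm h powr ?p) * ennreal ((v (x + h) - v x)\<^sup>2)) \<partial>lborel \<partial>lborel)"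
    by (rule lborel_pair.Fubini'[symmetric]) measurable
  also have "\<dots> = (\<integral>\<^sup>+ h. ennreal A * (ennreal (norm h powr ?p) * (\<integral>\<^sup>+ x. ennreal ((v (x + h) - v x)\<^sup>2) \<partial>lborel)) \<partial>lborel)"
    by (intro nn_integral_cong) (simp add: nn_integral_cmult)
  also have "\<dots> = ennreal A * (\<integral>\<^sup>+ h. ennreal (norm h powr ?p) * (\<integral>\<^sup>+ x. ennreal ((v (x + h) - v x)\<^sup>2) \<partial>lborel) \<partial>lborel)"
    by (rule nn_integral_cmult) measurable
  finally show ?thesis .
qed

lemma ennreal_mult_le_mult_divide:
  assumes "ennreal a * x \<le> ennreal b * y" "0 < a" "0 \<le> b"
  shows "x \<le> ennreal (b / a) * y"
proof -
  have "x = ennreal (1 / a) * (ennreal a * x)"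
    using assms by (simp add: mult.assoc[symmetric] ennreal_mult[symmetric])
  also have "\<dots> \<le> ennreal (1 / a) * (ennreal b * y)"
    by (intro mult_left_mono assms) auto
  also have "\<dots> = ennreal (b / a) * y"
    using assms by (simp add: mult.assoc[symmetric] ennreal_mult[symmetric])
  finally show ?thesis .
qed

text \<open>For fixed x, the increments h in the shell with x + h off S satisfy (v(x+h) - v(x))^2 =
  v(x)^2, and they form a set of measure at least m. Since p \<le> 0, the weight on the shell is
  smallest at its outer radius 2R.\<close>

lemma L2_norm_le_shell_integral:
  fixes v :: "'a::euclidean_space \<Rightarrow> real"
  assumes [measurable]: "v \<in> borel_measurable borel" "S \<in> sets borel"
    and S: "emeasure lborel S \<le> ennreal m" "\<And>x. x \<notin> S \<Longrightarrow> v x = 0"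
    and m: "0 \<le> m" and "0 < R" "p \<le> 0"
    and R: "unit_ball_vol (real DIM('a)) * R ^ DIM('a) = 2 * m"
  shows "ennreal (m * (2 * R) powr p) * (\<integral>\<^sup>+ x. ennreal ((v x)\<^sup>2) \<partial>lborel)
    \<le> (\<integral>\<^sup>+ h. indicator (ball 0 (2 * R) - ball 0 R) h * (ennreal (norm h powr p) *
         (\<integral>\<^sup>+ x. ennreal ((v (x + h) - v x)\<^sup>2) \<partial>lborel)) \<partial>lborel)"
proof -
  let ?A = "ball 0 (2 * R) - ball 0 R :: 'a set"
  let ?q = "(2 * R) powr p"
  have "ennreal (m * ?q) * (\<integral>\<^sup>+ x. ennreal ((v x)\<^sup>2) \<partial>lborel)
      = (\<integral>\<^sup>+ x. ennreal ?q * ennreal ((v x)\<^sup>2) * ennreal m \<partial>lborel)"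
    using m by (subst nn_integral_cmult[symmetric]) (auto simp: ennreal_mult mult_ac)
  also have "\<dots> \<le> (\<integral>\<^sup>+ x. ennreal ?q * ennreal ((v x)\<^sup>2) * emeasure lborel {h \<in> ?A. x + h \<notin> S} \<partial>lborel)"
    using emeasure_shell_diff_ge[OF assms(2) S(1) m _ R] assms
    by (intro nn_integral_mono mult_left_mono) auto
  also have "\<dots> = (\<integral>\<^sup>+ x. \<integral>\<^sup>+ h. ennreal ?q * ennreal ((v x)\<^sup>2) * indicator {h \<in> ?A. x + h \<notin> S} h \<partial>lborel \<partial>lborel)"
    by (intro nn_integral_cong) (simp add: nn_integral_cmult)
  also have "\<dots> \<le> (\<integral>\<^sup>+ x. \<integral>\<^sup>+ h. indicator ?A h * (ennreal (norm h powr p) * ennreal ((v (x + h) - v x)\<^sup>2)) \<partial>lborel \<partial>lborel)"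
  proof (intro nn_integral_mono)
    fix x h :: 'a
    have "?q \<le> norm h powr p" if "h \<in> ?A"
      using that \<open>0 < R\<close> \<open>p \<le> 0\<close> by (intro powr_mono2') auto
    then show "ennreal ?q * ennreal ((v x)\<^sup>2) * indicator {h \<in> ?A. x + h \<notin> S} h
       \<le> indicator ?A h * (ennreal (norm h powr p) * ennreal ((v (x + h) - v x)\<^sup>2))"
      using S(2)[of "x + h"] by (auto simp: indicator_def intro!: mult_right_mono ennreal_leI)
  qed
  also have "\<dots> = (\<integral>\<^sup>+ h. \<integral>\<^sup>+ x. indicator ?A h * (ennreal (norm h powr p) * ennreal ((v (x + h) - v x)\<^sup>2)) \<partial>lborel \<partial>lborel)"
    by (rule lborel_pair.Fubini'[symmetric]) measurable
  also have "\<dots> = (\<integral>\<^sup>+ h. indicator ?A h * (ennreal (norm h powr p) *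
         (\<integral>\<^sup>+ x. ennreal ((v (x + h) - v x)\<^sup>2) \<partial>lborel)) \<partial>lborel)"
    by (intro nn_integral_cong) (simp add: nn_integral_cmult)
  finally show ?thesis .
qed

text \<open>The factor \<open>2 - \<alpha>\<close> of the shell estimate is dominated by the
  normalising constant through \<open>frac_const_lower\<close>, leaving no singular constant. The
  power of m arises from R being proportional to m^(1/d): R^(d+\<alpha>)/m is of order
  m^(\<alpha>/d).\<close>

lemma faber_krahn_frac:
  fixes \<alpha>0 :: real
  assumes "0 < \<alpha>0"
  shows "\<exists>C>0. \<forall>\<alpha>. \<alpha>0 \<le> \<alpha> \<longrightarrow> \<alpha> < 2 \<longrightarrow> (\<forall>(v :: 'a::euclidean_space \<Rightarrow> real) S m.
    v \<in> borel_measurable borel \<longrightarrow> S \<in> sets borel \<longrightarrow> 0 \<le> m \<longrightarrow> emeasure lborel S \<le> ennreal m \<longrightarrow>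
    (\<forall>x. x \<notin> S \<longrightarrow> v x = 0) \<longrightarrow>
    (\<integral>\<^sup>+ x. ennreal ((v x)\<^sup>2) \<partial>lborel) \<le> ennreal (C * m powr (\<alpha> / DIM('a))) * energy (frac_kernel \<alpha>) UNIV v)"
proof -
  let ?d = "real DIM('a)"
  define \<omega> where "\<omega> = unit_ball_vol ?d"
  have \<omega>: "\<omega> > 0" unfolding \<omega>_def by simp
  obtain c where c: "c > 0" "\<And>\<alpha>. \<alpha>0 \<le> \<alpha> \<Longrightarrow> \<alpha> < 2 \<Longrightarrow>
    c * (2 - \<alpha>) \<le> 2 powr \<alpha> * Gamma ((?d + \<alpha>) / 2) / (pi powr (?d / 2) * \<bar>Gamma (- \<alpha> / 2)\<bar>)"
    using frac_const_lower[of ?d \<alpha>0] assms by auto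
  \<comment> \<open>The base 2/\<omega> may lie on either side of one, while the exponent \<alpha>/d
    ranges over (0,2]; \<open>M powr 2\<close> bounds the power in all cases.\<close>
  define M where "M = max 1 (2 / \<omega>)"
  define C where "C = 4 / c * (2 powr (?d + 2) * (2 / \<omega>) * M powr 2)"
  have "C > 0" unfolding C_def M_def using c \<omega> by (simp add: max_def)
  moreover have "(\<integral>\<^sup>+ x. ennreal ((v x)\<^sup>2) \<partial>lborel) \<le> ennreal (C * m powr (\<alpha> / ?d)) * energy (frac_kernel \<alpha>) UNIV v"
    if \<alpha>: "\<alpha>0 \<le> \<alpha>" "\<alpha> < 2" and [measurable]: "v \<in> borel_measurable borel" "S \<in> sets borel"
      and m: "0 \<le> m" and S: "emeasure lborel S \<le> ennreal m" "\<And>x. x \<notin> S \<Longrightarrow> v x = 0"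
    for \<alpha> S m and v :: "'a \<Rightarrow> real"
  proof (cases "m = 0")
    case True
    then have "S \<in> null_sets lborel" using S by (auto simp: null_sets_def)
    then have "AE x in lborel. x \<notin> S" by (rule AE_not_in)
    then have "AE x in lborel. ennreal ((v x)\<^sup>2) = 0" by eventually_elim (simp add: S(2))
    then have "(\<integral>\<^sup>+ x. ennreal ((v x)\<^sup>2) \<partial>lborel) = 0" by (subst nn_integral_0_iff_AE) auto
    then show ?thesis by simp
  next
    case False
    then have m: "0 < m" using m by simp
    define R where "R = (2 * m / \<omega>) powr (1 / ?d)"
    have R: "R > 0" unfolding R_def using m \<omega> by simp
    have Rd: "\<omega> * R ^ DIM('a) = 2 * m"
      using m \<omega> R by (simp add: R_def powr_realpow[symmetric] powr_powr)
    define A where "A = 2 powr \<alpha> * Gamma ((?d + \<alpha>) / 2) / (pi powr (?d / 2) * \<bar>Gamma (- \<alpha> / 2)\<bar>)"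
    have A: "c * (2 - \<alpha>) \<le> A" unfolding A_def by (rule c(2)[OF \<alpha>])
    then have A0: "0 \<le> A" using c(1) \<alpha> by (smt (verit) mult_nonneg_nonneg)
    let ?p = "- ?d - \<alpha>"
    let ?D = "\<lambda>h. \<integral>\<^sup>+ x. ennreal ((v (x + h) - v x)\<^sup>2) \<partial>lborel"
    let ?G = "\<integral>\<^sup>+ h. ennreal (norm h powr ?p) * ?D h \<partial>lborel"
    have E: "energy (frac_kernel \<alpha>) UNIV v = ennreal A * ?G"
      by (rule energy_frac_kernel_increments) (use A0 in \<open>auto simp: A_def\<close>)
    have "ennreal (m * (2 * R) powr ?p) * (\<integral>\<^sup>+ x. ennreal ((v x)\<^sup>2) \<partial>lborel)
      \<le> (\<integral>\<^sup>+ h. indicator (ball 0 (2 * R) - ball 0 R) h * (ennreal (norm h powr ?p) * ?D h) \<partial>lborel)"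
      using assms \<alpha> m Rd R unfolding \<omega>_def by (intro L2_norm_le_shell_integral[of v S] S) auto
    also have "\<dots> \<le> ennreal (4 * (2 - \<alpha>)) * ?G"
      using assms \<alpha> R by (intro shell_integral_le increment_square_doubling) auto
    also have "\<dots> \<le> ennreal (4 / c * A) * ?G"
      using A c(1) by (intro mult_right_mono ennreal_leI) (auto simp: field_simps)
    also have "\<dots> = ennreal (4 / c) * energy (frac_kernel \<alpha>) UNIV v"
      unfolding E using A0 c(1) ennreal_mult[of "4 / c" A] by (simp add: mult.assoc)
    finally have "(\<integral>\<^sup>+ x. ennreal ((v x)\<^sup>2) \<partial>lborel)
      \<le> ennreal ((4 / c) / (m * (2 * R) powr ?p)) * energy (frac_kernel \<alpha>) UNIV v"
      by (rule ennreal_mult_le_mult_divide) (use m R c in auto)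
    also have "\<dots> \<le> ennreal (C * m powr (\<alpha> / ?d)) * energy (frac_kernel \<alpha>) UNIV v"
    proof (intro mult_right_mono ennreal_leI)
      have e: "1 / (2 * R) powr ?p = 2 powr (?d + \<alpha>) * (R ^ DIM('a) * R powr \<alpha>)"
      proof -
        have "1 / (2 * R) powr ?p = (2 * R) powr (?d + \<alpha>)"
          using powr_minus_divide[of "2 * R" ?p] by (simp add: add.commute)
        then show ?thesis using R by (simp add: powr_mult powr_add powr_realpow mult_ac)
      qed
      have "R powr \<alpha> = (2 / \<omega>) powr (\<alpha> / ?d) * m powr (\<alpha> / ?d)"
        unfolding R_def using m \<omega> by (simp add: powr_powr powr_mult[symmetric])
      also have "\<dots> \<le> M powr 2 * m powr (\<alpha> / ?d)"
      proof (rule mult_right_mono)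
        have "\<alpha> \<le> 2 * ?d" using \<alpha> DIM_positive[where 'a='a] by (smt (verit) Suc_leI of_nat_1 of_nat_mono One_nat_def)
        then have "\<alpha> / ?d \<le> 2" by (simp add: divide_le_eq)
        have "(2 / \<omega>) powr (\<alpha> / ?d) \<le> M powr (\<alpha> / ?d)"
          using assms \<alpha> \<omega> by (intro powr_mono2) (auto simp: M_def)
        also have "\<dots> \<le> M powr 2" using \<open>\<alpha> / ?d \<le> 2\<close> by (intro powr_mono) (auto simp: M_def)
        finally show "(2 / \<omega>) powr (\<alpha> / ?d) \<le> M powr 2" .
      qed simp
      finally have Ra: "R powr \<alpha> \<le> M powr 2 * m powr (\<alpha> / ?d)" .
      have "(4 / c) / (m * (2 * R) powr ?p) = 4 / c / m * (1 / (2 * R) powr ?p)" by simp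
      also have "\<dots> = 4 / c * (2 powr (?d + \<alpha>) * ((R ^ DIM('a) / m) * R powr \<alpha>))"
        unfolding e by simp
      also have "R ^ DIM('a) / m = 2 / \<omega>" using Rd m \<omega> by (simp add: field_simps)
      also have "4 / c * (2 powr (?d + \<alpha>) * (2 / \<omega> * R powr \<alpha>))
        \<le> 4 / c * (2 powr (?d + 2) * (2 / \<omega> * (M powr 2 * m powr (\<alpha> / ?d))))"
        using \<alpha> Ra \<omega> c(1) by (intro mult_left_mono mult_mono powr_mono) auto
      also have "\<dots> = C * m powr (\<alpha> / ?d)" by (simp add: C_def)
      finally show "(4 / c) / (m * (2 * R) powr ?p) \<le> C * m powr (\<alpha> / ?d)" .
    qed auto
    finally show ?thesis .
  qed
  ultimately show ?thesis by blast
qed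

section \<open>The Caccioppoli inequality\<close>

text \<open>If g has infinite integral there is nothing to show; otherwise f + g dominates h, which
  makes h integrable. In this form the Caccioppoli inequality can be derived before its right-hand
  side is known to be finite.\<close>

lemma nn_integral_le_of_integral_nonpos:
  fixes f g h :: "'a \<Rightarrow> real"
  assumes f: "integrable M f" "integral\<^sup>L M f \<le> 0"
    and [measurable]: "g \<in> borel_measurable M" "h \<in> borel_measurable M"
    and nonneg: "\<And>x. 0 \<le> g x" "\<And>x. 0 \<le> h x" and le: "\<And>x. h x \<le> f x + g x"
  shows "(\<integral>\<^sup>+ x. ennreal (h x) \<partial>M) \<le> (\<integral>\<^sup>+ x. ennreal (g x) \<partial>M)"
proof (cases "(\<integral>\<^sup>+ x. ennreal (g x) \<partial>M) = \<infinity>")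
  case False
  then have g: "integrable M g"
    using nonneg by (intro integrableI_nonneg) (auto simp: top.not_eq_extremum)
  then have fg: "integrable M (\<lambda>x. f x + g x)" using f by auto
  have h: "integrable M h"
    by (rule Bochner_Integration.integrable_bound[OF fg]) (use le nonneg in \<open>auto intro!: AE_I2 order_trans[OF le]\<close>)
  have "integral\<^sup>L M h \<le> (\<integral> x. f x + g x \<partial>M)" by (intro integral_mono h fg le)
  also have "\<dots> \<le> integral\<^sup>L M g" using f g by simp
  finally show ?thesis
    using nonneg by (simp add: nn_integral_eq_integral[OF h] nn_integral_eq_integral[OF g] ennreal_leI)
qed simp

lemma square_cutoff_increment_le:
  fixes s t a b :: real
  assumes "0 \<le> s" "s \<le> 1"
  shows "(s * a - t * b)\<^sup>2 \<le> 2 * (a - b)\<^sup>2 + 2 * (b\<^sup>2 * (s - t)\<^sup>2)"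
proof -
  have e: "s * a - t * b = s * (a - b) + b * (s - t)" by (simp add: algebra_simps)
  have "(s * a - t * b)\<^sup>2 \<le> 2 * (s * (a - b))\<^sup>2 + 2 * (b * (s - t))\<^sup>2"
    unfolding e using zero_le_power2[of "s * (a - b) - b * (s - t)"]
    by (simp add: power2_eq_square algebra_simps)
  also have "(s * (a - b))\<^sup>2 \<le> (a - b)\<^sup>2"
    using mult_right_mono[of "s\<^sup>2" 1 "(a - b)\<^sup>2"] assms by (simp add: power_mult_distrib power_le_one)
  finally show ?thesis by (simp add: power_mult_distrib)
qed

text \<open>The identity \<open>(a - b)(s\<^sup>2 a - t\<^sup>2 b) = (s a - t b)\<^sup>2 - a b (s - t)\<^sup>2\<close>, combined with
  the fact that replacing \<open>u\<close> by \<open>(u - l)\<^sub>+\<close> only decreases the product with the test function.\<close>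

lemma subsolution_test_inequality:
  fixes ux uy l s t :: real
  defines "a \<equiv> max (uy - l) 0" and "b \<equiv> max (ux - l) 0"
  shows "(s * a - t * b)\<^sup>2 \<le> (uy - ux) * (s\<^sup>2 * a - t\<^sup>2 * b) + b * a * (t - s)\<^sup>2"
proof -
  have id: "(a - b) * (s\<^sup>2 * a - t\<^sup>2 * b) = (s * a - t * b)\<^sup>2 - b * a * (t - s)\<^sup>2"
    by (simp add: power2_eq_square algebra_simps)
  have "(a - b) * (s\<^sup>2 * a) \<le> (uy - ux) * (s\<^sup>2 * a)"
    by (cases "uy \<le> l") (auto simp: a_def b_def intro!: mult_right_mono)
  moreover have "(uy - ux) * (t\<^sup>2 * b) \<le> (a - b) * (t\<^sup>2 * b)"
    by (cases "ux \<le> l") (auto simp: a_def b_def intro!: mult_right_mono)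
  ultimately show ?thesis using id by (simp add: right_diff_distrib)
qed

text \<open>The right-hand side is the weight in the integrability condition of
  \<open>kernel_ok\<close>: Lipschitz continuity serves at short range, boundedness of the cutoff at
  long range.\<close>

lemma Lipschitz_square_le_min:
  fixes s t B n :: real
  assumes "0 \<le> s" "s \<le> 1" "0 \<le> t" "t \<le> 1" "\<bar>s - t\<bar> \<le> B * n"
  shows "(s\<^sup>2 - t\<^sup>2)\<^sup>2 \<le> max 1 (4 * B\<^sup>2) * min 1 (n\<^sup>2)"
proof -
  have "\<bar>s\<^sup>2 - t\<^sup>2\<bar> = \<bar>s + t\<bar> * \<bar>s - t\<bar>" by (simp add: abs_mult[symmetric] power2_eq_square algebra_simps)
  also have "\<dots> \<le> 2 * (B * n)" using assms by (intro mult_mono) auto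
  finally have "\<bar>s\<^sup>2 - t\<^sup>2\<bar>\<^sup>2 \<le> (2 * (B * n))\<^sup>2" by (intro power_mono) auto
  then have 1: "(s\<^sup>2 - t\<^sup>2)\<^sup>2 \<le> 4 * B\<^sup>2 * n\<^sup>2" by (simp add: power_mult_distrib)
  have "s\<^sup>2 \<le> 1" "t\<^sup>2 \<le> 1" "0 \<le> s\<^sup>2" "0 \<le> t\<^sup>2" using assms by (auto simp: power_le_one)
  then have "\<bar>s\<^sup>2 - t\<^sup>2\<bar> \<le> 1" by linarith
  then have 2: "(s\<^sup>2 - t\<^sup>2)\<^sup>2 \<le> 1" by (simp add: abs_square_le_1)
  show ?thesis
  proof (cases "n\<^sup>2 \<le> 1")
    case True
    then show ?thesis using 1 mult_right_mono[of "4 * B\<^sup>2" "max 1 (4 * B\<^sup>2)" "n\<^sup>2"] by (simp add: min_def)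
  next
    case False
    then show ?thesis using 2 by (simp add: min_def)
  qed
qed

section \<open>Admissibility of the test function and the integrated inequality\<close>

lemma kernel_ok_nonneg: "kernel_ok k \<Longrightarrow> x \<noteq> y \<Longrightarrow> 0 \<le> k x y"
  by (auto simp: kernel_ok_def)

text \<open>Purely qualitative: it makes the test function admissible, and its bound enters no later
  constant. Increments of the truncation are controlled by those of u, and increments of the squared
  cutoff by the supremum in \<open>kernel_ok\<close> times the squared L2 norm of u.\<close>

lemma cutoff_energy_finite:
  fixes k :: "'a::euclidean_space \<Rightarrow> 'a \<Rightarrow> real"
  assumes k: "kernel_ok k"
    and [measurable]: "u \<in> borel_measurable borel" "\<eta> \<in> borel_measurable borel"
    and uL2: "(\<integral>\<^sup>+ x. ennreal ((u x)\<^sup>2) \<partial>lborel) < \<infinity>" and uE: "energy k UNIV u < \<infinity>"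
    and \<eta>: "\<And>x. 0 \<le> \<eta> x" "\<And>x. \<eta> x \<le> 1" "\<And>x y. \<bar>\<eta> x - \<eta> y\<bar> \<le> B * norm (x - y)" and l: "0 \<le> l"
  shows "energy k UNIV (\<lambda>x. (\<eta> x)\<^sup>2 * max (u x - l) 0) < \<infinity>"
proof -
  have [measurable]: "(\<lambda>p. k (fst p) (snd p)) \<in> borel_measurable (lborel \<Otimes>\<^sub>M lborel)"
    using k by (simp add: kernel_ok_def)
  have [measurable]: "k x \<in> borel_measurable borel" for x
    using measurable_Pair2[of "\<lambda>p. k (fst p) (snd p)" lborel lborel borel x] by simp
  define w where "w x = max (u x - l) 0" for x
  have [measurable]: "w \<in> borel_measurable borel" unfolding w_def by measurable
  define B' where "B' = max 1 (4 * B\<^sup>2)"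
  have B': "B' > 0" by (simp add: B'_def)
  define Q where "Q = (SUP x. \<integral>\<^sup>+ y. ennreal (min 1 ((norm (y - x))\<^sup>2) * k x y) \<partial>lborel)"
  have Q: "Q < \<infinity>" using k by (simp add: kernel_ok_def Q_def)
  have "energy k UNIV (\<lambda>x. (\<eta> x)\<^sup>2 * w x) \<le>
    (\<integral>\<^sup>+ p. 2 * ennreal ((u (snd p) - u (fst p))\<^sup>2 * k (fst p) (snd p)) +
       ennreal (2 * B') * (ennreal ((w (fst p))\<^sup>2) * ennreal (min 1 ((norm (snd p - fst p))\<^sup>2) * k (fst p) (snd p))) \<partial>(lborel \<Otimes>\<^sub>M lborel))"
  proof (subst energy_UNIV_lborel, measurable, rule nn_integral_mono)
    fix p :: "'a \<times> 'a"
    obtain x y where p: "p = (x, y)" by force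
    show "ennreal (((\<eta> (snd p))\<^sup>2 * w (snd p) - (\<eta> (fst p))\<^sup>2 * w (fst p))\<^sup>2 * k (fst p) (snd p)) \<le>
      2 * ennreal ((u (snd p) - u (fst p))\<^sup>2 * k (fst p) (snd p)) +
       ennreal (2 * B') * (ennreal ((w (fst p))\<^sup>2) * ennreal (min 1 ((norm (snd p - fst p))\<^sup>2) * k (fst p) (snd p)))"
    proof (cases "x = y")
      case False
      have k0: "0 \<le> k x y" using kernel_ok_nonneg[OF k False] .
      have "((\<eta> y)\<^sup>2 * w y - (\<eta> x)\<^sup>2 * w x)\<^sup>2 \<le> 2 * (w y - w x)\<^sup>2 + 2 * ((w x)\<^sup>2 * ((\<eta> y)\<^sup>2 - (\<eta> x)\<^sup>2)\<^sup>2)"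
        by (rule square_cutoff_increment_le) (use \<eta> in \<open>auto simp: power_le_one\<close>)
      also have "\<dots> \<le> 2 * (u y - u x)\<^sup>2 + 2 * ((w x)\<^sup>2 * (B' * min 1 ((norm (y - x))\<^sup>2)))"
      proof (intro add_mono mult_left_mono)
        show "(w y - w x)\<^sup>2 \<le> (u y - u x)\<^sup>2"
          by (rule abs_le_square_iff[THEN iffD1]) (auto simp: w_def)
        show "((\<eta> y)\<^sup>2 - (\<eta> x)\<^sup>2)\<^sup>2 \<le> B' * min 1 ((norm (y - x))\<^sup>2)"
          unfolding B'_def by (intro Lipschitz_square_le_min \<eta>)
      qed auto
      finally have "((\<eta> y)\<^sup>2 * w y - (\<eta> x)\<^sup>2 * w x)\<^sup>2 * k x y \<le>
        (2 * (u y - u x)\<^sup>2 + 2 * ((w x)\<^sup>2 * (B' * min 1 ((norm (y - x))\<^sup>2)))) * k x y"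
        by (rule mult_right_mono[OF _ k0])
      also have "\<dots> = 2 * ((u y - u x)\<^sup>2 * k x y) + 2 * B' * ((w x)\<^sup>2 * (min 1 ((norm (y - x))\<^sup>2) * k x y))"
        by (simp add: algebra_simps)
      finally have "ennreal (((\<eta> y)\<^sup>2 * w y - (\<eta> x)\<^sup>2 * w x)\<^sup>2 * k x y) \<le> ennreal \<dots>"
        by (rule ennreal_leI)
      also have "\<dots> = 2 * ennreal ((u y - u x)\<^sup>2 * k x y) +
         ennreal (2 * B') * (ennreal ((w x)\<^sup>2) * ennreal (min 1 ((norm (y - x))\<^sup>2) * k x y))"
        using k0 B' by (subst ennreal_plus) (auto simp: ennreal_mult ennreal_mult'')
      finally show ?thesis by (simp add: p)
    qed (simp add: p)
  qed
  also have "\<dots> = 2 * (\<integral>\<^sup>+ p. ennreal ((u (snd p) - u (fst p))\<^sup>2 * k (fst p) (snd p)) \<partial>(lborel \<Otimes>\<^sub>M lborel)) +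
      ennreal (2 * B') * (\<integral>\<^sup>+ p. ennreal ((w (fst p))\<^sup>2) * ennreal (min 1 ((norm (snd p - fst p))\<^sup>2) * k (fst p) (snd p)) \<partial>(lborel \<Otimes>\<^sub>M lborel))"
    by (subst nn_integral_add) (measurable, simp add: nn_integral_cmult)
  also have "(\<integral>\<^sup>+ p. ennreal ((u (snd p) - u (fst p))\<^sup>2 * k (fst p) (snd p)) \<partial>(lborel \<Otimes>\<^sub>M lborel)) = energy k UNIV u"
    by (subst energy_UNIV_lborel) auto
  also have "(\<integral>\<^sup>+ p. ennreal ((w (fst p))\<^sup>2) * ennreal (min 1 ((norm (snd p - fst p))\<^sup>2) * k (fst p) (snd p)) \<partial>(lborel \<Otimes>\<^sub>M lborel))
     = (\<integral>\<^sup>+ x. ennreal ((w x)\<^sup>2) * (\<integral>\<^sup>+ y. ennreal (min 1 ((norm (y - x))\<^sup>2) * k x y) \<partial>lborel) \<partial>lborel)"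
    by (subst lborel.nn_integral_fst[symmetric]) (measurable, auto intro!: nn_integral_cong nn_integral_cmult)
  also have "\<dots> \<le> (\<integral>\<^sup>+ x. ennreal ((u x)\<^sup>2) * Q \<partial>lborel)"
    using l unfolding Q_def
    by (intro nn_integral_mono mult_mono SUP_upper ennreal_leI abs_le_square_iff[THEN iffD1]) (auto simp: w_def)
  also have "\<dots> = (\<integral>\<^sup>+ x. ennreal ((u x)\<^sup>2) \<partial>lborel) * Q"
    by (rule nn_integral_multc) measurable
  finally have "energy k UNIV (\<lambda>x. (\<eta> x)\<^sup>2 * w x) \<le> 2 * energy k UNIV u +
     ennreal (2 * B') * ((\<integral>\<^sup>+ x. ennreal ((u x)\<^sup>2) \<partial>lborel) * Q)"
    by (simp add: add_left_mono mult_left_mono)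
  also have "\<dots> < \<infinity>" using uL2 uE Q by (auto simp: ennreal_mult_less_top)
  finally show ?thesis unfolding w_def .
qed

lemma abs_mult_le_sum_squares: "\<bar>a * b\<bar> \<le> a\<^sup>2 + b\<^sup>2" for a b :: real
proof -
  have "2 * (\<bar>a\<bar> * \<bar>b\<bar>) \<le> a\<^sup>2 + b\<^sup>2"
    using sum_squares_bound[of "\<bar>a\<bar>" "\<bar>b\<bar>"] by (simp add: mult.assoc)
  moreover have "0 \<le> \<bar>a\<bar> * \<bar>b\<bar>" by simp
  ultimately show ?thesis unfolding abs_mult by linarith
qed

text \<open>Multiply \<open>subsolution_test_inequality\<close> by k and integrate: the term
  containing u has nonpositive integral by the subsolution property. The remainder keeps the product
  w(x) w(y) instead of a sum of squares, since at long range one factor is localised by the cutoff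
  and the other has to become the tail, which is linear in w.\<close>

lemma caccioppoli:
  fixes k :: "'a::euclidean_space \<Rightarrow> 'a \<Rightarrow> real"
  assumes k: "kernel_ok k"
    and [measurable]: "u \<in> borel_measurable borel" "\<eta> \<in> borel_measurable borel"
    and u: "u \<in> Hspace k"
    and sub: "\<And>\<phi>. \<phi> \<in> Hspace0 k (ball x0 r) \<Longrightarrow> (AE x in lebesgue. \<phi> x \<ge> 0) \<Longrightarrow> Eform k UNIV u \<phi> \<le> 0"
    and \<eta>: "\<And>x. 0 \<le> \<eta> x" "\<And>x. \<eta> x \<le> 1" "\<And>x y. \<bar>\<eta> x - \<eta> y\<bar> \<le> B * norm (x - y)"
    and supp: "\<And>x. x \<notin> ball x0 r \<Longrightarrow> \<eta> x = 0" and l: "0 \<le> l"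
  defines "w \<equiv> \<lambda>x. max (u x - l) 0"
  shows "energy k UNIV (\<lambda>x. \<eta> x * w x) \<le>
    (\<integral>\<^sup>+ p. ennreal (w (fst p) * w (snd p) * (\<eta> (fst p) - \<eta> (snd p))\<^sup>2 * k (fst p) (snd p)) \<partial>(lborel \<Otimes>\<^sub>M lborel))"
proof -
  have [measurable]: "(\<lambda>p. k (fst p) (snd p)) \<in> borel_measurable (lborel \<Otimes>\<^sub>M lborel)"
    using k by (simp add: kernel_ok_def)
  have [measurable]: "w \<in> borel_measurable borel" unfolding w_def by measurable
  define \<phi> where "\<phi> x = (\<eta> x)\<^sup>2 * w x" for x
  have [measurable]: "\<phi> \<in> borel_measurable borel" unfolding \<phi>_def by measurable
  have leb: "f \<in> borel_measurable lebesgue" if "f \<in> borel_measurable borel" for f :: "'a \<Rightarrow> real"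
    using that by (intro measurable_completion) simp
  have uint: "integrable lebesgue (\<lambda>x. (u x)\<^sup>2)" using u by (simp add: Hspace_def)
  then have uL2: "(\<integral>\<^sup>+ x. ennreal ((u x)\<^sup>2) \<partial>lborel) < \<infinity>"
    unfolding integrable_iff_bounded by (simp add: nn_integral_completion)
  have uE: "energy k UNIV u < \<infinity>" using u by (simp add: Hspace_def)
  have \<phi>E: "energy k UNIV \<phi> < \<infinity>"
    unfolding \<phi>_def w_def by (rule cutoff_energy_finite[where B=B]) (use assms uL2 uE in auto)
  have \<phi>0: "0 \<le> \<phi> x" for x by (simp add: \<phi>_def w_def)
  have \<phi>u: "(\<phi> x)\<^sup>2 \<le> (u x)\<^sup>2" for x
  proof (rule abs_le_square_iff[THEN iffD1])
    have "\<phi> x \<le> 1 * w x" unfolding \<phi>_def using \<eta>(1,2)[of x] by (intro mult_right_mono) (auto simp: power_le_one w_def)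
    also have "\<dots> \<le> \<bar>u x\<bar>" using l by (auto simp: w_def)
    finally show "\<bar>\<phi> x\<bar> \<le> \<bar>u x\<bar>" using \<phi>0[of x] by simp
  qed
  have "integrable lebesgue (\<lambda>x. (\<phi> x)\<^sup>2)"
    by (rule Bochner_Integration.integrable_bound[OF uint]) (auto intro!: leb simp: \<phi>u)
  then have "\<phi> \<in> Hspace0 k (ball x0 r)"
    using \<phi>E supp unfolding Hspace0_def Hspace_def by (auto intro!: leb AE_I2 simp: \<phi>_def)
  then have "Eform k UNIV u \<phi> \<le> 0" using \<phi>0 by (intro sub) auto
  moreover have "Eform k UNIV u \<phi> = (\<integral> p. (u (snd p) - u (fst p)) * (\<phi> (snd p) - \<phi> (fst p)) * k (fst p) (snd p) \<partial>(lborel \<Otimes>\<^sub>M lborel))"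
    (is "_ = integral\<^sup>L _ ?f")
    unfolding Eform_def UNIV_Times_UNIV indicator_UNIV mult_1 by (rule integral_pair_lebesgue) measurable
  ultimately have f0: "integral\<^sup>L (lborel \<Otimes>\<^sub>M lborel) ?f \<le> 0" by simp
  \<comment> \<open>Needed to exploit \<open>f0\<close>: a non-integrable integrand has Bochner
    integral 0, and the sign would then say nothing.\<close>
  have "integrable (lborel \<Otimes>\<^sub>M lborel) ?f"
  proof (rule integrableI_bounded)
    have "(\<integral>\<^sup>+ p. ennreal (norm (?f p)) \<partial>(lborel \<Otimes>\<^sub>M lborel)) \<le>
      (\<integral>\<^sup>+ p. ennreal ((u (snd p) - u (fst p))\<^sup>2 * k (fst p) (snd p)) + ennreal ((\<phi> (snd p) - \<phi> (fst p))\<^sup>2 * k (fst p) (snd p)) \<partial>(lborel \<Otimes>\<^sub>M lborel))"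
    proof (rule nn_integral_mono)
      fix p :: "'a \<times> 'a"
      obtain x y where p: "p = (x, y)" by force
      show "ennreal (norm (?f p)) \<le> ennreal ((u (snd p) - u (fst p))\<^sup>2 * k (fst p) (snd p)) + ennreal ((\<phi> (snd p) - \<phi> (fst p))\<^sup>2 * k (fst p) (snd p))"
      proof (cases "x = y")
        case False
        have k0: "0 \<le> k x y" using kernel_ok_nonneg[OF k False] .
        have "\<bar>(u y - u x) * (\<phi> y - \<phi> x)\<bar> * k x y \<le> ((u y - u x)\<^sup>2 + (\<phi> y - \<phi> x)\<^sup>2) * k x y"
          by (intro mult_right_mono abs_mult_le_sum_squares k0)
        then have "norm (?f p) \<le> ((u y - u x)\<^sup>2 + (\<phi> y - \<phi> x)\<^sup>2) * k x y"
          using k0 by (simp add: p abs_mult)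
        then show ?thesis using k0 by (simp add: p ennreal_plus[symmetric] distrib_right ennreal_leI del: ennreal_plus)
      qed (simp add: p)
    qed
    also have "\<dots> = energy k UNIV u + energy k UNIV \<phi>"
      by (subst nn_integral_add) (auto simp: energy_UNIV_lborel)
    also have "\<dots> < \<infinity>" using uE \<phi>E by simp
    finally show "(\<integral>\<^sup>+ p. ennreal (norm (?f p)) \<partial>(lborel \<Otimes>\<^sub>M lborel)) < \<infinity>" .
  qed measurable
  note main = nn_integral_le_of_integral_nonpos[OF this f0, 
     of "\<lambda>p. w (fst p) * w (snd p) * (\<eta> (fst p) - \<eta> (snd p))\<^sup>2 * k (fst p) (snd p)"
        "\<lambda>p. (\<eta> (snd p) * w (snd p) - \<eta> (fst p) * w (fst p))\<^sup>2 * k (fst p) (snd p)"]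
  show ?thesis
  proof (subst energy_UNIV_lborel, measurable, rule main)
    fix p :: "'a \<times> 'a"
    obtain x y where p: "p = (x, y)" by force
    have w0: "0 \<le> w x" for x by (simp add: w_def)
    show "0 \<le> w (fst p) * w (snd p) * (\<eta> (fst p) - \<eta> (snd p))\<^sup>2 * k (fst p) (snd p)"
      using kernel_ok_nonneg[OF k, of x y] w0 by (cases "x = y") (auto simp: p)
    show "0 \<le> (\<eta> (snd p) * w (snd p) - \<eta> (fst p) * w (fst p))\<^sup>2 * k (fst p) (snd p)"
      using kernel_ok_nonneg[OF k, of x y] by (cases "x = y") (auto simp: p)
    show "(\<eta> (snd p) * w (snd p) - \<eta> (fst p) * w (fst p))\<^sup>2 * k (fst p) (snd p)
      \<le> ?f p + w (fst p) * w (snd p) * (\<eta> (fst p) - \<eta> (snd p))\<^sup>2 * k (fst p) (snd p)"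
    proof (cases "x = y")
      case False
      have "(\<eta> y * w y - \<eta> x * w x)\<^sup>2 * k x y \<le> ((u y - u x) * (\<phi> y - \<phi> x) + w x * w y * (\<eta> x - \<eta> y)\<^sup>2) * k x y"
        unfolding \<phi>_def w_def
        by (intro mult_right_mono subsolution_test_inequality kernel_ok_nonneg[OF k False])
      then show ?thesis by (simp add: p algebra_simps)
    qed (simp add: p)
  qed measurable
qed

section \<open>Near and far part of the cutoff energy\<close>

lemma ennreal_le_suminf: "f j \<le> (\<Sum>i. f i)" for f :: "nat \<Rightarrow> ennreal"
  using sum_le_suminf[of f "{j}"] by simp

lemma dyadic_scale_exists:
  fixes \<delta> n :: real
  assumes "0 < n" "n < \<delta>"
  shows "\<exists>j::nat. \<delta> / 2 ^ Suc j \<le> n \<and> n < \<delta> / 2 ^ j"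
proof -
  obtain N where N: "(1 / 2) ^ N < n / \<delta>"
    using real_arch_pow_inv[of "n / \<delta>" "1 / 2"] assms by auto
  have "(1 / 2) ^ Suc N \<le> (1/2::real) ^ N" by simp
  then have "\<delta> * (1 / 2) ^ Suc N \<le> n" using N assms by (simp add: field_simps)
  then have ex: "\<delta> / 2 ^ Suc N \<le> n" by (simp add: power_one_over)
  define j where "j = (LEAST j. \<delta> / 2 ^ Suc j \<le> n)"
  have j: "\<delta> / 2 ^ Suc j \<le> n" unfolding j_def by (rule LeastI[of _ N]) (rule ex)
  moreover have "n < \<delta> / 2 ^ j"
  proof (cases j)
    case (Suc i)
    then have "\<not> \<delta> / 2 ^ Suc i \<le> n" using not_less_Least[of i "\<lambda>j. \<delta> / 2 ^ Suc j \<le> n"] j_def by simp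
    then show ?thesis using Suc by simp
  qed (use assms in simp)
  ultimately show ?thesis by blast
qed

text \<open>On each dyadic shell the weight is at most its value at the inner radius, and the shell
  is contained in its outer ball. The resulting series is geometric with ratio 2^(-(2-\<alpha>)),
  whose sum is of order 1/(2-\<alpha>). This avoids polar coordinates.\<close>

lemma nn_integral_ball_norm_powr_le:
  assumes d: "2 \<le> DIM('a::euclidean_space)" and \<alpha>: "0 < \<alpha>" "\<alpha> < 2" and \<delta>: "0 < \<delta>"
  shows "(\<integral>\<^sup>+ h. indicator (ball 0 \<delta>) h * ennreal (norm (h::'a) powr (2 - real DIM('a) - \<alpha>)) \<partial>lborel)
    \<le> ennreal (8 * unit_ball_vol (real DIM('a)) * 2 ^ DIM('a) * \<delta> powr (2 - \<alpha>) / (2 - \<alpha>))"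
proof -
  let ?d = "real DIM('a)"
  define s where "s = ?d + \<alpha> - 2"
  define \<omega> where "\<omega> = unit_ball_vol ?d"
  have \<omega>: "\<omega> > 0" by (simp add: \<omega>_def)
  \<comment> \<open>The weight must decrease in the norm for the inner radius to be the worst case;
    this is where the dimension bound enters.\<close>
  have s: "s > 0" using d \<alpha> by (simp add: s_def)
  have es: "2 - ?d - \<alpha> = - s" by (simp add: s_def)
  let ?f = "\<lambda>j h. ennreal ((\<delta> / 2 ^ Suc j) powr (- s)) * indicator (ball (0::'a) (\<delta> / 2 ^ j)) h"
  have pt: "indicator (ball 0 \<delta>) h * ennreal (norm h powr (- s)) \<le> (\<Sum>j. ?f j h)" for h :: 'a
  proof (cases "h \<noteq> 0 \<and> h \<in> ball 0 \<delta>")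
    case True
    then obtain j where j: "\<delta> / 2 ^ Suc j \<le> norm h" "norm h < \<delta> / 2 ^ j"
      using dyadic_scale_exists[of "norm h" \<delta>] by auto
    have "norm h powr (- s) \<le> (\<delta> / 2 ^ Suc j) powr (- s)"
      using j(1) s \<delta> by (intro powr_mono2') auto
    then have "indicator (ball 0 \<delta>) h * ennreal (norm h powr (- s)) \<le> ?f j h"
      using True j(2) by (simp add: ennreal_leI)
    also have "\<dots> \<le> (\<Sum>j. ?f j h)" by (rule ennreal_le_suminf)
    finally show ?thesis .
  qed (auto simp: indicator_def)
  define z where "z = 2 powr (- (2 - \<alpha>))"
  have z: "0 < z" "z < 1" using powr_less_mono[of "- (2 - \<alpha>)" 0 2] \<alpha> by (auto simp: z_def)
  have tm: "(\<integral>\<^sup>+ h. ?f j h \<partial>lborel) = ennreal (\<omega> * 2 powr s * \<delta> powr (2 - \<alpha>) * z ^ j)" for j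
  proof -
    have "(\<integral>\<^sup>+ h. ?f j h \<partial>lborel) = ennreal ((\<delta> / 2 ^ Suc j) powr (- s)) * emeasure lborel (ball (0::'a) (\<delta> / 2 ^ j))"
      by (rule nn_integral_cmult_indicator) simp
    also have "emeasure lborel (ball (0::'a) (\<delta> / 2 ^ j)) = ennreal (\<omega> * (\<delta> / 2 ^ j) ^ DIM('a))"
      unfolding \<omega>_def using \<delta> by (intro emeasure_ball) simp
    also have "ennreal ((\<delta> / 2 ^ Suc j) powr (- s)) * ennreal (\<omega> * (\<delta> / 2 ^ j) ^ DIM('a))
      = ennreal ((\<delta> / 2 ^ Suc j) powr (- s) * (\<omega> * (\<delta> / 2 ^ j) ^ DIM('a)))"
      using \<omega> \<delta> by (intro ennreal_mult[symmetric]) auto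
    also have "(\<delta> / 2 ^ Suc j) powr (- s) * (\<omega> * (\<delta> / 2 ^ j) ^ DIM('a)) = \<omega> * 2 powr s * \<delta> powr (2 - \<alpha>) * z ^ j"
    proof -
      have a: "\<delta> / 2 ^ Suc j = \<delta> * 2 powr (- real (Suc j))" "\<delta> / 2 ^ j = \<delta> * 2 powr (- real j)"
        by (simp_all only: powr_minus_divide powr_realpow[OF zero_less_numeral] times_divide_eq_right mult_1_right)
      have b: "(\<delta> * 2 powr (- real j)) ^ DIM('a) = \<delta> powr ?d * 2 powr (- real j * ?d)"
        using \<delta> by (subst powr_realpow[symmetric]) (simp_all add: powr_mult powr_powr)
      have c: "(\<delta> * 2 powr (- real (Suc j))) powr (- s) = \<delta> powr (- s) * 2 powr (real (Suc j) * s)"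
        using \<delta> by (simp add: powr_mult powr_powr del: of_nat_Suc)
      have "(\<delta> / 2 ^ Suc j) powr (- s) * (\<omega> * (\<delta> / 2 ^ j) ^ DIM('a))
         = \<omega> * ((\<delta> powr (- s) * \<delta> powr ?d) * (2 powr (real (Suc j) * s) * 2 powr (- real j * ?d)))"
        unfolding a b c by (simp only: mult_ac)
      also have "\<dots> = \<omega> * (\<delta> powr (2 - \<alpha>) * 2 powr (s + (- (2 - \<alpha>)) * real j))"
      proof -
        have "- s + ?d = 2 - \<alpha>" "real (Suc j) * s + - real j * ?d = s + (- (2 - \<alpha>)) * real j"
          by (simp_all add: s_def algebra_simps)
        then show ?thesis unfolding powr_add[symmetric] by (simp only:)
      qed
      also have "\<dots> = \<omega> * 2 powr s * \<delta> powr (2 - \<alpha>) * z ^ j"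
      proof -
        have "z ^ j = 2 powr ((- (2 - \<alpha>)) * real j)"
          using z(1) by (subst powr_realpow[symmetric]) (simp_all add: z_def powr_powr)
        then show ?thesis unfolding powr_add by (simp only: mult_ac)
      qed
      finally show ?thesis .
    qed
    finally show ?thesis .
  qed
  have "(\<integral>\<^sup>+ h. indicator (ball 0 \<delta>) h * ennreal (norm (h::'a) powr (- s)) \<partial>lborel) \<le> (\<integral>\<^sup>+ h. (\<Sum>j. ?f j h) \<partial>lborel)"
    by (intro nn_integral_mono pt)
  also have "\<dots> = (\<Sum>j. \<integral>\<^sup>+ h. ?f j h \<partial>lborel)" by (rule nn_integral_suminf) measurable
  also have "\<dots> = ennreal (\<Sum>j. \<omega> * 2 powr s * \<delta> powr (2 - \<alpha>) * z ^ j)"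
    unfolding tm using z \<omega> by (intro suminf_ennreal2 summable_mult summable_geometric) auto
  also have "\<dots> = ennreal (\<omega> * 2 powr s * \<delta> powr (2 - \<alpha>) * (1 / (1 - z)))"
    using z by (subst suminf_mult) (auto simp: suminf_geometric summable_geometric)
  also have "\<dots> \<le> ennreal (8 * \<omega> * 2 ^ DIM('a) * \<delta> powr (2 - \<alpha>) / (2 - \<alpha>))"
  proof (rule ennreal_leI)
    have "(2 - \<alpha>) / 8 \<le> 1 - z" using two_powr_bounds(2)[of "2 - \<alpha>"] \<alpha> by (simp add: z_def)
    then have "1 / (1 - z) \<le> 1 / ((2 - \<alpha>) / 8)" using z \<alpha> by (intro divide_left_mono) auto
    moreover have "2 powr s \<le> 2 powr ?d" using \<alpha> by (intro powr_mono) (auto simp: s_def)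
    ultimately have "\<omega> * 2 powr s * \<delta> powr (2 - \<alpha>) * (1 / (1 - z)) \<le> \<omega> * 2 powr ?d * \<delta> powr (2 - \<alpha>) * (1 / ((2 - \<alpha>) / 8))"
      using \<omega> z by (intro mult_mono) auto
    then show "\<omega> * 2 powr s * \<delta> powr (2 - \<alpha>) * (1 / (1 - z)) \<le> 8 * \<omega> * 2 ^ DIM('a) * \<delta> powr (2 - \<alpha>) / (2 - \<alpha>)"
      by (simp add: powr_realpow mult_ac)
  qed
  finally show ?thesis unfolding es \<omega>_def .
qed

text \<open>Since r \<le> (r/\<delta>) |y - x|, both r and |y - x0| \<le> |y - x| + r are at most
  (2r/\<delta>) |y - x|. Replacing the exponent -p by the larger q makes the factor independent of
  \<alpha>.\<close>

lemma norm_powr_far_le: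
  fixes x y x0 :: "'a::real_normed_vector"
  assumes \<delta>: "0 < \<delta>" "\<delta> \<le> r" and y: "\<delta> \<le> norm (y - x)" and x: "norm (x - x0) \<le> r"
    and p: "p \<le> 0" "- p \<le> q"
  shows "norm (y - x) powr p \<le> (2 * r / \<delta>) powr q * r powr p"
    and "y \<noteq> x0 \<Longrightarrow> norm (y - x) powr p \<le> (2 * r / \<delta>) powr q * norm (y - x0) powr p"
proof -
  define \<Lambda> where "\<Lambda> = 2 * r / \<delta>"
  have \<Lambda>: "2 \<le> \<Lambda>" using \<delta> by (simp add: \<Lambda>_def field_simps)
  have key: "norm (y - x) powr p \<le> \<Lambda> powr q * n powr p" if n: "0 < n" "n \<le> \<Lambda> * norm (y - x)" for n
  proof -
    have "norm (y - x) powr p \<le> (n / \<Lambda>) powr p"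
      using n \<Lambda> p by (intro powr_mono2') (auto simp: field_simps)
    also have "\<dots> = \<Lambda> powr (- p) * n powr p" using n \<Lambda> by (simp add: powr_divide powr_minus field_simps)
    also have "\<dots> \<le> \<Lambda> powr q * n powr p" using \<Lambda> p by (intro mult_right_mono powr_mono) auto
    finally show ?thesis .
  qed
  have rd: "2 * r \<le> \<Lambda> * norm (y - x)"
  proof -
    have "2 * r = \<Lambda> * \<delta>" using \<delta> by (simp add: \<Lambda>_def)
    also have "\<dots> \<le> \<Lambda> * norm (y - x)" using y \<Lambda> by (intro mult_left_mono) auto
    finally show ?thesis .
  qed
  show "norm (y - x) powr p \<le> (2 * r / \<delta>) powr q * r powr p"
    unfolding \<Lambda>_def[symmetric] using rd \<delta> by (intro key) auto
  show "norm (y - x) powr p \<le> (2 * r / \<delta>) powr q * norm (y - x0) powr p" if "y \<noteq> x0"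
    unfolding \<Lambda>_def[symmetric]
  proof (rule key)
    have "norm (y - x0) \<le> norm (y - x) + norm (x - x0)" using norm_triangle_ineq[of "y - x" "x - x0"] by simp
    also have "\<dots> \<le> norm (y - x) + r" using x by simp
    also have "\<dots> \<le> \<Lambda> * norm (y - x)"
    proof -
      have "2 * norm (y - x) \<le> \<Lambda> * norm (y - x)" using \<Lambda> by (intro mult_right_mono) auto
      then show ?thesis using rd by linarith
    qed
    finally show "norm (y - x0) \<le> \<Lambda> * norm (y - x)" .
  qed (use that in simp)
qed

lemma nn_integral_pair_symmetrize:
  fixes G :: "'a::euclidean_space \<Rightarrow> 'a \<Rightarrow> ennreal"
  assumes [measurable]: "(\<lambda>p. G (fst p) (snd p)) \<in> borel_measurable (lborel \<Otimes>\<^sub>M lborel)"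
  shows "(\<integral>\<^sup>+ p. G (fst p) (snd p) + G (snd p) (fst p) \<partial>(lborel \<Otimes>\<^sub>M lborel))
    = 2 * (\<integral>\<^sup>+ x. \<integral>\<^sup>+ y. G x y \<partial>lborel \<partial>lborel)"
proof -
  have [measurable]: "(\<lambda>p. G (snd p) (fst p)) \<in> borel_measurable (lborel \<Otimes>\<^sub>M lborel)"
    using measurable_compose[OF measurable_pair_swap' assms] by (simp add: case_prod_beta)
  have 1: "(\<integral>\<^sup>+ p. G (fst p) (snd p) \<partial>(lborel \<Otimes>\<^sub>M lborel)) = (\<integral>\<^sup>+ x. \<integral>\<^sup>+ y. G x y \<partial>lborel \<partial>lborel)"
    by (subst lborel.nn_integral_fst[symmetric]) auto
  have 2: "(\<integral>\<^sup>+ p. G (snd p) (fst p) \<partial>(lborel \<Otimes>\<^sub>M lborel)) = (\<integral>\<^sup>+ x. \<integral>\<^sup>+ y. G x y \<partial>lborel \<partial>lborel)"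
    by (subst lborel_pair.nn_integral_snd[symmetric]) auto
  show ?thesis by (subst nn_integral_add) (auto simp: 1 2 mult_2)
qed


text \<open>Away from x the kernel is compared with its value at distance r when y lies in the half
  ball, and with the kernel centred at x0 otherwise. The two regions on the right cover all y
  because \<rho> \<ge> r/2. No singularity is left here, so \<open>2 - \<alpha>\<close> is simply
  bounded by 2.\<close>

lemma nonlocal_tail_le:
  fixes w :: "'a::euclidean_space \<Rightarrow> real"
  assumes [measurable]: "w \<in> borel_measurable borel" and w0: "\<And>x. 0 \<le> w x"
    and \<alpha>: "0 < \<alpha>" "\<alpha> < 2" and \<delta>: "0 < \<delta>" "\<delta> \<le> r" and x: "norm (x - x0) \<le> r" and \<rho>: "r / 2 \<le> \<rho>"
    and cK: "0 \<le> cK"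
    and tail: "(\<integral>\<^sup>+ y\<in>- ball x0 (r/2). ennreal (w y / norm (y - x0) powr (real DIM('a) + \<alpha>)) \<partial>lborel) \<le> ennreal (r powr (- \<alpha>) * T)"
  shows "(\<integral>\<^sup>+ y. indicator (- ball 0 \<delta>) (y - x) * ennreal (w y * (cK * (2 - \<alpha>) * norm (y - x) powr (- real DIM('a) - \<alpha>))) \<partial>lborel)
    \<le> ennreal (2 * cK * (2 * r / \<delta>) powr (real DIM('a) + 2)) *
       (ennreal (r powr (- real DIM('a) - \<alpha>)) * (\<integral>\<^sup>+ y\<in>ball x0 \<rho>. ennreal (w y) \<partial>lborel) + ennreal (r powr (- \<alpha>) * T))"
proof -
  let ?d = "real DIM('a)"
  let ?p = "- ?d - \<alpha>"
  define Q where "Q = (2 * r / \<delta>) powr (?d + 2)"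
  have Q: "0 \<le> Q" by (simp add: Q_def)
  have r: "0 < r" using \<delta> by simp
  have pt: "indicator (- ball 0 \<delta>) (y - x) * ennreal (w y * (cK * (2 - \<alpha>) * norm (y - x) powr ?p))
    \<le> ennreal (2 * cK * Q) * (ennreal (r powr ?p) * (ennreal (w y) * indicator (ball x0 \<rho>) y) +
        ennreal (w y / norm (y - x0) powr (?d + \<alpha>)) * indicator (- ball x0 (r/2)) y)" for y
  proof (cases "y - x \<in> ball 0 \<delta>")
    case False
    then have y: "\<delta> \<le> norm (y - x)" by simp
    have ck2: "cK * (2 - \<alpha>) \<le> 2 * cK" "0 \<le> cK * (2 - \<alpha>)"
      using mult_left_mono[of "2 - \<alpha>" 2 cK] cK \<alpha> by (auto simp: mult.commute)
    show ?thesis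
    proof (cases "y \<in> ball x0 (r/2)")
      case True
      then have "y \<in> ball x0 \<rho>" using \<rho> by auto
      have "norm (y - x) powr ?p \<le> Q * r powr ?p"
        unfolding Q_def using \<alpha> by (intro norm_powr_far_le(1)[OF \<delta> y x]) auto
      then have "w y * (cK * (2 - \<alpha>) * norm (y - x) powr ?p) \<le> w y * ((2 * cK) * (Q * r powr ?p))"
        using ck2 w0 by (intro mult_left_mono[OF mult_mono[OF ck2(1)]]) auto
      then have "ennreal (w y * (cK * (2 - \<alpha>) * norm (y - x) powr ?p)) \<le> ennreal ((2 * cK * Q) * (r powr ?p * w y))"
        by (intro ennreal_leI) (simp add: mult_ac)
      also have "\<dots> = ennreal (2 * cK * Q) * (ennreal (r powr ?p) * ennreal (w y))"
        using cK Q w0 by (simp add: ennreal_mult)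
      finally show ?thesis using False True \<open>y \<in> ball x0 \<rho>\<close> by simp
    next
      case out: False
      then have "y \<noteq> x0" using r by auto
      then have "norm (y - x) powr ?p \<le> Q * norm (y - x0) powr ?p"
        unfolding Q_def using \<alpha> by (intro norm_powr_far_le(2)[OF \<delta> y x]) auto
      then have "w y * (cK * (2 - \<alpha>) * norm (y - x) powr ?p) \<le> w y * ((2 * cK) * (Q * norm (y - x0) powr ?p))"
        using ck2 w0 by (intro mult_left_mono[OF mult_mono[OF ck2(1)]]) auto
      also have "norm (y - x0) powr ?p = 1 / norm (y - x0) powr (?d + \<alpha>)"
        using powr_minus_divide[of "norm (y - x0)" "?d + \<alpha>"] by simp
      finally have "ennreal (w y * (cK * (2 - \<alpha>) * norm (y - x) powr ?p)) \<le> ennreal ((2 * cK * Q) * (w y / norm (y - x0) powr (?d + \<alpha>)))"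
        by (intro ennreal_leI) (simp add: mult_ac)
      also have "\<dots> = ennreal (2 * cK * Q) * ennreal (w y / norm (y - x0) powr (?d + \<alpha>))"
        using cK Q w0 by (intro ennreal_mult) auto
      also have "\<dots> \<le> ennreal (2 * cK * Q) * (ennreal (r powr ?p) * (ennreal (w y) * indicator (ball x0 \<rho>) y) +
        ennreal (w y / norm (y - x0) powr (?d + \<alpha>)) * indicator (- ball x0 (r/2)) y)"
        using out by (intro mult_left_mono) auto
      finally show ?thesis using False by simp
    qed
  qed simp
  have "(\<integral>\<^sup>+ y. indicator (- ball 0 \<delta>) (y - x) * ennreal (w y * (cK * (2 - \<alpha>) * norm (y - x) powr ?p)) \<partial>lborel)
    \<le> (\<integral>\<^sup>+ y. ennreal (2 * cK * Q) * (ennreal (r powr ?p) * (ennreal (w y) * indicator (ball x0 \<rho>) y) +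
        ennreal (w y / norm (y - x0) powr (?d + \<alpha>)) * indicator (- ball x0 (r/2)) y) \<partial>lborel)"
    by (intro nn_integral_mono pt)
  also have "\<dots> = ennreal (2 * cK * Q) * (\<integral>\<^sup>+ y. ennreal (r powr ?p) * (ennreal (w y) * indicator (ball x0 \<rho>) y) +
        ennreal (w y / norm (y - x0) powr (?d + \<alpha>)) * indicator (- ball x0 (r/2)) y \<partial>lborel)"
    by (rule nn_integral_cmult) measurable
  also have "(\<integral>\<^sup>+ y. ennreal (r powr ?p) * (ennreal (w y) * indicator (ball x0 \<rho>) y) +
        ennreal (w y / norm (y - x0) powr (?d + \<alpha>)) * indicator (- ball x0 (r/2)) y \<partial>lborel)
     = (\<integral>\<^sup>+ y. ennreal (r powr ?p) * (ennreal (w y) * indicator (ball x0 \<rho>) y) \<partial>lborel) +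
       (\<integral>\<^sup>+ y\<in>- ball x0 (r/2). ennreal (w y / norm (y - x0) powr (?d + \<alpha>)) \<partial>lborel)"
    by (rule nn_integral_add) measurable
  also have "(\<integral>\<^sup>+ y. ennreal (r powr ?p) * (ennreal (w y) * indicator (ball x0 \<rho>) y) \<partial>lborel)
     = ennreal (r powr ?p) * (\<integral>\<^sup>+ y\<in>ball x0 \<rho>. ennreal (w y) \<partial>lborel)"
    by (rule nn_integral_cmult) measurable
  finally show ?thesis
    unfolding Q_def by (rule order_trans) (intro mult_left_mono add_left_mono tail, simp)
qed

text \<open>Cauchy--Schwarz against the indicator of the ball. It turns the square of the L1 norm,
  produced by long-range interactions inside the ball, into an L2 quantity.\<close>

lemma nn_integral_square_ball_le:
  fixes w :: "'a::euclidean_space \<Rightarrow> real"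
  assumes [measurable]: "w \<in> borel_measurable borel" and w0: "\<And>x. 0 \<le> w x" and \<rho>: "0 \<le> \<rho>"
  shows "(\<integral>\<^sup>+ y\<in>ball x0 \<rho>. ennreal (w y) \<partial>lborel) * (\<integral>\<^sup>+ y\<in>ball x0 \<rho>. ennreal (w y) \<partial>lborel)
    \<le> ennreal (unit_ball_vol (real DIM('a)) * \<rho> ^ DIM('a)) * (\<integral>\<^sup>+ y\<in>ball x0 \<rho>. ennreal ((w y)\<^sup>2) \<partial>lborel)"
proof -
  let ?i = "\<lambda>y. indicator (ball x0 \<rho>) y :: ennreal"
  have i2: "(ennreal (w y) * ?i y)\<^sup>2 = ennreal ((w y)\<^sup>2) * ?i y" for y
    using w0 by (auto simp: indicator_def ennreal_power)
  have "(\<integral>\<^sup>+ y. ennreal (w y) * ?i y * ?i y \<partial>lborel)\<^sup>2 \<le>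
    (\<integral>\<^sup>+ y. (ennreal (w y) * ?i y)\<^sup>2 \<partial>lborel) * (\<integral>\<^sup>+ y. (?i y)\<^sup>2 \<partial>lborel)"
    by (rule Cauchy_Schwarz_nn_integral) measurable
  also have "(\<lambda>y. ennreal (w y) * ?i y * ?i y) = (\<lambda>y. ennreal (w y) * ?i y)" by (auto simp: indicator_def)
  also have "(\<lambda>y. (?i y)\<^sup>2) = ?i" by (auto simp: indicator_def)
  also have "(\<integral>\<^sup>+ y. ?i y \<partial>lborel) = ennreal (unit_ball_vol (real DIM('a)) * \<rho> ^ DIM('a))"
    using \<rho> by (simp add: emeasure_ball)
  finally show ?thesis unfolding i2 by (simp add: power2_eq_square mult.commute)
qed

text \<open>If the cutoff contributes at all, one of x, y lies in the ball of radius m. For |x - y|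
  < \<delta> both points then lie in the ball of radius \<rho>; the Lipschitz bound adds two to the
  exponent, and the product w(x) w(y) is split into squares. At longer range the cutoff difference
  is bounded by one and the product is kept. The estimate is symmetrised because either point may be
  the one near the centre.\<close>

lemma cutoff_kernel_split:
  fixes w \<eta> :: "'a::euclidean_space \<Rightarrow> real" and p :: real
  assumes w0: "\<And>x. 0 \<le> w x" and \<eta>: "\<And>x. 0 \<le> \<eta> x" "\<And>x. \<eta> x \<le> 1"
    "\<And>x y. \<bar>\<eta> x - \<eta> y\<bar> \<le> norm (x - y) / \<delta>"
    and supp: "\<And>x. x \<notin> ball x0 m \<Longrightarrow> \<eta> x = 0" and m: "m + \<delta> \<le> \<rho>" and \<delta>: "0 < \<delta>" and c: "0 \<le> c"
  defines "G \<equiv> \<lambda>x y. indicator (ball x0 \<rho>) x * ennreal (c / (2 * \<delta>\<^sup>2) * (w x)\<^sup>2) *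
        (indicator (ball 0 \<delta>) (y - x) * ennreal (norm (y - x) powr (2 + p)))
      + indicator (ball x0 m) x * ennreal (w x) *
        (indicator (- ball 0 \<delta>) (y - x) * ennreal (w y * (c * norm (y - x) powr p)))"
  shows "ennreal (w x * w y * (\<eta> x - \<eta> y)\<^sup>2 * (c * norm (y - x) powr p)) \<le> G x y + G y x"
proof -
  let ?n = "norm (y - x)"
  have sym: "norm (x - y) = ?n" by (rule norm_minus_commute)
  show ?thesis
  proof (cases "x \<in> ball x0 m \<or> y \<in> ball x0 m")
    case False
    then have "\<eta> x = 0" "\<eta> y = 0" using supp by auto
    then show ?thesis by simp
  next
    case near: True
    show ?thesis
    proof (cases "?n < \<delta>")
      case True
      have "dist x y < \<delta>" using True sym by (simp add: dist_norm)
      then have xy: "x \<in> ball x0 \<rho>" "y \<in> ball x0 \<rho>"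
        using near m dist_triangle[of x0 x y] dist_triangle[of x0 y x] \<delta> by (auto simp: dist_commute)
      have "(\<eta> x - \<eta> y)\<^sup>2 \<le> (?n / \<delta>)\<^sup>2"
        using power_mono[OF \<eta>(3)[of x y], of 2] sym by simp
      moreover have "w x * w y \<le> ((w x)\<^sup>2 + (w y)\<^sup>2) / 2"
        using sum_squares_bound[of "w x" "w y"] by simp
      ultimately have "w x * w y * (\<eta> x - \<eta> y)\<^sup>2 * (c * ?n powr p)
        \<le> ((w x)\<^sup>2 + (w y)\<^sup>2) / 2 * (?n / \<delta>)\<^sup>2 * (c * ?n powr p)"
        using w0 c by (intro mult_right_mono mult_mono) auto
      also have "\<dots> = (c / (2 * \<delta>\<^sup>2) * (w x)\<^sup>2 + c / (2 * \<delta>\<^sup>2) * (w y)\<^sup>2) * (?n\<^sup>2 * ?n powr p)"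
        by (simp add: power_divide field_simps, simp add: add_divide_distrib)
      also have "?n\<^sup>2 * ?n powr p = ?n powr (2 + p)"
      proof (cases "y = x")
        case False
        then have "0 < ?n" by simp
        then show ?thesis by (simp only: powr_add powr_numeral)
      qed simp
      finally have "ennreal (w x * w y * (\<eta> x - \<eta> y)\<^sup>2 * (c * ?n powr p))
         \<le> ennreal (c / (2 * \<delta>\<^sup>2) * (w x)\<^sup>2 * ?n powr (2 + p) + c / (2 * \<delta>\<^sup>2) * (w y)\<^sup>2 * ?n powr (2 + p))"
        by (intro ennreal_leI) (simp add: distrib_right)
      also have "\<dots> = ennreal (c / (2 * \<delta>\<^sup>2) * (w x)\<^sup>2) * ennreal (?n powr (2 + p)) +
          ennreal (c / (2 * \<delta>\<^sup>2) * (w y)\<^sup>2) * ennreal (?n powr (2 + p))"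
      proof -
        have "ennreal (a * n + b * n) = ennreal a * ennreal n + ennreal b * ennreal n"
          if "0 \<le> a" "0 \<le> b" "0 \<le> n" for a b n :: real
          using that by (simp add: ennreal_mult)
        then show ?thesis by this (use c in auto)
      qed
      also have "\<dots> \<le> G x y + G y x"
        unfolding G_def using xy True sym by (intro add_mono) simp_all
      finally show ?thesis .
    next
      case far: False
      have "\<bar>\<eta> x - \<eta> y\<bar> \<le> 1" using \<eta>(1,2)[of x] \<eta>(1,2)[of y] by linarith
      then have "(\<eta> x - \<eta> y)\<^sup>2 \<le> 1" by (simp add: abs_square_le_1)
      then have "w x * w y * (\<eta> x - \<eta> y)\<^sup>2 * (c * ?n powr p) \<le> w x * w y * 1 * (c * ?n powr p)"
        using w0 c by (intro mult_right_mono mult_left_mono) auto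
      then have le: "ennreal (w x * w y * (\<eta> x - \<eta> y)\<^sup>2 * (c * ?n powr p)) \<le> ennreal (w x * (w y * (c * ?n powr p)))"
        by (intro ennreal_leI) (simp add: mult_ac)
      have e: "ennreal (w x * (w y * (c * ?n powr p))) = ennreal (w x) * ennreal (w y * (c * ?n powr p))"
        "ennreal (w x * (w y * (c * ?n powr p))) = ennreal (w y) * ennreal (w x * (c * ?n powr p))"
        using w0 c by (auto simp: ennreal_mult[symmetric] mult_ac)
      from near show ?thesis
      proof
        assume "x \<in> ball x0 m"
        then have "ennreal (w x * (w y * (c * ?n powr p))) \<le> G x y"
          unfolding G_def e(1) using far sym by simp
        then show ?thesis using le by (meson add_increasing2 order_trans zero_le)
      next
        assume "y \<in> ball x0 m"
        then have "ennreal (w x * (w y * (c * ?n powr p))) \<le> G y x"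
          unfolding G_def e(2) using far sym by simp
        then show ?thesis using le by (meson add_increasing order_trans zero_le)
      qed
    qed
  qed
qed

text \<open>The first part of the split integrates to a multiple of the L2 term. The second gives
  the L1 norm times the sum of another L1 norm and the tail: the former product goes back into L2 by
  Cauchy--Schwarz, and only the product with T keeps Y1.\<close>

lemma cutoff_kernel_integral_le:
  fixes w \<eta> :: "'a::euclidean_space \<Rightarrow> real"
  assumes d: "2 \<le> DIM('a)" and [measurable]: "w \<in> borel_measurable borel"
    and w0: "\<And>x. 0 \<le> w x" and \<eta>: "\<And>x. 0 \<le> \<eta> x" "\<And>x. \<eta> x \<le> 1"
    "\<And>x y. \<bar>\<eta> x - \<eta> y\<bar> \<le> norm (x - y) / \<delta>"
    and supp: "\<And>x. x \<notin> ball x0 m \<Longrightarrow> \<eta> x = 0" and m: "m + \<delta> \<le> \<rho>" and \<delta>: "0 < \<delta>" "\<delta> \<le> r"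
    and \<rho>: "r / 2 \<le> \<rho>" "\<rho> \<le> r" and \<alpha>: "0 < \<alpha>" "\<alpha> < 2" and cK: "0 \<le> cK" and T: "0 \<le> T"
    and tail: "(\<integral>\<^sup>+ y\<in>- ball x0 (r/2). ennreal (w y / norm (y - x0) powr (real DIM('a) + \<alpha>)) \<partial>lborel) \<le> ennreal (r powr (- \<alpha>) * T)"
    and W2: "(\<integral>\<^sup>+ y\<in>ball x0 \<rho>. ennreal ((w y)\<^sup>2) \<partial>lborel) \<le> ennreal Y2" "0 \<le> Y2"
    and W1: "(\<integral>\<^sup>+ y\<in>ball x0 \<rho>. ennreal (w y) \<partial>lborel) \<le> ennreal Y1" "0 \<le> Y1"
  shows "(\<integral>\<^sup>+ p. ennreal (w (fst p) * w (snd p) * (\<eta> (fst p) - \<eta> (snd p))\<^sup>2 *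
        (cK * (2 - \<alpha>) * norm (snd p - fst p) powr (- real DIM('a) - \<alpha>))) \<partial>(lborel \<Otimes>\<^sub>M lborel))
    \<le> ennreal (cK * (2 powr (real DIM('a) + 4) * (2 * unit_ball_vol (real DIM('a)) + 1)) *
        ((r / \<delta>) powr (real DIM('a) + 2) * r powr (- \<alpha>)) * (Y2 + T * Y1))"
proof -
  let ?d = "real DIM('a)"
  let ?p = "- ?d - \<alpha>"
  define \<omega> where "\<omega> = unit_ball_vol ?d"
  have \<omega>: "\<omega> > 0" by (simp add: \<omega>_def)
  define c where "c = cK * (2 - \<alpha>)"
  have c: "0 \<le> c" using cK \<alpha> by (simp add: c_def)
  have r: "0 < r" using \<delta> by simp
  define G1 where "G1 x y = indicator (ball x0 \<rho>) x * ennreal (c / (2 * \<delta>\<^sup>2) * (w x)\<^sup>2) *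
        (indicator (ball 0 \<delta>) (y - x) * ennreal (norm (y - x) powr (2 + ?p)))" for x y
  define G2 where "G2 x y = indicator (ball x0 m) x * ennreal (w x) *
        (indicator (- ball 0 \<delta>) (y - x) * ennreal (w y * (c * norm (y - x) powr ?p)))" for x y
  have [measurable]: "(\<lambda>p. G1 (fst p) (snd p)) \<in> borel_measurable (lborel \<Otimes>\<^sub>M lborel)"
    unfolding G1_def by measurable
  have [measurable]: "(\<lambda>p. G2 (fst p) (snd p)) \<in> borel_measurable (lborel \<Otimes>\<^sub>M lborel)"
    unfolding G2_def by measurable
  have [measurable]: "G1 x \<in> borel_measurable borel" "G2 x \<in> borel_measurable borel" for x
    unfolding G1_def G2_def by measurable
  let ?W1 = "\<integral>\<^sup>+ y\<in>ball x0 \<rho>. ennreal (w y) \<partial>lborel"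
  let ?W2 = "\<integral>\<^sup>+ y\<in>ball x0 \<rho>. ennreal ((w y)\<^sup>2) \<partial>lborel"
  define Q where "Q = 2 * cK * (2 * r / \<delta>) powr (?d + 2)"
  have Q: "0 \<le> Q" using cK by (simp add: Q_def)
  \<comment> \<open>Value of (c / (2 \<delta>^2)) times the bound of
    \<open>nn_integral_ball_norm_powr_le\<close>: the \<open>2 - \<alpha>\<close> in c cancels its
    denominator.\<close>
  define b where "b = 4 * cK * \<omega> * 2 ^ DIM('a) * \<delta> powr (- \<alpha>)"
  have b: "0 \<le> b" using cK \<omega> by (simp add: b_def)
  have i1: "(\<integral>\<^sup>+ y. G1 x y \<partial>lborel) \<le> ennreal b * (ennreal ((w x)\<^sup>2) * indicator (ball x0 \<rho>) x)" for x
  proof -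
    let ?J = "8 * \<omega> * 2 ^ DIM('a) * \<delta> powr (2 - \<alpha>) / (2 - \<alpha>)"
    have "(\<integral>\<^sup>+ y. G1 x y \<partial>lborel) = indicator (ball x0 \<rho>) x * ennreal (c / (2 * \<delta>\<^sup>2) * (w x)\<^sup>2) *
        (\<integral>\<^sup>+ y. indicator (ball 0 \<delta>) (y - x) * ennreal (norm (y - x) powr (2 + ?p)) \<partial>lborel)"
      unfolding G1_def by (rule nn_integral_cmult) measurable
    also have "(\<integral>\<^sup>+ y. indicator (ball 0 \<delta>) (y - x) * ennreal (norm (y - x) powr (2 + ?p)) \<partial>lborel)
       = (\<integral>\<^sup>+ h. indicator (ball 0 \<delta>) h * ennreal (norm (h::'a) powr (2 + ?p)) \<partial>lborel)"
      using nn_integral_lborel_translate[of "\<lambda>h::'a. indicator (ball 0 \<delta>) h * ennreal (norm h powr (2 + ?p))" "- x"] by simp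
    also have "\<dots> \<le> ennreal ?J"
      using nn_integral_ball_norm_powr_le[OF d \<alpha> \<delta>(1)] by (simp add: \<omega>_def algebra_simps)
    finally have "(\<integral>\<^sup>+ y. G1 x y \<partial>lborel) \<le> indicator (ball x0 \<rho>) x * ennreal (c / (2 * \<delta>\<^sup>2) * (w x)\<^sup>2) * ennreal ?J"
      by (simp add: mult_left_mono)
    also have "\<dots> = indicator (ball x0 \<rho>) x * ennreal (c / (2 * \<delta>\<^sup>2) * (w x)\<^sup>2 * ?J)"
      using c \<omega> \<alpha> by (subst ennreal_mult) (auto simp: mult.assoc)
    also have "c / (2 * \<delta>\<^sup>2) * (w x)\<^sup>2 * ?J = b * (w x)\<^sup>2"
    proof -
      have e: "\<delta> powr (2 - \<alpha>) = \<delta>\<^sup>2 * \<delta> powr (- \<alpha>)" using \<delta> by (simp add: powr_diff powr_minus divide_inverse)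
      show ?thesis unfolding e b_def c_def using \<alpha> \<delta> by (simp add: field_simps)
    qed
    finally show ?thesis using b by (simp add: ennreal_mult mult_ac)
  qed
  let ?K = "ennreal (r powr ?p) * ?W1 + ennreal (r powr (- \<alpha>) * T)"
  have i2: "(\<integral>\<^sup>+ y. G2 x y \<partial>lborel) \<le> (ennreal (w x) * indicator (ball x0 \<rho>) x) * (ennreal Q * ?K)" for x
  proof (cases "x \<in> ball x0 m")
    case True
    then have x: "norm (x - x0) \<le> r" "x \<in> ball x0 \<rho>" using m \<rho> \<delta> by (auto simp: dist_norm norm_minus_commute)
    have "(\<integral>\<^sup>+ y. G2 x y \<partial>lborel) = indicator (ball x0 m) x * ennreal (w x) *
        (\<integral>\<^sup>+ y. indicator (- ball 0 \<delta>) (y - x) * ennreal (w y * (c * norm (y - x) powr ?p)) \<partial>lborel)"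
      unfolding G2_def by (rule nn_integral_cmult) measurable
    also have "\<dots> \<le> indicator (ball x0 m) x * ennreal (w x) * (ennreal Q * ?K)"
      unfolding c_def Q_def
      by (intro mult_left_mono nonlocal_tail_le[OF assms(2) w0 \<alpha> \<delta> x(1) \<rho>(1) cK tail]) simp
    finally show ?thesis using True x(2) by simp
  qed (simp add: G2_def)
  have "(\<integral>\<^sup>+ p. ennreal (w (fst p) * w (snd p) * (\<eta> (fst p) - \<eta> (snd p))\<^sup>2 *
        (c * norm (snd p - fst p) powr ?p)) \<partial>(lborel \<Otimes>\<^sub>M lborel))
    \<le> (\<integral>\<^sup>+ p. (G1 (fst p) (snd p) + G2 (fst p) (snd p)) + (G1 (snd p) (fst p) + G2 (snd p) (fst p)) \<partial>(lborel \<Otimes>\<^sub>M lborel))"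
    unfolding G1_def G2_def by (intro nn_integral_mono cutoff_kernel_split[OF w0 \<eta> supp m \<delta>(1) c])
  also have "\<dots> = 2 * (\<integral>\<^sup>+ x. \<integral>\<^sup>+ y. (G1 x y + G2 x y) \<partial>lborel \<partial>lborel)"
    by (rule nn_integral_pair_symmetrize[of "\<lambda>x y. G1 x y + G2 x y"]) measurable
  also have "(\<integral>\<^sup>+ x. \<integral>\<^sup>+ y. (G1 x y + G2 x y) \<partial>lborel \<partial>lborel)
     \<le> (\<integral>\<^sup>+ x. ennreal b * (ennreal ((w x)\<^sup>2) * indicator (ball x0 \<rho>) x) +
          (ennreal (w x) * indicator (ball x0 \<rho>) x) * (ennreal Q * ?K) \<partial>lborel)"
    using i1 i2 by (intro nn_integral_mono) (simp add: nn_integral_add add_mono)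
  also have "\<dots> = ennreal b * ?W2 + ?W1 * (ennreal Q * ?K)"
    by (subst nn_integral_add) (auto simp: nn_integral_cmult nn_integral_multc)
  also have "?W1 * (ennreal Q * ?K) = ennreal (Q * r powr ?p) * (?W1 * ?W1) + ennreal (Q * (r powr (- \<alpha>) * T)) * ?W1"
    using Q T by (simp add: ennreal_mult distrib_left mult_ac)
  also have "?W1 * ?W1 \<le> ennreal (\<omega> * \<rho> ^ DIM('a)) * ?W2"
    unfolding \<omega>_def using \<rho> r by (intro nn_integral_square_ball_le w0) auto
  also have "ennreal (\<omega> * \<rho> ^ DIM('a)) \<le> ennreal (\<omega> * r powr ?d)"
    using \<omega> \<rho> r by (intro ennreal_leI mult_left_mono) (auto simp: powr_realpow power_mono)
  finally have "(\<integral>\<^sup>+ p. ennreal (w (fst p) * w (snd p) * (\<eta> (fst p) - \<eta> (snd p))\<^sup>2 *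
        (c * norm (snd p - fst p) powr ?p)) \<partial>(lborel \<Otimes>\<^sub>M lborel))
    \<le> 2 * (ennreal b * ?W2 + (ennreal (Q * r powr ?p) * (ennreal (\<omega> * r powr ?d) * ?W2) + ennreal (Q * (r powr (- \<alpha>) * T)) * ?W1))"
    by (simp add: mult_left_mono add_mono mult_right_mono)
  also have "\<dots> \<le> 2 * (ennreal b * ennreal Y2 + (ennreal (Q * r powr ?p) * (ennreal (\<omega> * r powr ?d) * ennreal Y2) + ennreal (Q * (r powr (- \<alpha>) * T)) * ennreal Y1))"
    by (intro mult_left_mono add_mono W1 W2) auto
  also have "\<dots> = ennreal (2 * (b * Y2 + (Q * r powr ?p * (\<omega> * r powr ?d * Y2) + Q * (r powr (- \<alpha>) * T) * Y1)))"
    using b Q T W1(2) W2(2) \<omega> by (simp add: ennreal_mult ennreal_plus)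
  also have "\<dots> \<le> ennreal (cK * (2 powr (?d + 4) * (2 * \<omega> + 1)) * ((r / \<delta>) powr (?d + 2) * r powr (- \<alpha>)) * (Y2 + T * Y1))"
  proof (rule ennreal_leI)
    \<comment> \<open>Common scale factor: the near part scales like \<delta>^(-\<alpha>) =
      (r/\<delta>)^\<alpha> r^(-\<alpha>), which is at most \<open>\<Lambda>\<close> since \<delta>
      \<le> r, and the far part is a multiple of \<open>\<Lambda>\<close>.\<close>
    define \<Lambda> where "\<Lambda> = (r / \<delta>) powr (?d + 2) * r powr (- \<alpha>)"
    have \<Lambda>: "0 \<le> \<Lambda>" by (simp add: \<Lambda>_def)
    have "\<delta> powr (- \<alpha>) = (r / \<delta>) powr \<alpha> * r powr (- \<alpha>)"
      using \<delta> r by (simp add: powr_divide powr_minus field_simps)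
    also have "\<dots> \<le> \<Lambda>" unfolding \<Lambda>_def
      using \<delta> \<alpha> r by (intro mult_right_mono powr_mono) auto
    finally have 1: "\<delta> powr (- \<alpha>) \<le> \<Lambda>" .
    have 2: "Q * r powr (- \<alpha>) = 2 * cK * 2 powr (?d + 2) * \<Lambda>"
      unfolding Q_def \<Lambda>_def using r \<delta> powr_mult[of 2 "r / \<delta>" "?d + 2"] by simp
    have 3: "r powr ?p * r powr ?d = r powr (- \<alpha>)" using r by (simp add: powr_add[symmetric])
    define P where "P = 2 powr ?d"
    have P: "0 < P" "2 powr (?d + 4) = 16 * P" "2 powr (?d + 2) = 4 * P" "2 ^ DIM('a) = P" 
      by (auto simp: P_def powr_add powr_realpow)
    have "2 * (b * Y2 + (Q * r powr ?p * (\<omega> * r powr ?d * Y2) + Q * (r powr (- \<alpha>) * T) * Y1))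
      = 2 * (b * Y2) + 2 * (Q * (r powr ?p * r powr ?d) * (\<omega> * Y2) + (Q * r powr (- \<alpha>)) * (T * Y1))"
      by (simp add: algebra_simps)
    also have "\<dots> = 8 * cK * \<omega> * P * Y2 * \<delta> powr (- \<alpha>) + 16 * cK * P * \<Lambda> * (\<omega> * Y2 + T * Y1)"
      unfolding 3 2 b_def P by (simp add: algebra_simps)
    also have "\<dots> \<le> 8 * cK * \<omega> * P * Y2 * \<Lambda> + 16 * cK * P * \<Lambda> * (\<omega> * Y2 + T * Y1)"
      using cK \<omega> P(1) W2(2) 1 by (intro add_right_mono mult_left_mono) auto
    also have "\<dots> \<le> 16 * cK * P * \<Lambda> * ((2 * \<omega> + 1) * (Y2 + T * Y1))"
    proof -
      have "8 * cK * \<omega> * P * Y2 * \<Lambda> + 16 * cK * P * \<Lambda> * (\<omega> * Y2 + T * Y1)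
        = 16 * cK * P * \<Lambda> * (\<omega> * Y2 / 2 + \<omega> * Y2 + T * Y1)" by (simp add: algebra_simps)
      also have "\<dots> \<le> 16 * cK * P * \<Lambda> * ((2 * \<omega> + 1) * (Y2 + T * Y1))"
      proof (rule mult_left_mono)
        have "0 \<le> \<omega> * Y2" "0 \<le> \<omega> * (T * Y1)" using \<omega> W1(2) W2(2) T by auto
        then show "\<omega> * Y2 / 2 + \<omega> * Y2 + T * Y1 \<le> (2 * \<omega> + 1) * (Y2 + T * Y1)"
          using W2(2) by (simp add: algebra_simps)
      qed (use cK P \<Lambda> in auto)
      finally show ?thesis .
    qed
    also have "\<dots> = cK * (2 powr (?d + 4) * (2 * \<omega> + 1)) * \<Lambda> * (Y2 + T * Y1)"
      unfolding P by (simp add: mult_ac)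
    finally show "2 * (b * Y2 + (Q * r powr ?p * (\<omega> * r powr ?d * Y2) + Q * (r powr (- \<alpha>) * T) * Y1))
       \<le> cK * (2 powr (?d + 4) * (2 * \<omega> + 1)) * ((r / \<delta>) powr (?d + 2) * r powr (- \<alpha>)) * (Y2 + T * Y1)"
      unfolding \<Lambda>_def .
  qed
  finally show ?thesis unfolding c_def \<omega>_def .
qed

section \<open>De Giorgi iteration\<close>

text \<open>The parameter \<open>T\<close> bounds the tail in its scale-invariant form, i.e. multiplied by \<open>r\<^sup>\<alpha>\<close>.\<close>

locale nonlocal_subsolution =
  fixes k :: "'a::euclidean_space \<Rightarrow> 'a \<Rightarrow> real" and \<alpha> cl cK r T :: real and x0 :: 'a and u :: "'a \<Rightarrow> real"
  assumes dim: "2 \<le> DIM('a)" and \<alpha>: "0 < \<alpha>" "\<alpha> < 2" and cl: "0 < cl" and cK: "0 < cK"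
    and r: "0 < r" and T: "0 \<le> T"
    and kernel: "kernel_ok k" and E_ge: "cond_E_ge k \<alpha> cl" and U2: "cond_U2 k \<alpha> cK"
    and u_measurable [measurable]: "u \<in> borel_measurable borel" and u_Hspace: "u \<in> Hspace k"
    and subsolution: "\<And>\<phi>. \<phi> \<in> Hspace0 k (ball x0 r) \<Longrightarrow> (AE x in lebesgue. \<phi> x \<ge> 0) \<Longrightarrow> Eform k UNIV u \<phi> \<le> 0"
    and tail: "(\<integral>\<^sup>+ y\<in>- ball x0 (r/2). ennreal (max (u y) 0 / norm (y - x0) powr (real DIM('a) + \<alpha>)) \<partial>lborel)
      \<le> ennreal (r powr (- \<alpha>) * T)"
begin

lemma kernel_measurable [measurable]: "(\<lambda>p. k (fst p) (snd p)) \<in> borel_measurable (lborel \<Otimes>\<^sub>M lborel)"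
  using kernel by (simp add: kernel_ok_def)

lemma u_L2: "(\<integral>\<^sup>+ x. ennreal ((u x)\<^sup>2) \<partial>lborel) < \<infinity>"
proof -
  have "integrable lebesgue (\<lambda>x. (u x)\<^sup>2)" using u_Hspace by (simp add: Hspace_def)
  then show ?thesis unfolding integrable_iff_bounded by (simp add: nn_integral_completion)
qed

text \<open>The hypothesis concerns balls only, so the whole space is exhausted by balls and the
  fractional energies converge monotonically.\<close>

lemma energy_ge_frac_UNIV:
  assumes [measurable]: "v \<in> borel_measurable borel" and v: "(\<integral>\<^sup>+ x. ennreal ((v x)\<^sup>2) \<partial>lborel) < \<infinity>"
  shows "ennreal cl * energy (frac_kernel \<alpha>) UNIV v \<le> energy k UNIV v"
proof -
  let ?M = "lborel \<Otimes>\<^sub>M (lborel :: 'a measure)"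
  let ?f = "\<lambda>p. ennreal ((v (snd p) - v (fst p))\<^sup>2 * frac_kernel \<alpha> (fst p) (snd p))"
  \<comment> \<open>\<open>Suc n\<close> keeps every radius positive, as \<open>cond_E_ge\<close>
    requires.\<close>
  let ?B = "\<lambda>n::nat. ball (0::'a) (real (Suc n))"
  have le: "ennreal cl * (\<integral>\<^sup>+ p. indicator (?B n \<times> ?B n) p * ?f p \<partial>?M) \<le> energy k UNIV v" for n
  proof -
    have vint: "integrable lebesgue (\<lambda>x. (v x)\<^sup>2)"
      unfolding integrable_iff_bounded using v by (auto simp: nn_integral_completion intro!: measurable_completion)
    have "set_integrable lebesgue (?B n) (\<lambda>x. (v x)\<^sup>2)"
      unfolding set_integrable_def by (rule integrable_mult_indicator[OF _ vint]) simp
    moreover have "v \<in> borel_measurable lebesgue" by (intro measurable_completion) simp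
    ultimately have "ennreal cl * energy (frac_kernel \<alpha>) (?B n) v \<le> energy k (?B n) v"
      using E_ge unfolding cond_E_ge_def by (metis of_nat_0_less_iff zero_less_Suc)
    also have "\<dots> \<le> energy k UNIV v"
      unfolding energy_def by (intro nn_integral_mono) (auto simp: indicator_def)
    also have "energy (frac_kernel \<alpha>) (?B n) v = (\<integral>\<^sup>+ p. indicator (?B n \<times> ?B n) p * ?f p \<partial>?M)"
      unfolding energy_def by (rule nn_integral_pair_lebesgue) measurable
    finally show ?thesis .
  qed
  have "energy (frac_kernel \<alpha>) UNIV v = (\<integral>\<^sup>+ p. ?f p \<partial>?M)"
    by (rule energy_UNIV_lborel) measurable
  also have "\<dots> = (\<integral>\<^sup>+ p. (SUP n. indicator (?B n \<times> ?B n) p * ?f p) \<partial>?M)"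
  proof (rule nn_integral_cong)
    fix p :: "'a \<times> 'a"
    obtain n :: nat where n: "max (norm (fst p)) (norm (snd p)) < real n" using reals_Archimedean2 by blast
    show "?f p = (SUP n. indicator (?B n \<times> ?B n) p * ?f p)"
    proof (rule antisym)
      have "?f p = indicator (?B n \<times> ?B n) p * ?f p"
        using n by (cases p) (auto simp: indicator_def)
      also have "\<dots> \<le> (SUP n. indicator (?B n \<times> ?B n) p * ?f p)" by (rule SUP_upper) simp
      finally show "?f p \<le> (SUP n. indicator (?B n \<times> ?B n) p * ?f p)" .
      show "(SUP n. indicator (?B n \<times> ?B n) p * ?f p) \<le> ?f p"
        by (rule SUP_least) (auto simp: indicator_def)
    qed
  qed
  also have "\<dots> = (SUP n. \<integral>\<^sup>+ p. indicator (?B n \<times> ?B n) p * ?f p \<partial>?M)"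
  proof (rule nn_integral_monotone_convergence_SUP)
    show "incseq (\<lambda>n p. indicator (?B n \<times> ?B n) p * ?f p)"
      by (auto simp: incseq_def le_fun_def indicator_def)
  qed measurable
  finally have "ennreal cl * energy (frac_kernel \<alpha>) UNIV v
     = (SUP n. ennreal cl * (\<integral>\<^sup>+ p. indicator (?B n \<times> ?B n) p * ?f p \<partial>?M))"
    by (simp add: SUP_mult_left_ennreal)
  also have "\<dots> \<le> energy k UNIV v" by (intro SUP_least le)
  finally show ?thesis .
qed

text \<open>Caccioppoli followed by (U2). Because l \<ge> 0, the truncation lies below the positive
  part of u, so one tail bound serves every level.\<close>

lemma energy_cutoff_truncation_le:
  assumes [measurable]: "\<eta> \<in> borel_measurable borel"
    and \<eta>: "\<And>x. 0 \<le> \<eta> x" "\<And>x. \<eta> x \<le> 1" "\<And>x y. \<bar>\<eta> x - \<eta> y\<bar> \<le> norm (x - y) / \<delta>"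
    and supp: "\<And>x. x \<notin> ball x0 m \<Longrightarrow> \<eta> x = 0" and m: "m + \<delta> \<le> \<rho>" and \<delta>: "0 < \<delta>" "\<delta> \<le> r"
    and \<rho>: "r / 2 \<le> \<rho>" "\<rho> \<le> r" and l: "0 \<le> l"
    and W2: "(\<integral>\<^sup>+ y\<in>ball x0 \<rho>. ennreal ((max (u y - l) 0)\<^sup>2) \<partial>lborel) \<le> ennreal Y2" "0 \<le> Y2"
    and W1: "(\<integral>\<^sup>+ y\<in>ball x0 \<rho>. ennreal (max (u y - l) 0) \<partial>lborel) \<le> ennreal Y1" "0 \<le> Y1"
  shows "energy k UNIV (\<lambda>x. \<eta> x * max (u x - l) 0)
    \<le> ennreal (cK * (2 powr (real DIM('a) + 4) * (2 * unit_ball_vol (real DIM('a)) + 1)) *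
        ((r / \<delta>) powr (real DIM('a) + 2) * r powr (- \<alpha>)) * (Y2 + T * Y1))"
proof -
  define w where "w x = max (u x - l) 0" for x
  have [measurable]: "w \<in> borel_measurable borel" unfolding w_def by measurable
  have w0: "0 \<le> w x" for x by (simp add: w_def)
  have supp': "\<eta> x = 0" if "x \<notin> ball x0 r" for x
    using that m \<rho> \<delta> by (intro supp) auto
  have "energy k UNIV (\<lambda>x. \<eta> x * w x) \<le>
    (\<integral>\<^sup>+ p. ennreal (w (fst p) * w (snd p) * (\<eta> (fst p) - \<eta> (snd p))\<^sup>2 * k (fst p) (snd p)) \<partial>(lborel \<Otimes>\<^sub>M lborel))"
    unfolding w_def
    by (rule caccioppoli[OF kernel u_measurable assms(1) u_Hspace subsolution \<eta>(1,2) _ supp' l, where B="1 / \<delta>"])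
       (use \<eta>(3) in auto)
  also have "\<dots> \<le> (\<integral>\<^sup>+ p. ennreal (w (fst p) * w (snd p) * (\<eta> (fst p) - \<eta> (snd p))\<^sup>2 *
      (cK * (2 - \<alpha>) * norm (snd p - fst p) powr (- real DIM('a) - \<alpha>))) \<partial>(lborel \<Otimes>\<^sub>M lborel))"
  proof (rule nn_integral_mono_AE)
    have "AE p in lborel \<Otimes>\<^sub>M (lborel :: 'a measure). k (fst p) (snd p) \<le> cK * (2 - \<alpha>) * norm (snd p - fst p) powr (- real DIM('a) - \<alpha>)"
      using U2 by (simp add: cond_U2_def)
    then show "AE p in lborel \<Otimes>\<^sub>M lborel. ennreal (w (fst p) * w (snd p) * (\<eta> (fst p) - \<eta> (snd p))\<^sup>2 * k (fst p) (snd p))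
      \<le> ennreal (w (fst p) * w (snd p) * (\<eta> (fst p) - \<eta> (snd p))\<^sup>2 *
      (cK * (2 - \<alpha>) * norm (snd p - fst p) powr (- real DIM('a) - \<alpha>)))"
      by eventually_elim (intro ennreal_leI mult_left_mono mult_nonneg_nonneg w0, auto)
  qed
  also have "\<dots> \<le> ennreal (cK * (2 powr (real DIM('a) + 4) * (2 * unit_ball_vol (real DIM('a)) + 1)) *
        ((r / \<delta>) powr (real DIM('a) + 2) * r powr (- \<alpha>)) * (Y2 + T * Y1))"
  proof (rule cutoff_kernel_integral_le[OF dim _ w0 \<eta> supp m \<delta> \<rho> \<alpha> _ T])
    have "(\<integral>\<^sup>+ y\<in>- ball x0 (r/2). ennreal (w y / norm (y - x0) powr (real DIM('a) + \<alpha>)) \<partial>lborel)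
      \<le> (\<integral>\<^sup>+ y\<in>- ball x0 (r/2). ennreal (max (u y) 0 / norm (y - x0) powr (real DIM('a) + \<alpha>)) \<partial>lborel)"
      using l by (intro nn_integral_mono mult_right_mono ennreal_leI divide_right_mono) (auto simp: w_def)
    then show "(\<integral>\<^sup>+ y\<in>- ball x0 (r/2). ennreal (w y / norm (y - x0) powr (real DIM('a) + \<alpha>)) \<partial>lborel) \<le> ennreal (r powr (- \<alpha>) * T)"
      using tail by (rule order_trans)
  qed (use cK W1 W2 in \<open>auto simp: w_def\<close>)
  finally show ?thesis unfolding w_def .
qed

section \<open>One step of the iteration\<close>

lemma emeasure_superlevel_le:
  assumes "l < l'" "0 \<le> Y"
    and Y: "(\<integral>\<^sup>+ x\<in>ball x0 \<rho>. ennreal ((max (u x - l) 0)\<^sup>2) \<partial>lborel) \<le> ennreal Y"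
  shows "emeasure lborel {x \<in> ball x0 \<rho>. l' < u x} \<le> ennreal (Y / (l' - l)\<^sup>2)"
proof -
  let ?S = "{x \<in> ball x0 \<rho>. l' < u x}"
  have "ennreal ((l' - l)\<^sup>2) * emeasure lborel ?S = (\<integral>\<^sup>+ x. ennreal ((l' - l)\<^sup>2) * indicator ?S x \<partial>lborel)"
    by (subst nn_integral_cmult_indicator) auto
  also have "\<dots> \<le> (\<integral>\<^sup>+ x\<in>ball x0 \<rho>. ennreal ((max (u x - l) 0)\<^sup>2) \<partial>lborel)"
    using assms(1) by (intro nn_integral_mono) (auto simp: indicator_def intro!: ennreal_leI power_mono)
  also have "\<dots> \<le> ennreal Y * 1" using Y by simp
  finally have "emeasure lborel ?S \<le> ennreal (Y / (l' - l)\<^sup>2) * 1"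
    by (rule ennreal_mult_le_mult_divide) (use assms in auto)
  then show ?thesis by simp
qed

text \<open>Where u exceeds l', both l' - l and u - l' are at most u - l. Thus the L1 norm at the
  higher level, which multiplies the tail, is paid for by the squared L2 norm at the lower
  one.\<close>

lemma nn_integral_truncation_le:
  assumes "l < l'" "0 \<le> Y"
    and Y: "(\<integral>\<^sup>+ x\<in>ball x0 \<rho>. ennreal ((max (u x - l) 0)\<^sup>2) \<partial>lborel) \<le> ennreal Y"
  shows "(\<integral>\<^sup>+ x\<in>ball x0 \<rho>. ennreal (max (u x - l') 0) \<partial>lborel) \<le> ennreal (Y / (l' - l))"
proof -
  have pt: "(l' - l) * max (u x - l') 0 \<le> (max (u x - l) 0)\<^sup>2" for x
  proof (cases "u x \<le> l'")
    case False
    then show ?thesis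
      unfolding power2_eq_square using assms(1) by (intro mult_mono') auto
  qed simp
  have "ennreal (l' - l) * (\<integral>\<^sup>+ x\<in>ball x0 \<rho>. ennreal (max (u x - l') 0) \<partial>lborel)
    = (\<integral>\<^sup>+ x. ennreal (l' - l) * (ennreal (max (u x - l') 0) * indicator (ball x0 \<rho>) x) \<partial>lborel)"
    by (rule nn_integral_cmult[symmetric]) measurable
  also have "\<dots> \<le> (\<integral>\<^sup>+ x\<in>ball x0 \<rho>. ennreal ((max (u x - l) 0)\<^sup>2) \<partial>lborel)"
    using assms(1) pt by (intro nn_integral_mono) (auto simp: indicator_def ennreal_mult[symmetric] intro!: ennreal_leI)
  also have "\<dots> \<le> ennreal Y * 1" using Y by simp
  finally have "(\<integral>\<^sup>+ x\<in>ball x0 \<rho>. ennreal (max (u x - l') 0) \<partial>lborel) \<le> ennreal (Y / (l' - l)) * 1"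
    by (rule ennreal_mult_le_mult_divide) (use assms in auto)
  then show ?thesis by simp
qed

text \<open>The energy bound is linear in Y, while the Faber--Krahn factor contributes the measure
  of the superlevel set, itself at most Y/(l'-l)^2 by Chebyshev. The total power 1 + \<alpha>/d
  exceeds one, and this superlinearity drives the iteration.\<close>

lemma de_giorgi_step:
  assumes CF: "0 < CF" "\<And>(v :: 'a \<Rightarrow> real) S m. v \<in> borel_measurable borel \<Longrightarrow> S \<in> sets borel \<Longrightarrow> 0 \<le> m \<Longrightarrow>
      emeasure lborel S \<le> ennreal m \<Longrightarrow> (\<And>x. x \<notin> S \<Longrightarrow> v x = 0) \<Longrightarrow>
      (\<integral>\<^sup>+ x. ennreal ((v x)\<^sup>2) \<partial>lborel) \<le> ennreal (CF * m powr (\<alpha> / DIM('a))) * energy (frac_kernel \<alpha>) UNIV v"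
    and \<rho>: "r / 2 \<le> \<rho>" "\<rho> < \<rho>'" "\<rho>' \<le> r" and l: "0 \<le> l" "l < l'" and Y0: "0 \<le> Y"
    and Y: "(\<integral>\<^sup>+ x\<in>ball x0 \<rho>'. ennreal ((max (u x - l) 0)\<^sup>2) \<partial>lborel) \<le> ennreal Y"
  shows "(\<integral>\<^sup>+ x\<in>ball x0 \<rho>. ennreal ((max (u x - l') 0)\<^sup>2) \<partial>lborel)
    \<le> ennreal (CF / cl * (Y / (l' - l)\<^sup>2) powr (\<alpha> / DIM('a)) *
       (cK * (2 powr (real DIM('a) + 4) * (2 * unit_ball_vol (real DIM('a)) + 1)) *
        ((2 * r / (\<rho>' - \<rho>)) powr (real DIM('a) + 2) * r powr (- \<alpha>)) * (Y + T * (Y / (l' - l)))))"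
proof -
  \<comment> \<open>Half of the gap is used by the cutoff to fall from 1 to 0; the other half keeps
    all points within distance \<open>\<delta>\<close> of its support inside the larger
    ball.\<close>
  define \<delta> where "\<delta> = (\<rho>' - \<rho>) / 2"
  have \<delta>: "0 < \<delta>" "\<delta> \<le> r" using \<rho> r by (auto simp: \<delta>_def)
  define \<eta> where "\<eta> x = max 0 (min 1 ((\<rho> + \<delta> - norm (x - x0)) / \<delta>))" for x
  define w where "w x = max (u x - l') 0" for x
  have [measurable]: "w \<in> borel_measurable borel" unfolding w_def by measurable
  have \<eta>m [measurable]: "\<eta> \<in> borel_measurable borel" unfolding \<eta>_def by measurable
  have \<eta>01: "0 \<le> \<eta> x" "\<eta> x \<le> 1" for x by (auto simp: \<eta>_def)
  have \<eta>L: "\<bar>\<eta> x - \<eta> y\<bar> \<le> norm (x - y) / \<delta>" for x y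
  proof -
    have "\<bar>\<eta> x - \<eta> y\<bar> \<le> \<bar>(\<rho> + \<delta> - norm (x - x0)) / \<delta> - (\<rho> + \<delta> - norm (y - x0)) / \<delta>\<bar>"
      unfolding \<eta>_def by linarith
    also have "\<dots> = \<bar>norm (y - x0) - norm (x - x0)\<bar> / \<delta>"
      using \<delta> by (simp add: diff_divide_distrib[symmetric])
    also have "\<dots> \<le> norm (x - y) / \<delta>"
      using norm_triangle_ineq3[of "y - x0" "x - x0"] \<delta> by (intro divide_right_mono) (auto simp: norm_minus_commute)
    finally show ?thesis .
  qed
  have \<eta>supp: "\<eta> x = 0" if "x \<notin> ball x0 (\<rho> + \<delta>)" for x
  proof -
    have "\<rho> + \<delta> - norm (x - x0) \<le> 0" using that by (simp add: dist_norm norm_minus_commute)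
    then have "(\<rho> + \<delta> - norm (x - x0)) / \<delta> \<le> 0" using \<delta> by (simp add: divide_nonpos_pos)
    then show ?thesis by (simp add: \<eta>_def)
  qed
  have \<eta>1: "\<eta> x = 1" if "x \<in> ball x0 \<rho>" for x
    using that \<delta> by (simp add: \<eta>_def dist_norm norm_minus_commute le_divide_eq)
  let ?S = "{x \<in> ball x0 \<rho>'. l' < u x}"
  let ?v = "\<lambda>x. \<eta> x * w x"
  define m where "m = Y / (l' - l)\<^sup>2"
  define K where "K = cK * (2 powr (real DIM('a) + 4) * (2 * unit_ball_vol (real DIM('a)) + 1)) *
        ((r / \<delta>) powr (real DIM('a) + 2) * r powr (- \<alpha>)) * (Y + T * (Y / (l' - l)))"
  have "(\<integral>\<^sup>+ x\<in>ball x0 \<rho>'. ennreal ((max (u x - l') 0)\<^sup>2) \<partial>lborel) \<le> (\<integral>\<^sup>+ x\<in>ball x0 \<rho>'. ennreal ((max (u x - l) 0)\<^sup>2) \<partial>lborel)"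
    using l by (intro nn_integral_mono mult_right_mono ennreal_leI power_mono) auto
  then have "(\<integral>\<^sup>+ x\<in>ball x0 \<rho>'. ennreal ((max (u x - l') 0)\<^sup>2) \<partial>lborel) \<le> ennreal Y" using Y by (rule order_trans)
  then have E: "energy k UNIV ?v \<le> ennreal K"
    unfolding w_def K_def using \<rho> l Y0 r
    by (intro energy_cutoff_truncation_le[OF \<eta>m \<eta>01 \<eta>L \<eta>supp _ \<delta>, where \<rho>=\<rho>'] nn_integral_truncation_le Y) (auto simp: \<delta>_def)
  have vL2: "(\<integral>\<^sup>+ x. ennreal ((?v x)\<^sup>2) \<partial>lborel) < \<infinity>"
  proof -
    have "(?v x)\<^sup>2 \<le> (u x)\<^sup>2" for x
    proof (rule abs_le_square_iff[THEN iffD1])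
      have w0: "0 \<le> w x" by (simp add: w_def)
      then have "\<bar>?v x\<bar> \<le> 1 * w x"
        unfolding abs_mult using \<eta>01[of x] by (intro mult_mono) auto
      also have "\<dots> \<le> \<bar>u x\<bar>" using l by (auto simp: w_def)
      finally show "\<bar>?v x\<bar> \<le> \<bar>u x\<bar>" .
    qed
    then have "(\<integral>\<^sup>+ x. ennreal ((?v x)\<^sup>2) \<partial>lborel) \<le> (\<integral>\<^sup>+ x. ennreal ((u x)\<^sup>2) \<partial>lborel)"
      by (intro nn_integral_mono ennreal_leI)
    then show ?thesis using u_L2 by (rule le_less_trans)
  qed
  have "ennreal cl * energy (frac_kernel \<alpha>) UNIV ?v \<le> energy k UNIV ?v"
    by (rule energy_ge_frac_UNIV[OF _ vL2]) measurable
  also have "\<dots> \<le> ennreal K * 1" using E by simp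
  finally have F: "energy (frac_kernel \<alpha>) UNIV ?v \<le> ennreal (K / cl) * 1"
    by (rule ennreal_mult_le_mult_divide) (use cl cK Y0 T l in \<open>auto simp: K_def\<close>)
  have "(\<integral>\<^sup>+ x\<in>ball x0 \<rho>. ennreal ((max (u x - l') 0)\<^sup>2) \<partial>lborel) \<le> (\<integral>\<^sup>+ x. ennreal ((?v x)\<^sup>2) \<partial>lborel)"
    using \<eta>1 by (intro nn_integral_mono) (auto simp: indicator_def w_def)
  also have "\<dots> \<le> ennreal (CF * m powr (\<alpha> / DIM('a))) * energy (frac_kernel \<alpha>) UNIV ?v"
  proof (rule CF(2))
    show "emeasure lborel ?S \<le> ennreal m"
      unfolding m_def by (rule emeasure_superlevel_le[OF l(2) Y0 Y])
    show "?v x = 0" if "x \<notin> ?S" for x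
    proof (cases "x \<in> ball x0 \<rho>'")
      case False
      then have "x \<notin> ball x0 (\<rho> + \<delta>)" using \<rho> by (auto simp: \<delta>_def field_simps)
      then show ?thesis using \<eta>supp by simp
    qed (use that in \<open>auto simp: w_def\<close>)
  qed (use Y0 in \<open>auto simp: m_def\<close>)
  also have "\<dots> \<le> ennreal (CF * m powr (\<alpha> / DIM('a))) * (ennreal (K / cl) * 1)"
    by (intro mult_left_mono F) auto
  also have "\<dots> = ennreal (CF / cl * m powr (\<alpha> / DIM('a)) * K)"
    using CF(1) cl cK Y0 T l by (simp add: ennreal_mult[symmetric] K_def)
  finally show ?thesis unfolding m_def K_def \<delta>_def by (simp add: mult.commute)
qed

end

text \<open>Try y_j \<le> \<kappa> q^j. With q^\<beta> = 1/b the nonlinear factor compensates the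
  growth b^j, and with \<kappa>^\<beta> = q/K it also yields the factor q for the next step; these
  equations determine q and the threshold for y_0. Stating the threshold with \<beta> instead of a
  makes it the same for all exponents a \<ge> \<beta>.\<close>

lemma fast_geometric_decay:
  fixes y :: "nat \<Rightarrow> real" and K b \<beta> a :: real
  assumes y0: "\<And>j. 0 \<le> y j" and K: "1 \<le> K" and b: "1 < b" and \<beta>: "0 < \<beta>" "\<beta> \<le> a"
    and step: "\<And>j. y (Suc j) \<le> K * b ^ j * (y j * y j powr a)"
    and init: "y 0 \<le> K powr (- 1 / \<beta>) * b powr (- 1 / \<beta>\<^sup>2)"
  shows "y \<longlonglongrightarrow> 0"
proof -
  define \<kappa> where "\<kappa> = K powr (- 1 / \<beta>) * b powr (- 1 / \<beta>\<^sup>2)"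
  define q where "q = b powr (- 1 / \<beta>)"
  have q: "0 < q" "q < 1" using b \<beta> powr_less_mono[of "- 1 / \<beta>" 0 b] by (auto simp: q_def)
  have \<kappa>0: "0 < \<kappa>" using K b by (simp add: \<kappa>_def)
  have \<kappa>1: "\<kappa> \<le> 1"
    unfolding \<kappa>_def using K b \<beta> powr_mono[of "- 1 / \<beta>" 0 K] powr_mono[of "- 1 / \<beta>\<^sup>2" 0 b]
    by (intro mult_le_one) auto
  have \<kappa>\<beta>: "\<kappa> powr \<beta> = q / K"
  proof -
    have "\<kappa> powr \<beta> = K powr (- 1) * b powr (- 1 / \<beta>\<^sup>2 * \<beta>)"
      unfolding \<kappa>_def using K b \<beta> by (simp add: powr_mult powr_powr)
    also have "- 1 / \<beta>\<^sup>2 * \<beta> = - 1 / \<beta>" using \<beta> by (simp add: power2_eq_square)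
    finally show ?thesis using K by (simp add: q_def powr_minus_divide)
  qed
  have "q powr \<beta> = b powr (- 1)" using \<beta> by (simp add: q_def powr_powr)
  then have q\<beta>: "q powr \<beta> = 1 / b" using b by (simp add: powr_minus_divide)
  have bound: "y j \<le> \<kappa> * q ^ j" for j
  proof (induction j)
    case 0 then show ?case using init by (simp add: \<kappa>_def)
  next
    case (Suc j)
    have "q ^ j \<le> 1" using q by (intro power_le_one) auto
    then have le1: "\<kappa> * q ^ j \<le> 1" using \<kappa>1 \<kappa>0 q by (intro mult_le_one) auto
    have "y (Suc j) \<le> K * b ^ j * (y j * y j powr a)" by (rule step)
    also have "\<dots> \<le> K * b ^ j * (\<kappa> * q ^ j * (\<kappa> * q ^ j) powr \<beta>)"
    proof (intro mult_left_mono mult_mono Suc)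
      \<comment> \<open>Since y_j \<le> \<kappa> q^j \<le> 1, lowering the exponent from a to
        \<open>\<beta>\<close> increases the power.\<close>
      have "y j powr a \<le> y j powr \<beta>"
        using y0[of j] Suc le1 \<beta> by (cases "y j = 0") (auto intro!: powr_mono')
      also have "\<dots> \<le> (\<kappa> * q ^ j) powr \<beta>" using Suc y0 \<beta> by (intro powr_mono2) auto
      finally show "y j powr a \<le> (\<kappa> * q ^ j) powr \<beta>" .
    qed (use K b \<kappa>0 q in auto)
    also have "(\<kappa> * q ^ j) powr \<beta> = q / K * (1 / b) ^ j"
    proof -
      have "(q ^ j) powr \<beta> = (q powr \<beta>) ^ j"
        using q by (simp add: powr_realpow[symmetric] powr_powr mult.commute)
      then show ?thesis using \<kappa>0 q by (simp add: powr_mult \<kappa>\<beta> q\<beta>)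
    qed
    also have "K * b ^ j * (\<kappa> * q ^ j * (q / K * (1 / b) ^ j)) = \<kappa> * q ^ Suc j"
      using K b by (simp add: power_one_over field_simps)
    finally show ?case .
  qed
  have "(\<lambda>j. \<kappa> * q ^ j) \<longlonglongrightarrow> 0"
    using q by (intro tendsto_mult_right_zero LIMSEQ_power_zero) auto
  then show ?thesis
    by (rule tendsto_sandwich[OF _ _ tendsto_const, rotated 2]) (auto simp: y0 bound)
qed

section \<open>Iterating levels and radii to a supremum bound\<close>

context nonlocal_subsolution
begin

text \<open>Condition \<open>init\<close> is the smallness condition of
  \<open>fast_geometric_decay\<close> for \<beta> = \<alpha>0/d, written out. The power of (\<tau> -
  \<sigma>)/r stays explicit because the absorption for q < 2 uses annuli of vanishing
  width.\<close>

lemma de_giorgi_bound: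
  fixes \<alpha>0 CF :: real
  assumes CF: "0 < CF" "\<And>(v :: 'a \<Rightarrow> real) S m. v \<in> borel_measurable borel \<Longrightarrow> S \<in> sets borel \<Longrightarrow> 0 \<le> m \<Longrightarrow>
      emeasure lborel S \<le> ennreal m \<Longrightarrow> (\<And>x. x \<notin> S \<Longrightarrow> v x = 0) \<Longrightarrow>
      (\<integral>\<^sup>+ x. ennreal ((v x)\<^sup>2) \<partial>lborel) \<le> ennreal (CF * m powr (\<alpha> / DIM('a))) * energy (frac_kernel \<alpha>) UNIV v"
    and \<alpha>0: "0 < \<alpha>0" "\<alpha>0 \<le> \<alpha>"
    and \<sigma>: "r / 2 \<le> \<sigma>" "\<sigma> < \<tau>" "\<tau> \<le> r" and L: "0 < L" "T / 2 \<le> L"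
  defines "d \<equiv> real DIM('a)"
  defines "C0 \<equiv> max 1 (CF / cl * cK * (2 powr (d + 4) * (2 * unit_ball_vol d + 1)) * 2 powr (2 * d + 9))"
  assumes init: "(\<integral>\<^sup>+ x\<in>ball x0 \<tau>. ennreal ((max (u x) 0)\<^sup>2) \<partial>lborel)
      \<le> ennreal (C0 powr (- d / \<alpha>0) * (2 powr (d + 5)) powr (- d\<^sup>2 / \<alpha>0\<^sup>2) * ((\<tau> - \<sigma>) / r) powr (d * (d + 2) / \<alpha>0) * (L\<^sup>2 * r powr d))"
  shows "AE x in lborel. x \<in> ball x0 \<sigma> \<longrightarrow> u x \<le> L"
proof -
  have d: "1 \<le> d" using dim by (simp add: d_def)
  define \<theta> where "\<theta> = (\<tau> - \<sigma>) / r"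
  have \<theta>: "0 < \<theta>" "\<theta> \<le> 1" using \<sigma> r by (auto simp: \<theta>_def field_simps)
  define \<beta> where "\<beta> = \<alpha>0 / d"
  have \<beta>: "0 < \<beta>" "\<beta> \<le> \<alpha> / d" using \<alpha>0 d by (auto simp: \<beta>_def divide_right_mono)
  \<comment> \<open>Growth per step: the cutoffs contribute 2^(d+2), the Chebyshev factor at most 4,
    and the tail divided by the level gap 2. The same three sources at j = 0 give the exponent 2d +
    9 in \<open>C0\<close>.\<close>
  define b where "b = (2::real) powr (d + 5)"
  define c1 where "c1 = CF / cl * cK * (2 powr (d + 4) * (2 * unit_ball_vol d + 1))"
  have "0 < 2 * unit_ball_vol d + 1" using unit_ball_vol_pos[of d] d by linarith
  then have c1: "0 < c1" using CF(1) cl cK by (simp add: c1_def)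
  define K where "K = C0 * \<theta> powr (- (d + 2))"
  have C0: "1 \<le> C0" "c1 * 2 powr (2 * d + 9) \<le> C0" by (auto simp: C0_def c1_def)
  have \<theta>p: "1 \<le> \<theta> powr (- (d + 2))" using powr_mono'[of "- (d + 2)" 0 \<theta>] \<theta> d by simp
  have K: "1 \<le> K" using mult_mono[OF C0(1) \<theta>p] C0 by (simp add: K_def)
  define \<rho> where "\<rho> j = \<sigma> + (\<tau> - \<sigma>) / 2 ^ j" for j :: nat
  define l where "l j = L * (1 - 1 / 2 ^ j)" for j :: nat
  define I where "I j = (\<integral>\<^sup>+ x\<in>ball x0 (\<rho> j). ennreal ((max (u x - l j) 0)\<^sup>2) \<partial>lborel)" for j
  have l0: "0 \<le> l j" for j using L by (simp add: l_def)
  have Ifin: "I j < \<infinity>" for j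
  proof -
    have "(max (u x - l j) 0)\<^sup>2 \<le> (u x)\<^sup>2" for x
      using l0[of j] by (intro abs_le_square_iff[THEN iffD1]) auto
    then have "I j \<le> (\<integral>\<^sup>+ x. ennreal ((u x)\<^sup>2) \<partial>lborel)"
      unfolding I_def by (intro nn_integral_mono) (auto simp: indicator_def intro!: ennreal_leI)
    then show ?thesis using u_L2 by (rule le_less_trans)
  qed
  \<comment> \<open>Dividing by this quantity makes the recursion free of r and L.\<close>
  define N where "N = L\<^sup>2 * r powr d"
  have N: "0 < N" using L r by (simp add: N_def)
  define y where "y j = enn2real (I j) / N" for j
  have y0: "0 \<le> y j" for j using N by (simp add: y_def)
  have Iy: "I j = ennreal (N * y j)" for j using Ifin[of j] N by (simp add: y_def)
  have step: "y (Suc j) \<le> K * b ^ j * (y j * y j powr (\<alpha> / d))" for j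
  proof -
    have h: "l (Suc j) - l j = L / 2 ^ Suc j" by (simp add: l_def field_simps)
    have h': "\<rho> j - \<rho> (Suc j) = \<theta> * r / 2 ^ Suc j" using r by (simp add: \<rho>_def \<theta>_def field_simps)
    define Y where "Y = N * y j"
    have Y: "0 \<le> Y" using N y0 by (simp add: Y_def)
    have "ennreal (N * y (Suc j)) = I (Suc j)" by (rule Iy[symmetric])
    also have "\<dots> \<le> ennreal (CF / cl * (Y / (l (Suc j) - l j)\<^sup>2) powr (\<alpha> / DIM('a)) *
       (cK * (2 powr (real DIM('a) + 4) * (2 * unit_ball_vol (real DIM('a)) + 1)) *
        ((2 * r / (\<rho> j - \<rho> (Suc j))) powr (real DIM('a) + 2) * r powr (- \<alpha>)) * (Y + T * (Y / (l (Suc j) - l j)))))"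
      unfolding I_def
    proof (rule de_giorgi_step[OF CF])
      show "r / 2 \<le> \<rho> (Suc j)" using \<sigma> by (simp add: \<rho>_def add_increasing2)
      have "0 < \<rho> j - \<rho> (Suc j)" unfolding h' using \<theta> r by simp
      then show "\<rho> (Suc j) < \<rho> j" by simp
      have "(\<tau> - \<sigma>) / 2 ^ j \<le> (\<tau> - \<sigma>) / 1" using \<sigma> by (intro divide_left_mono) auto
      then show "\<rho> j \<le> r" using \<sigma> by (simp add: \<rho>_def)
      have "0 < l (Suc j) - l j" unfolding h using L by simp
      then show "l j < l (Suc j)" by simp
      show "(\<integral>\<^sup>+ x\<in>ball x0 (\<rho> j). ennreal ((max (u x - l j) 0)\<^sup>2) \<partial>lborel) \<le> ennreal Y"
        using Iy[of j] by (simp add: I_def Y_def)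
    qed (use l0 Y in auto)
    finally have "N * y (Suc j) \<le> CF / cl * (Y / (l (Suc j) - l j)\<^sup>2) powr (\<alpha> / d) *
       (cK * (2 powr (d + 4) * (2 * unit_ball_vol d + 1)) *
        ((2 * r / (\<rho> j - \<rho> (Suc j))) powr (d + 2) * r powr (- \<alpha>)) * (Y + T * (Y / (l (Suc j) - l j))))"
      unfolding d_def
      by (subst (asm) ennreal_le_iff) (use CF cl cK T Y L N y0 h in auto)
    also have "\<dots> = c1 * (Y / (l (Suc j) - l j)\<^sup>2) powr (\<alpha> / d) *
        ((2 * r / (\<rho> j - \<rho> (Suc j))) powr (d + 2) * r powr (- \<alpha>)) * (Y + T * (Y / (l (Suc j) - l j)))"
      by (simp add: c1_def mult_ac)
    also have "(Y / (l (Suc j) - l j)\<^sup>2) powr (\<alpha> / d) = (4 ^ Suc j) powr (\<alpha> / d) * (r powr \<alpha> * y j powr (\<alpha> / d))"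
    proof -
      have "Y / (l (Suc j) - l j)\<^sup>2 = 4 ^ Suc j * (r powr d * y j)"
        unfolding h Y_def N_def using L by (simp add: power_divide power_mult_distrib[symmetric] power2_eq_square field_simps)
      then show ?thesis using y0 r d by (simp add: powr_mult powr_powr)
    qed
    also have "2 * r / (\<rho> j - \<rho> (Suc j)) = 2 ^ (j + 2) / \<theta>"
      unfolding h' using r \<theta> by (simp add: field_simps)
    also have "(2 ^ (j + 2) / \<theta>) powr (d + 2) = 2 powr (real (j + 2) * (d + 2)) * \<theta> powr (- (d + 2))"
    proof -
      have "(2::real) ^ (j + 2) = 2 powr real (j + 2)" by (rule powr_realpow[symmetric]) simp
      then show ?thesis by (simp only: powr_divide powr_powr powr_minus_divide times_divide_eq_right mult_1_right)
    qed
    also have "c1 * ((4 ^ Suc j) powr (\<alpha> / d) * (r powr \<alpha> * y j powr (\<alpha> / d))) *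
        (2 powr (real (j + 2) * (d + 2)) * \<theta> powr (- (d + 2)) * r powr (- \<alpha>)) * (Y + T * (Y / (l (Suc j) - l j)))
      = c1 * \<theta> powr (- (d + 2)) * y j powr (\<alpha> / d) * (2 powr (real (j + 2) * (d + 2)) * (r powr \<alpha> * r powr (- \<alpha>)) *
         ((4 ^ Suc j) powr (\<alpha> / d) * (Y + T * (Y / (l (Suc j) - l j)))))"
      by (simp only: mult_ac)
    also have "r powr \<alpha> * r powr (- \<alpha>) = 1" using r by (simp add: powr_minus)
    also have "c1 * \<theta> powr (- (d + 2)) * y j powr (\<alpha> / d) * (2 powr (real (j + 2) * (d + 2)) * 1 *
         ((4 ^ Suc j) powr (\<alpha> / d) * (Y + T * (Y / (l (Suc j) - l j)))))
      \<le> c1 * \<theta> powr (- (d + 2)) * y j powr (\<alpha> / d) * (2 powr (real (j + 2) * (d + 2)) * 1 *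
         (2 powr (2 * real (j + 1)) * (2 powr real (j + 3) * Y)))"
    proof (intro mult_left_mono mult_mono)
      have "\<alpha> / d \<le> 1" using \<alpha> dim by (simp add: d_def divide_le_eq)
      then have "(4 ^ Suc j) powr (\<alpha> / d) \<le> (4 ^ Suc j :: real) powr 1"
        by (intro powr_mono) (auto simp del: power_Suc)
      also have "\<dots> = 2 powr (2 * real (j + 1))"
        using powr_powr[of 2 2 "real (j + 1)"] powr_realpow[of 4 "j + 1"] by simp
      finally show "(4 ^ Suc j) powr (\<alpha> / d) \<le> 2 powr (2 * real (j + 1))" .
      \<comment> \<open>Here T \<le> 2L absorbs the tail: the level gap is L / 2^(j+1), so the tail
        costs only another power of two.\<close>
      have "T * (Y / (l (Suc j) - l j)) \<le> (2 * L) * (Y / (l (Suc j) - l j))"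
        unfolding h using L Y by (intro mult_right_mono) auto
      also have "\<dots> = 2 ^ (j + 2) * Y" unfolding h using L by simp
      finally have "Y + T * (Y / (l (Suc j) - l j)) \<le> (1 + 2 ^ (j + 2)) * Y" by (simp add: distrib_right)
      also have "\<dots> \<le> 2 ^ (j + 3) * Y"
      proof (rule mult_right_mono[OF _ Y])
        have "1 \<le> (2::real) ^ (j + 2)" by (rule one_le_power) simp
        then show "1 + 2 ^ (j + 2) \<le> (2::real) ^ (j + 3)" by (simp add: power_add)
      qed
      finally show "Y + T * (Y / (l (Suc j) - l j)) \<le> 2 powr real (j + 3) * Y"
        by (subst powr_realpow) auto
    qed (use c1 T Y L h in auto)
    also have "\<dots> = N * (c1 * 2 powr (2 * d + 9) * \<theta> powr (- (d + 2)) * b ^ j * (y j * y j powr (\<alpha> / d)))"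
    proof -
      have "2 powr (real (j + 2) * (d + 2)) * (2 powr (2 * real (j + 1)) * 2 powr real (j + 3)) = 2 powr (2 * d + 9) * b ^ j"
      proof -
        have "b ^ j = 2 powr ((d + 5) * real j)"
          by (simp add: b_def powr_powr powr_realpow[symmetric])
        then show ?thesis unfolding powr_add[symmetric] \<open>b ^ j = _\<close> by (simp add: algebra_simps)
      qed
      then have "c1 * \<theta> powr (- (d + 2)) * y j powr (\<alpha> / d) * Y * (2 powr (real (j + 2) * (d + 2)) * (2 powr (2 * real (j + 1)) * 2 powr real (j + 3)))
        = c1 * \<theta> powr (- (d + 2)) * y j powr (\<alpha> / d) * Y * (2 powr (2 * d + 9) * b ^ j)" by simp
      then show ?thesis unfolding Y_def by (simp add: mult_ac)
    qed
    also have "\<dots> \<le> N * (K * b ^ j * (y j * y j powr (\<alpha> / d)))"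
      unfolding K_def using C0 N y0 by (intro mult_left_mono mult_right_mono) (auto simp: b_def)
    finally show ?thesis using N by simp
  qed
  have "y 0 \<le> K powr (- 1 / \<beta>) * b powr (- 1 / \<beta>\<^sup>2)"
  proof -
    have e: "K powr (- 1 / \<beta>) = C0 powr (- d / \<alpha>0) * \<theta> powr (d * (d + 2) / \<alpha>0)"
    proof -
      have f1: "K powr (- 1 / \<beta>) = C0 powr (- 1 / \<beta>) * \<theta> powr (- (d + 2) * (- 1 / \<beta>))"
        unfolding K_def using C0 \<theta> by (simp add: powr_mult powr_powr)
      have f2: "- 1 / \<beta> = - d / \<alpha>0" and f3: "- (d + 2) * (- 1 / \<beta>) = d * (d + 2) / \<alpha>0"
        using \<alpha>0 d by (auto simp: \<beta>_def field_simps)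
      show ?thesis unfolding f1 f3 by (simp only: f2)
    qed
    have e2: "- 1 / \<beta>\<^sup>2 = - d\<^sup>2 / \<alpha>0\<^sup>2" by (simp add: \<beta>_def power_divide)
    have "ennreal (N * y 0) = I 0" by (rule Iy[symmetric])
    also have "I 0 \<le> ennreal (C0 powr (- d / \<alpha>0) * b powr (- d\<^sup>2 / \<alpha>0\<^sup>2) * \<theta> powr (d * (d + 2) / \<alpha>0) * N)"
      using init by (simp add: I_def \<rho>_def l_def b_def \<theta>_def N_def)
    also have "\<dots> = ennreal (N * (K powr (- 1 / \<beta>) * b powr (- 1 / \<beta>\<^sup>2)))"
      unfolding e e2 by (simp add: mult_ac)
    finally show ?thesis using N by (subst (asm) ennreal_le_iff) (auto simp: )
  qed
  then have "y \<longlonglongrightarrow> 0"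
    by (intro fast_geometric_decay[where \<beta>=\<beta> and a="\<alpha> / d", OF y0 K _ \<beta> step]) (use d in \<open>auto simp: b_def\<close>)
  then have lim: "(\<lambda>j. ennreal (N * y j)) \<longlonglongrightarrow> ennreal (N * 0)"
    by (intro tendsto_ennrealI tendsto_mult tendsto_const)
  have "(\<integral>\<^sup>+ x\<in>ball x0 \<sigma>. ennreal ((max (u x - L) 0)\<^sup>2) \<partial>lborel) \<le> ennreal (N * y j)" for j
  proof -
    have "\<sigma> \<le> \<rho> j" "l j \<le> L" using \<sigma> L by (auto simp: \<rho>_def l_def field_simps)
    then show ?thesis unfolding Iy[symmetric] I_def
      by (intro nn_integral_mono) (auto simp: indicator_def intro!: ennreal_leI power_mono)
  qed
  then have "(\<integral>\<^sup>+ x\<in>ball x0 \<sigma>. ennreal ((max (u x - L) 0)\<^sup>2) \<partial>lborel) \<le> ennreal (N * 0)"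
    by (intro LIMSEQ_le_const[OF lim]) auto
  then have "(\<integral>\<^sup>+ x\<in>ball x0 \<sigma>. ennreal ((max (u x - L) 0)\<^sup>2) \<partial>lborel) = 0" by simp
  then have "AE x in lborel. ennreal ((max (u x - L) 0)\<^sup>2) * indicator (ball x0 \<sigma>) x = 0"
    by (subst (asm) nn_integral_0_iff_AE) auto
  then show ?thesis
  proof eventually_elim
    case (elim x)
    show ?case
    proof
      assume "x \<in> ball x0 \<sigma>"
      then have "(max (u x - L) 0)\<^sup>2 \<le> 0" using elim by (simp add: ennreal_eq_0_iff)
      then show "u x \<le> L" by (simp add: max_def split: if_splits)
    qed
  qed
qed

end

section \<open>Changing the exponent\<close>

text \<open>Splitting at height A replaces Hoelder: below A the square is at most A^2, and above A
  it is at most A^(2-q) s^q because 2 - q \<le> 0. A single application of \<open>DG\<close> between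
  r/2 and r then suffices.\<close>

lemma AE_ball_bound_from_powr_ge_2:
  fixes u :: "'a::euclidean_space \<Rightarrow> real" and c \<gamma> r T q A :: real
  assumes DG: "\<And>\<sigma> \<tau> L. r / 2 \<le> \<sigma> \<Longrightarrow> \<sigma> < \<tau> \<Longrightarrow> \<tau> \<le> r \<Longrightarrow> 0 < L \<Longrightarrow> T / 2 \<le> L \<Longrightarrow>
      (\<integral>\<^sup>+ x\<in>ball x0 \<tau>. ennreal ((max (u x) 0)\<^sup>2) \<partial>lborel)
        \<le> ennreal (c * ((\<tau> - \<sigma>) / r) powr \<gamma> * (L\<^sup>2 * r powr DIM('a))) \<Longrightarrow>
      AE x in lborel. x \<in> ball x0 \<sigma> \<longrightarrow> u x \<le> L"
    and [measurable]: "u \<in> borel_measurable borel"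
    and c: "0 < c" and r: "0 < r" and T: "0 \<le> T" and q: "2 \<le> q" and A: "0 < A"
    and Q: "(\<integral>\<^sup>+ x\<in>ball x0 r. ennreal ((max (u x) 0) powr q) \<partial>lborel) \<le> ennreal (A powr q * r powr DIM('a))"
  shows "AE x in lborel. x \<in> ball x0 (r / 2) \<longrightarrow>
    u x \<le> sqrt ((unit_ball_vol DIM('a) + 1) / (c * (1 / 2) powr \<gamma>)) * A + T"
proof -
  define \<omega> where "\<omega> = unit_ball_vol (real DIM('a))"
  have \<omega>: "0 < \<omega>" by (simp add: \<omega>_def)
  \<comment> \<open>Solves c (1/2)^\<gamma> D^2 = \<omega> + 1; the two summands are the
    contributions below and above height A.\<close>
  define D where "D = sqrt ((\<omega> + 1) / (c * (1 / 2) powr \<gamma>))"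
  have D: "0 < D" using \<omega> c by (simp add: D_def)
  have pt: "(max (u x) 0)\<^sup>2 \<le> A\<^sup>2 + A powr (2 - q) * (max (u x) 0) powr q" for x
  proof (cases "max (u x) 0 \<le> A")
    case True
    then have "(max (u x) 0)\<^sup>2 \<le> A\<^sup>2" by (intro power_mono) auto
    then show ?thesis by (simp add: add_increasing2)
  next
    case False
    define s where "s = max (u x) 0"
    have s: "A < s" using False unfolding s_def by linarith
    have "s\<^sup>2 = s powr (2 - q) * s powr q" using s A by (simp add: powr_add[symmetric])
    also have "\<dots> \<le> A powr (2 - q) * s powr q" using s A q by (intro mult_right_mono powr_mono2') auto
    finally show ?thesis unfolding s_def[symmetric] by (simp add: add_increasing)
  qed
  have "AE x in lborel. x \<in> ball x0 (r / 2) \<longrightarrow> u x \<le> D * A + T / 2"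
  proof (rule DG[of _ r])
    show "0 < D * A + T / 2" using D A T by (simp add: add_pos_nonneg)
    show "T / 2 \<le> D * A + T / 2" using D A by simp
    have "(\<integral>\<^sup>+ x\<in>ball x0 r. ennreal ((max (u x) 0)\<^sup>2) \<partial>lborel)
      \<le> (\<integral>\<^sup>+ x. ennreal (A\<^sup>2) * indicator (ball x0 r) x +
            ennreal (A powr (2 - q)) * (ennreal ((max (u x) 0) powr q) * indicator (ball x0 r) x) \<partial>lborel)"
      using pt by (intro nn_integral_mono)
        (auto simp: indicator_def ennreal_mult[symmetric] ennreal_plus[symmetric] simp del: ennreal_plus intro!: ennreal_leI)
    also have "\<dots> = ennreal (A\<^sup>2) * emeasure lborel (ball x0 r) +
        ennreal (A powr (2 - q)) * (\<integral>\<^sup>+ x\<in>ball x0 r. ennreal ((max (u x) 0) powr q) \<partial>lborel)"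
      by (subst nn_integral_add) (auto simp: nn_integral_cmult)
    also have "\<dots> \<le> ennreal (A\<^sup>2) * ennreal (\<omega> * r powr DIM('a)) + ennreal (A powr (2 - q)) * ennreal (A powr q * r powr DIM('a))"
      using r by (intro add_mono mult_left_mono Q) (auto simp: emeasure_ball \<omega>_def powr_realpow)
    also have "\<dots> = ennreal (A\<^sup>2 * (\<omega> * r powr DIM('a)) + A powr (2 - q) * (A powr q * r powr DIM('a)))"
      using \<omega> by (simp add: ennreal_mult[symmetric])
    also have "A powr (2 - q) * (A powr q * r powr DIM('a)) = A\<^sup>2 * r powr DIM('a)"
      using A by (simp add: mult.assoc[symmetric] powr_add[symmetric])
    also have "A\<^sup>2 * (\<omega> * r powr DIM('a)) + A\<^sup>2 * r powr DIM('a) = (\<omega> + 1) * (A\<^sup>2 * r powr DIM('a))"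
      by (simp add: algebra_simps)
    also have "\<omega> + 1 = c * (1 / 2) powr \<gamma> * D\<^sup>2" using c \<omega> by (simp add: D_def)
    also have "c * (1 / 2) powr \<gamma> * D\<^sup>2 * (A\<^sup>2 * r powr DIM('a)) = c * (1 / 2) powr \<gamma> * ((D * A)\<^sup>2 * r powr DIM('a))"
      by (simp add: power_mult_distrib mult_ac)
    also have "ennreal \<dots> \<le> ennreal (c * (1 / 2) powr \<gamma> * ((D * A + T / 2)\<^sup>2 * r powr DIM('a)))"
      using c D A T by (intro ennreal_leI mult_left_mono mult_right_mono power_mono) auto
    also have "1 / 2 = (r - r / 2) / r" using r by simp
    finally show "(\<integral>\<^sup>+ x\<in>ball x0 r. ennreal ((max (u x) 0)\<^sup>2) \<partial>lborel)
        \<le> ennreal (c * ((r - r / 2) / r) powr \<gamma> * ((D * A + T / 2)\<^sup>2 * r powr DIM('a)))" .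
  qed (use r in auto)
  then show ?thesis by eventually_elim (use T in \<open>auto simp: D_def \<omega>_def\<close>)
qed

text \<open>With \<open>X = M + A s\<close> one has \<open>M \<le> X\<close> and \<open>A \<le> X / s\<close>, so \<open>M\<^bsup>2-q\<^esup> A\<^sup>q \<le> X\<^sup>2 s\<^bsup>-q\<^esup>\<close>: this replaces
  Young's inequality.\<close>

lemma AE_ball_bound_improve:
  fixes u :: "'a::euclidean_space \<Rightarrow> real" and c \<gamma> r T q A M s :: real
  assumes DG: "\<And>L. 0 < L \<Longrightarrow> T / 2 \<le> L \<Longrightarrow>
      (\<integral>\<^sup>+ x\<in>ball x0 \<tau>. ennreal ((max (u x) 0)\<^sup>2) \<partial>lborel) \<le> ennreal (b * (L\<^sup>2 * R)) \<Longrightarrow>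
      AE x in lborel. x \<in> ball x0 \<sigma> \<longrightarrow> u x \<le> L"
    and [measurable]: "u \<in> borel_measurable borel"
    and T: "0 \<le> T" and q: "0 < q" "q < 2" and A: "0 < A" and M: "0 < M" and \<epsilon>: "0 < \<epsilon>" and s: "0 < s" and b: "0 < b" and R: "0 \<le> R"
    and sq: "b * \<epsilon>\<^sup>2 * s powr q = 1"
    and Q: "(\<integral>\<^sup>+ x\<in>ball x0 \<tau>. ennreal ((max (u x) 0) powr q) \<partial>lborel) \<le> ennreal (A powr q * R)"
    and uM: "AE x in lborel. x \<in> ball x0 \<tau> \<longrightarrow> u x \<le> M"
  shows "AE x in lborel. x \<in> ball x0 \<sigma> \<longrightarrow> u x \<le> \<epsilon> * (M + A * s) + T / 2"
proof (rule DG)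
  define X where "X = M + A * s"
  have X: "0 < X" "M \<le> X" "A \<le> X / s" using M A s by (auto simp: X_def field_simps add_pos_pos)
  show "0 < \<epsilon> * (M + A * s) + T / 2" using \<epsilon> X T by (simp add: X_def add_pos_nonneg)
  show "T / 2 \<le> \<epsilon> * (M + A * s) + T / 2" using \<epsilon> X by (simp add: X_def)
  have pt: "(max (u x) 0)\<^sup>2 \<le> M powr (2 - q) * (max (u x) 0) powr q" if "u x \<le> M" for x
  proof (cases "u x \<le> 0")
    case False
    then have "(u x)\<^sup>2 = u x powr (2 - q) * u x powr q" by (simp add: powr_add[symmetric])
    also have "\<dots> \<le> M powr (2 - q) * u x powr q" using False that q by (intro mult_right_mono powr_mono2) auto
    finally show ?thesis using False by (simp add: max_def)
  qed (simp add: max_def)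
  have "(\<integral>\<^sup>+ x\<in>ball x0 \<tau>. ennreal ((max (u x) 0)\<^sup>2) \<partial>lborel)
    \<le> (\<integral>\<^sup>+ x. ennreal (M powr (2 - q)) * (ennreal ((max (u x) 0) powr q) * indicator (ball x0 \<tau>) x) \<partial>lborel)"
  proof (rule nn_integral_mono_AE)
    from uM show "AE x in lborel. ennreal ((max (u x) 0)\<^sup>2) * indicator (ball x0 \<tau>) x
      \<le> ennreal (M powr (2 - q)) * (ennreal ((max (u x) 0) powr q) * indicator (ball x0 \<tau>) x)"
    proof eventually_elim
      case (elim x)
      then show ?case using pt[of x]
        by (auto simp: indicator_def ennreal_mult[symmetric] intro!: ennreal_leI)
    qed
  qed
  also have "\<dots> = ennreal (M powr (2 - q)) * (\<integral>\<^sup>+ x\<in>ball x0 \<tau>. ennreal ((max (u x) 0) powr q) \<partial>lborel)"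
    by (rule nn_integral_cmult) measurable
  also have "\<dots> \<le> ennreal (M powr (2 - q)) * ennreal (A powr q * R)"
    by (intro mult_left_mono Q) auto
  also have "\<dots> = ennreal (M powr (2 - q) * A powr q * R)"
    using R by (simp add: ennreal_mult[symmetric] mult.assoc)
  also have "\<dots> \<le> ennreal (b * ((\<epsilon> * X + T / 2)\<^sup>2 * R))"
  proof (rule ennreal_leI)
    have "M powr (2 - q) * A powr q \<le> X powr (2 - q) * (X / s) powr q"
      using X M A q by (intro mult_mono powr_mono2) auto
    also have "\<dots> = (X powr (2 - q) * X powr q) * (1 / s powr q)"
      by (simp add: powr_divide)
    also have "X powr (2 - q) * X powr q = X\<^sup>2" using X by (simp add: powr_add[symmetric])
    also have "1 / s powr q = b * \<epsilon>\<^sup>2" using sq s by (simp add: field_simps)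
    also have "X\<^sup>2 * (b * \<epsilon>\<^sup>2) = b * (\<epsilon> * X)\<^sup>2" by (simp add: power_mult_distrib)
    also have "\<dots> \<le> b * (\<epsilon> * X + T / 2)\<^sup>2"
      using b \<epsilon> X T by (intro mult_left_mono power_mono) auto
    finally have "M powr (2 - q) * A powr q * R \<le> b * (\<epsilon> * X + T / 2)\<^sup>2 * R"
      by (rule mult_right_mono[OF _ R])
    then show "M powr (2 - q) * A powr q * R \<le> b * ((\<epsilon> * X + T / 2)\<^sup>2 * R)" by (simp add: mult.assoc)
  qed
  finally show "(\<integral>\<^sup>+ x\<in>ball x0 \<tau>. ennreal ((max (u x) 0)\<^sup>2) \<partial>lborel)
    \<le> ennreal (b * ((\<epsilon> * (M + A * s) + T / 2)\<^sup>2 * R))" unfolding X_def .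
qed

text \<open>The supremum on one ball is bounded through the supremum on the next larger one,
  multiplied by a small \<epsilon>. Iterating n times multiplies an a priori bound \<open>M0\<close>
  by \<epsilon>^n, which disappears in the limit. The induction treats all radii simultaneously,
  since the bound on ball i uses the one on ball i + 1.\<close>

lemma AE_ball_bound_from_powr_less_2:
  fixes u :: "'a::euclidean_space \<Rightarrow> real" and c \<gamma> r T q A :: real
  assumes DG: "\<And>\<sigma> \<tau> L. r / 2 \<le> \<sigma> \<Longrightarrow> \<sigma> < \<tau> \<Longrightarrow> \<tau> \<le> r \<Longrightarrow> 0 < L \<Longrightarrow> T / 2 \<le> L \<Longrightarrow>
      (\<integral>\<^sup>+ x\<in>ball x0 \<tau>. ennreal ((max (u x) 0)\<^sup>2) \<partial>lborel)
        \<le> ennreal (c * ((\<tau> - \<sigma>) / r) powr \<gamma> * (L\<^sup>2 * r powr DIM('a))) \<Longrightarrow>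
      AE x in lborel. x \<in> ball x0 \<sigma> \<longrightarrow> u x \<le> L"
    and [measurable]: "u \<in> borel_measurable borel"
    and c: "0 < c" and \<gamma>: "0 \<le> \<gamma>" and r: "0 < r" and T: "0 \<le> T" and q: "0 < q" "q < 2" and A: "0 < A"
    and Q: "(\<integral>\<^sup>+ x\<in>ball x0 r. ennreal ((max (u x) 0) powr q) \<partial>lborel) \<le> ennreal (A powr q * r powr DIM('a))"
    and L2: "(\<integral>\<^sup>+ x\<in>ball x0 r. ennreal ((max (u x) 0)\<^sup>2) \<partial>lborel) < \<infinity>"
  defines "g \<equiv> 2 powr (\<gamma> / q)"
  shows "AE x in lborel. x \<in> ball x0 (r / 2) \<longrightarrow>
    u x \<le> 2 * ((c * (1 / (2 * g))\<^sup>2) powr (- 1 / q) * g ^ 3) * A + T"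
proof -
  \<comment> \<open>Halving the width of the annulus multiplies the coefficient of A by g;
    \<open>\<epsilon>\<close> is chosen so that \<epsilon> g = 1/2 and the sum over steps stays
    bounded.\<close>
  define \<epsilon> where "\<epsilon> = 1 / (2 * g)"
  \<comment> \<open>With s = D g^i this solves b \<epsilon>^2 s^q = 1 for b = c 2^(-(i+3)\<gamma>);
    the 3 in the width 2^(-(i+3)) of the annulus produces \<open>g ^ 3\<close>.\<close>
  define D where "D = (c * \<epsilon>\<^sup>2) powr (- 1 / q) * g ^ 3"
  have g: "1 \<le> g" unfolding g_def using \<gamma> q by (intro ge_one_powr_ge_zero) auto
  have \<epsilon>: "0 < \<epsilon>" "\<epsilon> \<le> 1 / 2" "\<epsilon> * g = 1 / 2" using g by (auto simp: \<epsilon>_def field_simps)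
  have D: "0 < D" using c \<epsilon> g by (simp add: D_def)
  \<comment> \<open>The radii start at r/2 and stay below 3r/4, leaving room to r for the a priori
    bound.\<close>
  define \<sigma> where "\<sigma> i = r * (3 / 4 - 1 / 2 ^ (i + 2))" for i :: nat
  have \<sigma>0: "\<sigma> 0 = r / 2" by (simp add: \<sigma>_def)
  have \<sigma>_ge: "r / 2 \<le> \<sigma> i" for i
  proof -
    have "1 / 2 ^ (i + 2) \<le> (1 / 4 :: real)" by (simp add: power_add field_simps)
    then have "r * (1 / 2) \<le> \<sigma> i" unfolding \<sigma>_def using r by (intro mult_left_mono; linarith)
    then show ?thesis by simp
  qed
  have \<sigma>_le: "\<sigma> i \<le> r * (3 / 4)" for i unfolding \<sigma>_def using r by (intro mult_left_mono) auto
  have \<sigma>_diff: "(\<sigma> (Suc i) - \<sigma> i) / r = (1 / 2) ^ (i + 3)" for i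
    using r by (simp add: \<sigma>_def field_simps power_add)
  have \<sigma>_less: "\<sigma> i < \<sigma> (Suc i)" for i
  proof -
    have "0 < (\<sigma> (Suc i) - \<sigma> i) / r" unfolding \<sigma>_diff by simp
    then show ?thesis using r by (simp add: zero_less_divide_iff)
  qed
  \<comment> \<open>Only finiteness matters: \<open>DG\<close> is applied between 3r/4 and r at a
    level large enough for the finite L2 integral.\<close>
  obtain M0 where M0: "0 < M0" "AE x in lborel. x \<in> ball x0 (r * (3 / 4)) \<longrightarrow> u x \<le> M0"
  proof -
    obtain J where J: "(\<integral>\<^sup>+ x\<in>ball x0 r. ennreal ((max (u x) 0)\<^sup>2) \<partial>lborel) = ennreal J" "0 \<le> J"
      using L2 by (cases "\<integral>\<^sup>+ x\<in>ball x0 r. ennreal ((max (u x) 0)\<^sup>2) \<partial>lborel") auto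
    define e where "e = c * ((r - r * (3 / 4)) / r) powr \<gamma> * r powr DIM('a)"
    have e: "0 < e" using c r by (simp add: e_def)
    define L where "L = T / 2 + sqrt (J / e) + 1"
    have L: "0 < L" "T / 2 \<le> L" "sqrt (J / e) \<le> L" using T J e by (auto simp: L_def add_nonneg_pos)
    have "AE x in lborel. x \<in> ball x0 (r * (3 / 4)) \<longrightarrow> u x \<le> L"
    proof (rule DG[of _ r])
      have "J = e * (sqrt (J / e))\<^sup>2" using J e by simp
      also have "\<dots> \<le> e * L\<^sup>2" using e L J by (intro mult_left_mono power_mono) auto
      finally have "J \<le> c * ((r - r * (3 / 4)) / r) powr \<gamma> * (L\<^sup>2 * r powr DIM('a))"
        by (simp add: e_def mult_ac)
      then show "(\<integral>\<^sup>+ x\<in>ball x0 r. ennreal ((max (u x) 0)\<^sup>2) \<partial>lborel)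
        \<le> ennreal (c * ((r - r * (3 / 4)) / r) powr \<gamma> * (L\<^sup>2 * r powr DIM('a)))"
        unfolding J(1) by (rule ennreal_leI)
    qed (use r L in auto)
    then show ?thesis using L(1) that by blast
  qed
  have bnd: "AE x in lborel. x \<in> ball x0 (\<sigma> i) \<longrightarrow> u x \<le> \<epsilon> ^ n * M0 + 2 * D * g ^ i * A + T" for i n
  proof (induction n arbitrary: i)
    case 0
    from M0(2) show ?case
    proof eventually_elim
      case (elim x)
      have "0 \<le> 2 * D * g ^ i * A" using D g A by simp
      moreover have "u x \<le> M0" if "x \<in> ball x0 (\<sigma> i)" using elim that \<sigma>_le[of i] by auto
      ultimately show ?case unfolding power_0 mult_1 using T by (intro impI) linarith
    qed
  next
    case (Suc n)
    define M where "M = \<epsilon> ^ n * M0 + 2 * D * g ^ Suc i * A + T"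
    have M: "0 < M" unfolding M_def using \<epsilon> M0 D g A T by (intro add_pos_nonneg) auto
    have improved: "AE x in lborel. x \<in> ball x0 (\<sigma> i) \<longrightarrow> u x \<le> \<epsilon> * (M + A * (D * g ^ i)) + T / 2"
    proof (rule AE_ball_bound_improve[where b="c * ((\<sigma> (Suc i) - \<sigma> i) / r) powr \<gamma>" and R="r powr DIM('a)" and q=q and \<tau>="\<sigma> (Suc i)"])
      show "AE x in lborel. x \<in> ball x0 (\<sigma> i) \<longrightarrow> u x \<le> L" if "0 < L" "T / 2 \<le> L"
        "(\<integral>\<^sup>+ x\<in>ball x0 (\<sigma> (Suc i)). ennreal ((max (u x) 0)\<^sup>2) \<partial>lborel)
          \<le> ennreal (c * ((\<sigma> (Suc i) - \<sigma> i) / r) powr \<gamma> * (L\<^sup>2 * r powr DIM('a)))" for L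
        using that \<sigma>_le[of "Suc i"] r by (intro DG[of "\<sigma> i" "\<sigma> (Suc i)"] \<sigma>_ge \<sigma>_less) auto
      show "0 < D * g ^ i" using D g by simp
      show "0 < c * ((\<sigma> (Suc i) - \<sigma> i) / r) powr \<gamma>" unfolding \<sigma>_diff using c by simp
      have "(D * g ^ i) powr q = (c * \<epsilon>\<^sup>2) powr (- 1) * (g ^ (i + 3)) powr q"
        unfolding D_def using c \<epsilon> g q by (simp add: powr_mult powr_powr power_add mult_ac)
      also have "(g ^ (i + 3)) powr q = (2 ^ (i + 3)) powr \<gamma>"
      proof -
        have "g ^ (i + 3) = 2 powr (\<gamma> / q * real (i + 3))"
          unfolding g_def by (subst powr_realpow[symmetric]) (simp_all add: powr_powr)
        moreover have "(2::real) ^ (i + 3) = 2 powr real (i + 3)" by (rule powr_realpow[symmetric]) simp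
        ultimately show ?thesis using q by (simp add: powr_powr mult.commute del: of_nat_add)
      qed
      finally have "(D * g ^ i) powr q = (c * \<epsilon>\<^sup>2) powr (- 1) * (2 ^ (i + 3)) powr \<gamma>" .
      moreover have "((1 / 2) ^ (i + 3)) powr \<gamma> * (2 ^ (i + 3)) powr \<gamma> = (1::real)"
        by (simp add: powr_mult[symmetric] power_mult_distrib[symmetric])
      moreover have "(c * \<epsilon>\<^sup>2) powr (- 1) = 1 / (c * \<epsilon>\<^sup>2)" using c \<epsilon> by (simp add: powr_minus_divide)
      moreover have "c * P * \<epsilon>\<^sup>2 * (1 / (c * \<epsilon>\<^sup>2) * P') = P * P'" for P P' :: real
        using c \<epsilon> by simp
      ultimately show "c * ((\<sigma> (Suc i) - \<sigma> i) / r) powr \<gamma> * \<epsilon>\<^sup>2 * (D * g ^ i) powr q = 1"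
        unfolding \<sigma>_diff by metis
      have "(\<integral>\<^sup>+ x\<in>ball x0 (\<sigma> (Suc i)). ennreal ((max (u x) 0) powr q) \<partial>lborel)
        \<le> (\<integral>\<^sup>+ x\<in>ball x0 r. ennreal ((max (u x) 0) powr q) \<partial>lborel)"
        using \<sigma>_le[of "Suc i"] r by (intro nn_integral_mono) (auto simp: indicator_def)
      then show "(\<integral>\<^sup>+ x\<in>ball x0 (\<sigma> (Suc i)). ennreal ((max (u x) 0) powr q) \<partial>lborel) \<le> ennreal (A powr q * r powr DIM('a))"
        using Q by (rule order_trans)
      show "AE x in lborel. x \<in> ball x0 (\<sigma> (Suc i)) \<longrightarrow> u x \<le> M" unfolding M_def by (rule Suc)
    qed (use T q A M \<epsilon> r in auto)
    \<comment> \<open>For A the coefficients 1 and at most 1/2 add up to less than 2. For T the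
      bound \<epsilon> \<le> 1/2 together with the 1/2 from the level condition gives exactly one,
      so the tail does not grow along the iteration.\<close>
    have le: "\<epsilon> * (M + A * (D * g ^ i)) + T / 2 \<le> \<epsilon> ^ Suc n * M0 + 2 * D * g ^ i * A + T"
    proof -
      have "\<epsilon> * (M + A * (D * g ^ i)) + T / 2 = \<epsilon> ^ Suc n * M0 + (\<epsilon> * g) * (2 * (D * g ^ i * A)) + \<epsilon> * T + \<epsilon> * (D * g ^ i * A) + T / 2"
        by (simp add: M_def algebra_simps)
      also have "\<dots> \<le> \<epsilon> ^ Suc n * M0 + (1 / 2) * (2 * (D * g ^ i * A)) + (1 / 2) * T + (1 / 2) * (D * g ^ i * A) + T / 2"
        unfolding \<epsilon>(3) using \<epsilon> T D g A by (intro add_mono order_refl mult_right_mono) auto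
      also have "\<dots> \<le> \<epsilon> ^ Suc n * M0 + 2 * D * g ^ i * A + T"
      proof -
        have "0 \<le> D * g ^ i * A" using D g A by simp
        then show ?thesis by linarith
      qed
      finally show ?thesis .
    qed
    from improved show ?case by eventually_elim (use le in \<open>meson order_trans\<close>)
  qed
  have "AE x in lborel. \<forall>n. x \<in> ball x0 (\<sigma> 0) \<longrightarrow> u x \<le> \<epsilon> ^ n * M0 + 2 * D * g ^ 0 * A + T"
    unfolding AE_all_countable by (intro allI bnd)
  then show ?thesis
  proof eventually_elim
    case (elim x)
    show ?case
    proof
      assume "x \<in> ball x0 (r / 2)"
      then have le: "u x \<le> \<epsilon> ^ n * M0 + 2 * D * A + T" for n using elim \<sigma>0 by simp
      have "(\<lambda>n. \<epsilon> ^ n * M0 + 2 * D * A + T) \<longlonglongrightarrow> 0 * M0 + 2 * D * A + T"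
        using \<epsilon> by (intro tendsto_intros LIMSEQ_power_zero) auto
      then have "u x \<le> 0 * M0 + 2 * D * A + T" by (rule LIMSEQ_le_const) (use le in auto)
      then show "u x \<le> 2 * ((c * (1 / (2 * g))\<^sup>2) powr (- 1 / q) * g ^ 3) * A + T"
        by (simp add: D_def \<epsilon>_def)
    qed
  qed
qed

section \<open>The local boundedness estimate\<close>

text \<open>A null set in one variable stays null in either coordinate of the product. With the two
  following lemmas this allows u to be replaced by a Borel representative.\<close>

lemma energy_cong_AE:
  assumes "AE x in lborel. u x = v x"
  shows "energy k U u = energy k U v"
proof -
  have "AE p in lebesgue \<Otimes>\<^sub>M lebesgue. u (fst p) = v (fst p) \<and> u (snd p) = v (snd p)"
    by (intro AE_pair_lebesgue AE_pair_lborel_fst_snd assms)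
  then show ?thesis unfolding energy_def by (intro nn_integral_cong_AE) auto
qed

lemma Hspace_cong_AE:
  fixes u v :: "'a::euclidean_space \<Rightarrow> real"
  assumes uv: "AE x in lborel. u x = v x" and u: "u \<in> Hspace k" and v: "v \<in> borel_measurable borel"
  shows "v \<in> Hspace k"
proof -
  have v': "v \<in> borel_measurable lebesgue" using v by (intro measurable_completion) simp
  have "AE x in lebesgue. u x = v x" using uv by (rule AE_completion)
  then have "AE x in lebesgue. (u x)\<^sup>2 = (v x)\<^sup>2" by eventually_elim simp
  moreover have u2: "integrable lebesgue (\<lambda>x. (u x)\<^sup>2)" using u by (simp add: Hspace_def)
  ultimately have "integrable lebesgue (\<lambda>x. (v x)\<^sup>2)"
    using v' borel_measurable_integrable[OF u2] by (subst integrable_cong_AE[symmetric]) auto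
  then show ?thesis using u v' energy_cong_AE[OF uv, of k UNIV] by (simp add: Hspace_def)
qed

lemma Eform_cong_AE:
  fixes u v :: "'a::euclidean_space \<Rightarrow> real"
  assumes uv: "AE x in lborel. u x = v x" and k: "kernel_ok k"
    and [measurable]: "u \<in> borel_measurable lebesgue" "v \<in> borel_measurable lebesgue" "\<phi> \<in> borel_measurable lebesgue"
  shows "Eform k UNIV u \<phi> = Eform k UNIV v \<phi>"
proof -
  have [measurable]: "(\<lambda>p. k (fst p) (snd p)) \<in> borel_measurable (lebesgue \<Otimes>\<^sub>M lebesgue)"
  proof (rule measurable_compose[OF measurable_ident_pair_lebesgue])
    show "(\<lambda>p. k (fst p) (snd p)) \<in> borel_measurable (lborel \<Otimes>\<^sub>M lborel)"
      using k by (simp add: kernel_ok_def)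
  qed
  have "AE p in lebesgue \<Otimes>\<^sub>M lebesgue. u (fst p) = v (fst p) \<and> u (snd p) = v (snd p)"
    by (intro AE_pair_lebesgue AE_pair_lborel_fst_snd uv)
  then show ?thesis
    unfolding Eform_def UNIV_Times_UNIV indicator_UNIV mult_1 by (intro integral_cong_AE) auto
qed

theorem mainTheorem13:
  fixes \<alpha>0 q cl cK :: real
  assumes "DIM('a::euclidean_space) \<ge> 3"
    and "0 < \<alpha>0" and "\<alpha>0 < 2" and "cl > 0" and "cK > 0" and "q > 1"
  shows "\<exists>C>0. \<forall>(\<alpha>::real) (k::'a \<Rightarrow> 'a \<Rightarrow> real) (x0::'a) (r::real) (u::'a \<Rightarrow> real).
     \<alpha>0 \<le> \<alpha> \<and> \<alpha> < 2 \<and> kernel_ok k \<and> cond_E_ge k \<alpha> cl \<and> cond_U2 k \<alpha> cK \<and>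
     r > 0 \<and> u \<in> Hspace k \<and>
     (\<forall>\<phi>\<in>Hspace0 k (ball x0 r). (AE x in lebesgue. \<phi> x \<ge> 0) \<longrightarrow> Eform k UNIV u \<phi> \<le> 0) \<and>
     (\<integral>\<^sup>+ x\<in>ball x0 r. ennreal ((max (u x) 0) powr q) \<partial>lebesgue) < \<infinity> \<and>
     (\<integral>\<^sup>+ y\<in>- ball x0 (r/2). ennreal (max (u y) 0 / norm (y - x0) powr (real DIM('a) + \<alpha>)) \<partial>lebesgue) < \<infinity>
     \<longrightarrow>
     esssup (restrict_space lebesgue (ball x0 (r/2))) (\<lambda>x. ereal (u x)) \<le>
       ereal (C * ((enn2real (\<integral>\<^sup>+ x\<in>ball x0 r. ennreal ((max (u x) 0) powr q) \<partial>lebesgue)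
                      / measure lebesgue (ball x0 r)) powr (1 / q))
              + r powr \<alpha> * enn2real (\<integral>\<^sup>+ y\<in>- ball x0 (r/2).
                  ennreal (max (u y) 0 / norm (y - x0) powr (real DIM('a) + \<alpha>)) \<partial>lebesgue))"
proof -
  let ?d = "real DIM('a)"
  obtain CF where CF: "CF > 0" "\<And>\<alpha> (v :: 'a \<Rightarrow> real) S m. \<alpha>0 \<le> \<alpha> \<Longrightarrow> \<alpha> < 2 \<Longrightarrow>
      v \<in> borel_measurable borel \<Longrightarrow> S \<in> sets borel \<Longrightarrow> 0 \<le> m \<Longrightarrow>
      emeasure lborel S \<le> ennreal m \<Longrightarrow> (\<And>x. x \<notin> S \<Longrightarrow> v x = 0) \<Longrightarrow>
      (\<integral>\<^sup>+ x. ennreal ((v x)\<^sup>2) \<partial>lborel) \<le> ennreal (CF * m powr (\<alpha> / ?d)) * energy (frac_kernel \<alpha>) UNIV v"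
    using faber_krahn_frac[OF \<open>0 < \<alpha>0\<close>, where 'a='a] by blast
  define C0 where "C0 = max 1 (CF / cl * cK * (2 powr (?d + 4) * (2 * unit_ball_vol ?d + 1)) * 2 powr (2 * ?d + 9))"
  define c where "c = C0 powr (- ?d / \<alpha>0) * (2 powr (?d + 5)) powr (- ?d\<^sup>2 / \<alpha>0\<^sup>2)"
  have c: "0 < c" by (simp add: c_def C0_def)
  define \<gamma> where "\<gamma> = ?d * (?d + 2) / \<alpha>0"
  have \<gamma>: "0 \<le> \<gamma>" using assms by (simp add: \<gamma>_def)
  define \<omega> where "\<omega> = unit_ball_vol ?d"
  have \<omega>: "0 < \<omega>" by (simp add: \<omega>_def)
  define g where "g = 2 powr (\<gamma> / q)"
  \<comment> \<open>Assembled from d, q, cl, cK and \<alpha>0 only, before \<alpha>, k, r and u are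
    introduced.\<close>
  define D where "D = (if q < 2 then 2 * ((c * (1 / (2 * g))\<^sup>2) powr (- 1 / q) * g ^ 3)
    else sqrt ((\<omega> + 1) / (c * (1 / 2) powr \<gamma>)))"
  have D: "0 < D" using c \<omega> by (simp add: D_def g_def)
  show ?thesis
  proof (intro exI[of _ "D * \<omega> powr (1 / q)"] conjI allI impI; (elim conjE)?)
    show "0 < D * \<omega> powr (1 / q)" using D \<omega> by simp
    fix \<alpha> r :: real and k :: "'a \<Rightarrow> 'a \<Rightarrow> real" and x0 :: 'a and u :: "'a \<Rightarrow> real"
    assume \<alpha>: "\<alpha>0 \<le> \<alpha>" "\<alpha> < 2" and k: "kernel_ok k" "cond_E_ge k \<alpha> cl" "cond_U2 k \<alpha> cK" and r: "0 < r"
      and u: "u \<in> Hspace k"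
      and sub: "\<forall>\<phi>\<in>Hspace0 k (ball x0 r). (AE x in lebesgue. \<phi> x \<ge> 0) \<longrightarrow> Eform k UNIV u \<phi> \<le> 0"
      and Qfin: "(\<integral>\<^sup>+ x\<in>ball x0 r. ennreal ((max (u x) 0) powr q) \<partial>lebesgue) < \<infinity>"
      and Tfin: "(\<integral>\<^sup>+ y\<in>- ball x0 (r/2). ennreal (max (u y) 0 / norm (y - x0) powr (?d + \<alpha>)) \<partial>lebesgue) < \<infinity>"
    let ?Q = "\<integral>\<^sup>+ x\<in>ball x0 r. ennreal ((max (u x) 0) powr q) \<partial>lebesgue"
    let ?T = "\<integral>\<^sup>+ y\<in>- ball x0 (r/2). ennreal (max (u y) 0 / norm (y - x0) powr (?d + \<alpha>)) \<partial>lebesgue"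
    define T where "T = r powr \<alpha> * enn2real ?T"
    have T: "0 \<le> T" by (simp add: T_def)
    have um [measurable]: "u \<in> borel_measurable lebesgue" using u by (simp add: Hspace_def)
    then obtain u' where u'm [measurable]: "u' \<in> borel_measurable borel" and uu': "AE x in lborel. u x = u' x"
      using completion_ex_borel_measurable_real[of u lborel] by auto
    have u'm': "u' \<in> borel_measurable lebesgue" by (intro measurable_completion) simp
    have Q': "(\<integral>\<^sup>+ x\<in>ball x0 r. ennreal ((max (u' x) 0) powr q) \<partial>lborel) = ?Q"
      unfolding nn_integral_completion using uu' by (intro nn_integral_cong_AE) auto
    have T': "(\<integral>\<^sup>+ y\<in>- ball x0 (r/2). ennreal (max (u' y) 0 / norm (y - x0) powr (?d + \<alpha>)) \<partial>lborel) = ?T"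
      unfolding nn_integral_completion using uu' by (intro nn_integral_cong_AE) auto
    interpret S: nonlocal_subsolution k \<alpha> cl cK r T x0 u'
    proof
      show "u' \<in> Hspace k" by (rule Hspace_cong_AE[OF uu' u u'm])
      show "Eform k UNIV u' \<phi> \<le> 0" if "\<phi> \<in> Hspace0 k (ball x0 r)" "AE x in lebesgue. 0 \<le> \<phi> x" for \<phi>
        using sub that Eform_cong_AE[OF uu' k(1) um u'm', of \<phi>] by (auto simp: Hspace0_def Hspace_def)
      have "r powr (- \<alpha>) * T = enn2real ?T"
        unfolding T_def using r by (simp add: mult.assoc[symmetric] powr_add[symmetric])
      then show "(\<integral>\<^sup>+ y\<in>- ball x0 (r/2). ennreal (max (u' y) 0 / norm (y - x0) powr (?d + \<alpha>)) \<partial>lborel)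
        \<le> ennreal (r powr (- \<alpha>) * T)" unfolding T' using Tfin by simp
      show "2 \<le> DIM('a)" using assms by linarith
      show "0 < \<alpha>" using assms \<alpha> by linarith
    qed (fact+)
    have DG: "AE x in lborel. x \<in> ball x0 \<sigma> \<longrightarrow> u' x \<le> L"
      if "r / 2 \<le> \<sigma>" "\<sigma> < \<tau>" "\<tau> \<le> r" "0 < L" "T / 2 \<le> L"
        "(\<integral>\<^sup>+ x\<in>ball x0 \<tau>. ennreal ((max (u' x) 0)\<^sup>2) \<partial>lborel)
          \<le> ennreal (c * ((\<tau> - \<sigma>) / r) powr \<gamma> * (L\<^sup>2 * r powr ?d))" for \<sigma> \<tau> L
    proof (rule S.de_giorgi_bound[where CF=CF and ?\<alpha>0.0=\<alpha>0 and \<tau>=\<tau>])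
      show "(\<integral>\<^sup>+ x. ennreal ((v x)\<^sup>2) \<partial>lborel) \<le> ennreal (CF * m powr (\<alpha> / DIM('a))) * energy (frac_kernel \<alpha>) UNIV v"
        if "v \<in> borel_measurable borel" "S \<in> sets borel" "0 \<le> m" "emeasure lborel S \<le> ennreal m"
          "\<And>x. x \<notin> S \<Longrightarrow> v x = 0" for v :: "'a \<Rightarrow> real" and S m
        by (rule CF(2)[OF \<alpha> that])
      show "(\<integral>\<^sup>+ x\<in>ball x0 \<tau>. ennreal ((max (u' x) 0)\<^sup>2) \<partial>lborel)
        \<le> ennreal (max 1 (CF / cl * cK * (2 powr (?d + 4) * (2 * unit_ball_vol ?d + 1)) * 2 powr (2 * ?d + 9)) powr (- ?d / \<alpha>0) *
          (2 powr (?d + 5)) powr (- ?d\<^sup>2 / \<alpha>0\<^sup>2) * ((\<tau> - \<sigma>) / r) powr (?d * (?d + 2) / \<alpha>0) * (L\<^sup>2 * r powr ?d))"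
        using that(6) unfolding c_def C0_def \<gamma>_def .
    qed (fact CF(1) assms \<alpha>(1) that)+
    have L2: "(\<integral>\<^sup>+ x\<in>ball x0 r. ennreal ((max (u' x) 0)\<^sup>2) \<partial>lborel) < \<infinity>"
    proof -
      have "(max (u' x) 0)\<^sup>2 \<le> (u' x)\<^sup>2" for x by (intro abs_le_square_iff[THEN iffD1]) auto
      then have "(\<integral>\<^sup>+ x\<in>ball x0 r. ennreal ((max (u' x) 0)\<^sup>2) \<partial>lborel) \<le> (\<integral>\<^sup>+ x. ennreal ((u' x)\<^sup>2) \<partial>lborel)"
        by (intro nn_integral_mono) (auto simp: indicator_def intro!: ennreal_leI)
      then show ?thesis using S.u_L2 by (rule le_less_trans)
    qed
    \<comment> \<open>\<open>A0\<close> is the normalised mean of the theorem. The factor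
      \<open>\<omega> powr (1 / q)\<close> in \<open>A1\<close> replaces the volume of the ball by
      r^d, the normalisation of the two preceding bounds.\<close>
    define A0 where "A0 = (enn2real ?Q / measure lebesgue (ball x0 r)) powr (1 / q)"
    define A1 where "A1 = \<omega> powr (1 / q) * A0"
    have A1: "0 \<le> A1" by (simp add: A1_def A0_def)
    have A1q: "A1 powr q * r powr ?d = enn2real ?Q"
    proof -
      have "measure lebesgue (ball x0 r) = \<omega> * r powr ?d"
        using r content_ball[of r x0] by (simp add: \<omega>_def powr_realpow)
      then show ?thesis using \<omega> r assms by (simp add: A1_def A0_def powr_mult powr_powr)
    qed
    \<comment> \<open>The bounds need a positive A, while \<open>A1\<close> vanishes when u is
      nonpositive almost everywhere on the ball. Hence every A above \<open>A1\<close> is used, and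
      then A tends to \<open>A1\<close> along a sequence.\<close>
    have bound: "AE x in lborel. x \<in> ball x0 (r / 2) \<longrightarrow> u' x \<le> D * A + T" if A: "A1 < A" for A
    proof -
      have A0: "0 < A" using A A1 by simp
      have "A1 powr q * r powr ?d \<le> A powr q * r powr ?d"
        using A A1 assms by (intro mult_right_mono powr_mono2) auto
      then have "enn2real ?Q \<le> A powr q * r powr ?d" unfolding A1q .
      then have Q: "(\<integral>\<^sup>+ x\<in>ball x0 r. ennreal ((max (u' x) 0) powr q) \<partial>lborel) \<le> ennreal (A powr q * r powr ?d)"
        unfolding Q' using Qfin by (metis ennreal_enn2real_if ennreal_leI infinity_ennreal_def less_irrefl)
      show ?thesis
      proof (cases "q < 2")
        case True
        then show ?thesis
          using AE_ball_bound_from_powr_less_2[OF DG u'm c \<gamma> r T _ True A0 Q L2] assms by (simp add: D_def g_def)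
      next
        case False
        then show ?thesis
          using AE_ball_bound_from_powr_ge_2[OF DG u'm c r T _ A0 Q] by (simp add: D_def \<omega>_def)
      qed
    qed
    have "AE x in lborel. \<forall>n. x \<in> ball x0 (r / 2) \<longrightarrow> u' x \<le> D * (A1 + 1 / real (Suc n)) + T"
      unfolding AE_all_countable by (intro allI bound) simp
    with uu' have "AE x in lborel. x \<in> ball x0 (r / 2) \<longrightarrow> u x \<le> D * A1 + T"
    proof eventually_elim
      case (elim x)
      show ?case
      proof
        assume "x \<in> ball x0 (r / 2)"
        then have le: "u x \<le> D * (A1 + 1 / real (Suc n)) + T" for n using elim by auto
        have "(\<lambda>n. D * (A1 + 1 / real (Suc n)) + T) \<longlonglongrightarrow> D * (A1 + 0) + T"
          by (intro tendsto_intros LIMSEQ_Suc lim_1_over_n)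
        then have "u x \<le> D * (A1 + 0) + T" by (rule LIMSEQ_le_const) (use le in auto)
        then show "u x \<le> D * A1 + T" by simp
      qed
    qed
    then have "AE x in lebesgue. x \<in> ball x0 (r / 2) \<longrightarrow> u x \<le> D * A1 + T" by (rule AE_completion)
    then have "AE x in restrict_space lebesgue (ball x0 (r / 2)). u x \<le> D * A1 + T"
      by (subst AE_restrict_space_iff) auto
    then have "esssup (restrict_space lebesgue (ball x0 (r / 2))) (\<lambda>x. ereal (u x)) \<le> ereal (D * A1 + T)"
      by (intro esssup_I) (auto intro!: borel_measurable_ereal measurable_restrict_space1 um)
    then show "esssup (restrict_space lebesgue (ball x0 (r / 2))) (\<lambda>x. ereal (u x)) \<le>
       ereal (D * \<omega> powr (1 / q) * ((enn2real ?Q / measure lebesgue (ball x0 r)) powr (1 / q))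
         + r powr \<alpha> * enn2real ?T)"
      by (simp add: A1_def A0_def T_def mult.assoc)
  qed
qed

end
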